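(* Let $R$ be any set with two or more elements and let $g$ be a pure state on $C^*_r(F_R)$. Then the hereditary kernel of $g$, namely $$\{a \in C^*_r(F_R) : g(a^*a+aa^* )=0\},$$ contains a sequential abelian approximate unit (for itself), and hence contains a strictly positive element (of itself).
   Context: $F_R$ denotes the free group on the set $R$, and $C^*_r(F_R)$ its reduced group C*-algebra; $R$ may have any cardinality $\geq 2$. The hereditary kernel of a state $g$ on a C*-algebra $A$ is the hereditary C*-subalgebra $\{a\in A : g(a^*a+aa^* )=0\}$. A sequential abelian approximate unit is an approximate unit that is a sequence of mutually commuting elements. *)

theory Defs
  imports "HOL-Analysis.Analysis" "HOL-Algebra.Group"
begin

section \<open>The free group on a set\<close>

text \<open>A letter \<open>(r, True)\<close> stands for the generator \<open>r\<close>, and \<open>(r, False)\<close> for its inverse.\<close>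

type_synonym 'r letter = "'r \<times> bool"

definition inv_letter :: "'r letter \<Rightarrow> 'r letter" where
  "inv_letter x = (fst x, \<not> snd x)"

definition reduced_word :: "'r letter list \<Rightarrow> bool" where
  "reduced_word w \<longleftrightarrow> successively (\<lambda>x y. y \<noteq> inv_letter x) w"

fun letter_mult :: "'r letter \<Rightarrow> 'r letter list \<Rightarrow> 'r letter list" where
  "letter_mult x [] = [x]"
| "letter_mult x (y # w) = (if y = inv_letter x then w else x # y # w)"

definition free_group :: "'r set \<Rightarrow> 'r letter list monoid" where
  "free_group R =
    \<lparr>carrier = {w. set w \<subseteq> R \<times> UNIV \<and> reduced_word w},
     mult = (\<lambda>u v. foldr letter_mult u v),
     one = []\<rparr>"

lemma inv_letter_inv_letter [simp]: "inv_letter (inv_letter x) = x"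
  by (simp add: inv_letter_def)

lemma inv_letter_neq [simp]: "inv_letter x \<noteq> x" "x \<noteq> inv_letter x"
  by (simp_all add: inv_letter_def prod_eq_iff)

lemma reduced_word_Cons:
  "reduced_word (x # w) \<longleftrightarrow> reduced_word w \<and> (w = [] \<or> hd w \<noteq> inv_letter x)"
  by (auto simp: reduced_word_def successively_Cons)

lemma reduced_word_Nil [simp]: "reduced_word []"
  by (simp add: reduced_word_def)

lemma reduced_letter_mult: "reduced_word w \<Longrightarrow> reduced_word (letter_mult x w)"
  by (cases w) (auto simp: reduced_word_Cons)

lemma reduced_foldr: "reduced_word w \<Longrightarrow> reduced_word (foldr letter_mult u w)"
  by (induction u) (auto intro: reduced_letter_mult)

lemma letter_mult_cancel:
  assumes "reduced_word w"
  shows "letter_mult x (letter_mult (inv_letter x) w) = w"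
  using assms by (cases w; cases "tl w") (auto simp: reduced_word_Cons)

lemma set_letter_mult: "set (letter_mult x w) \<subseteq> insert x (set w)"
  by (cases w) auto

lemma set_foldr: "set (foldr letter_mult u w) \<subseteq> set u \<union> set w"
proof (induction u)
  case (Cons x u)
  then show ?case using set_letter_mult[of x "foldr letter_mult u w"] by auto
qed simp

lemma foldr_letter_mult:
  assumes "reduced_word w"
  shows "foldr letter_mult (letter_mult x v) w = letter_mult x (foldr letter_mult v w)"
proof (cases v)
  case (Cons y ys)
  then show ?thesis
    using letter_mult_cancel[OF reduced_foldr[OF assms], of x ys] by auto
qed simp

lemma foldr_assoc:
  assumes "reduced_word w"
  shows "foldr letter_mult (foldr letter_mult u v) w = foldr letter_mult u (foldr letter_mult v w)"
  by (induction u) (simp_all add: foldr_letter_mult assms)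

lemma foldr_left_inverse: "foldr letter_mult (rev (map inv_letter u)) u = []"
  by (induction u) simp_all

lemma reduced_inverse:
  assumes "reduced_word u"
  shows "reduced_word (rev (map inv_letter u))"
  using assms unfolding reduced_word_def successively_rev successively_map
  by (rule successively_mono) auto

lemma group_free_group: "group (free_group R)"
proof (rule groupI)
  fix u v assume "u \<in> carrier (free_group R)" "v \<in> carrier (free_group R)"
  then show "u \<otimes>\<^bsub>free_group R\<^esub> v \<in> carrier (free_group R)"
    using set_foldr[of u v] by (auto simp: free_group_def reduced_foldr)
next
  fix u assume "u \<in> carrier (free_group R)"
  then show "\<exists>v\<in>carrier (free_group R). v \<otimes>\<^bsub>free_group R\<^esub> u = \<one>\<^bsub>free_group R\<^esub>"
    by (intro bexI[of _ "rev (map inv_letter u)"])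
      (auto simp: free_group_def foldr_left_inverse reduced_inverse inv_letter_def)
qed (auto simp: free_group_def foldr_assoc reduced_word_def)


section \<open>The Hilbert space of square-summable families\<close>

typedef 'a ell2 = "{f :: 'a \<Rightarrow> complex. (\<lambda>x. (cmod (f x))\<^sup>2) summable_on UNIV}"
  morphisms ell2_coeff Abs_ell2
  by (rule exI[of _ "\<lambda>_. 0"]) simp

setup_lifting type_definition_ell2

lemma ell2_coeff_summable: "(\<lambda>x. (cmod (ell2_coeff f x))\<^sup>2) summable_on UNIV"
  using ell2_coeff[of f] by simp

lemma ell2_eqI: "(\<And>x. ell2_coeff f x = ell2_coeff g x) \<Longrightarrow> f = g"
  by (simp add: ell2_coeff_inject[symmetric] fun_eq_iff)

lemma square_summable_mult:
  fixes f g :: "'a \<Rightarrow> complex"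
  assumes "(\<lambda>x. (cmod (f x))\<^sup>2) summable_on A" "(\<lambda>x. (cmod (g x))\<^sup>2) summable_on A"
  shows "(\<lambda>x. cmod (cnj (f x) * g x)) summable_on A"
proof (rule Infinite_Sum.abs_summable_on_comparison_test'[OF summable_on_add[OF assms]])
  fix x
  show "cmod (cnj (f x) * g x) \<le> (cmod (f x))\<^sup>2 + (cmod (g x))\<^sup>2"
  proof -
    have "2 * (cmod (f x) * cmod (g x)) \<le> (cmod (f x))\<^sup>2 + (cmod (g x))\<^sup>2"
      using sum_squares_bound[of "cmod (f x)" "cmod (g x)"] by (simp only: mult.assoc)
    moreover have "0 \<le> cmod (f x) * cmod (g x)"
      by simp
    ultimately show ?thesis
      unfolding norm_mult complex_mod_cnj by linarith
  qed
qed

lemma square_summable_add: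
  fixes f g :: "'a \<Rightarrow> complex"
  assumes "(\<lambda>x. (cmod (f x))\<^sup>2) summable_on A" "(\<lambda>x. (cmod (g x))\<^sup>2) summable_on A"
  shows "(\<lambda>x. (cmod (f x + g x))\<^sup>2) summable_on A"
proof -
  have "(\<lambda>x. 2 * (cmod (f x))\<^sup>2 + 2 * (cmod (g x))\<^sup>2) summable_on A"
    by (intro summable_on_add summable_on_cmult_right assms)
  then have "(\<lambda>x. norm ((cmod (f x + g x))\<^sup>2)) summable_on A"
  proof (rule Infinite_Sum.abs_summable_on_comparison_test')
    fix x
    have "(cmod (f x + g x))\<^sup>2 \<le> (cmod (f x) + cmod (g x))\<^sup>2"
      by (intro power_mono norm_triangle_ineq) simp
    also have "\<dots> \<le> 2 * (cmod (f x))\<^sup>2 + 2 * (cmod (g x))\<^sup>2"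
      using sum_squares_bound[of "cmod (f x)" "cmod (g x)"] unfolding power2_sum by linarith
    finally show "norm ((cmod (f x + g x))\<^sup>2) \<le> 2 * (cmod (f x))\<^sup>2 + 2 * (cmod (g x))\<^sup>2"
      by simp
  qed
  then show ?thesis by simp
qed

lemma square_summable_cmult:
  fixes f :: "'a \<Rightarrow> complex"
  assumes "(\<lambda>x. (cmod (f x))\<^sup>2) summable_on A"
  shows "(\<lambda>x. (cmod (c * f x))\<^sup>2) summable_on A"
  using summable_on_cmult_right[OF assms, of "(cmod c)\<^sup>2"]
  by (simp add: norm_mult power_mult_distrib)

lift_definition ell2_scaleC :: "complex \<Rightarrow> 'a ell2 \<Rightarrow> 'a ell2" is "\<lambda>c f x. c * f x"
  by (rule square_summable_cmult)

lift_definition ell2_cinner :: "'a ell2 \<Rightarrow> 'a ell2 \<Rightarrow> complex"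
  is "\<lambda>f g. \<Sum>\<^sub>\<infinity>x. cnj (f x) * g x" .

instantiation ell2 :: (type) real_vector
begin

lift_definition zero_ell2 :: "'a ell2" is "\<lambda>_. 0" by simp

lift_definition plus_ell2 :: "'a ell2 \<Rightarrow> 'a ell2 \<Rightarrow> 'a ell2" is "\<lambda>f g x. f x + g x"
  by (rule square_summable_add)

lift_definition uminus_ell2 :: "'a ell2 \<Rightarrow> 'a ell2" is "\<lambda>f x. - f x" by simp

lift_definition minus_ell2 :: "'a ell2 \<Rightarrow> 'a ell2 \<Rightarrow> 'a ell2" is "\<lambda>f g x. f x - g x"
  by (drule (1) square_summable_add[where g = "\<lambda>x. - g x" for g, rotated, simplified]) simp

definition scaleR_ell2 :: "real \<Rightarrow> 'a ell2 \<Rightarrow> 'a ell2" where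
  "scaleR_ell2 r f = ell2_scaleC (complex_of_real r) f"

instance
proof
  fix f g h :: "'a ell2" and r s :: real
  show "f + g + h = f + (g + h)" "f + g = g + f" "0 + f = f" "- f + f = 0" "f - g = f + - g"
    by (transfer; simp add: fun_eq_iff)+
  show "r *\<^sub>R (f + g) = r *\<^sub>R f + r *\<^sub>R g" "(r + s) *\<^sub>R f = r *\<^sub>R f + s *\<^sub>R f"
    "r *\<^sub>R s *\<^sub>R f = (r * s) *\<^sub>R f" "1 *\<^sub>R f = f"
    unfolding scaleR_ell2_def by (transfer; simp add: fun_eq_iff algebra_simps)+
qed

end

instantiation ell2 :: (type) real_inner
begin

definition inner_ell2 :: "'a ell2 \<Rightarrow> 'a ell2 \<Rightarrow> real" where
  "inner_ell2 f g = Re (ell2_cinner f g)"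

definition norm_ell2 :: "'a ell2 \<Rightarrow> real" where
  "norm_ell2 f = sqrt (inner f f)"

definition sgn_ell2 :: "'a ell2 \<Rightarrow> 'a ell2" where
  "sgn_ell2 f = f /\<^sub>R norm f"

definition dist_ell2 :: "'a ell2 \<Rightarrow> 'a ell2 \<Rightarrow> real" where
  "dist_ell2 f g = norm (f - g)"

definition uniformity_ell2 :: "('a ell2 \<times> 'a ell2) filter" where
  "uniformity_ell2 = (INF e\<in>{0<..}. principal {(f, g). dist f g < e})"

definition open_ell2 :: "'a ell2 set \<Rightarrow> bool" where
  "open_ell2 U \<longleftrightarrow> (\<forall>f\<in>U. eventually (\<lambda>(f', g). f' = f \<longrightarrow> g \<in> U) uniformity)"

instance
proof
  fix f g h :: "'a ell2" and r :: real
  note cs = abs_summable_summable[OF square_summable_mult[OF ell2_coeff_summable ell2_coeff_summable]]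
  show "sgn f = f /\<^sub>R norm f" "dist f g = norm (f - g)" "norm f = sqrt (inner f f)"
    "uniformity = (INF e\<in>{0<..}. principal {(f, g :: 'a ell2). dist f g < e})"
    by (simp_all add: sgn_ell2_def dist_ell2_def norm_ell2_def uniformity_ell2_def)
  show "open U \<longleftrightarrow> (\<forall>f\<in>U. \<forall>\<^sub>F (f', g) in uniformity. f' = f \<longrightarrow> g \<in> U)" for U :: "'a ell2 set"
    by (simp add: open_ell2_def)
  have "ell2_cinner g f = cnj (ell2_cinner f g)"
    by (simp add: ell2_cinner.rep_eq mult.commute flip: infsum_cnj)
  then show "inner f g = inner g f"
    by (simp add: inner_ell2_def)
  show "inner (f + g) h = inner f h + inner g h"
    by (simp add: inner_ell2_def ell2_cinner.rep_eq plus_ell2.rep_eq distrib_right infsum_add[OF cs cs])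
  show "inner (r *\<^sub>R f) g = r * inner f g"
    by (simp add: inner_ell2_def ell2_cinner.rep_eq ell2_scaleC.rep_eq scaleR_ell2_def mult.assoc
        infsum_cmult_right')
  have sq: "inner f f = (\<Sum>\<^sub>\<infinity>x. (cmod (ell2_coeff f x))\<^sup>2)"
    by (simp add: inner_ell2_def ell2_cinner.rep_eq cmod_power2 flip: infsum_Re[OF cs])
      (simp add: power2_eq_square)
  then show "0 \<le> inner f f"
    by (simp add: infsum_nonneg)
  show "inner f f = 0 \<longleftrightarrow> f = 0"
  proof
    assume "inner f f = 0"
    then have "(cmod (ell2_coeff f x))\<^sup>2 = 0" for x
      by (intro nonneg_infsum_le_0D[OF _ ell2_coeff_summable]) (simp_all add: sq)
    then show "f = 0"
      by (intro ell2_eqI) (simp add: zero_ell2.rep_eq)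
  next
    assume "f = 0"
    then show "inner f f = 0"
      unfolding sq by (simp add: zero_ell2.rep_eq)
  qed
qed

end

lemma ell2_norm_square: "(norm f)\<^sup>2 = (\<Sum>\<^sub>\<infinity>x. (cmod (ell2_coeff f x))\<^sup>2)"
proof -
  note cs = abs_summable_summable[OF square_summable_mult[OF ell2_coeff_summable ell2_coeff_summable]]
  have "(norm f)\<^sup>2 = inner f f"
    by (rule power2_norm_eq_inner)
  also have "\<dots> = (\<Sum>\<^sub>\<infinity>x. (cmod (ell2_coeff f x))\<^sup>2)"
    by (simp add: inner_ell2_def ell2_cinner.rep_eq cmod_power2 flip: infsum_Re[OF cs])
      (simp add: power2_eq_square)
  finally show ?thesis .
qed


section \<open>Operators and the reduced group C*-algebra\<close>

text \<open>The library has no complex normed spaces, so \<open>'a op\<close> consists of the bounded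
  \<^emph>\<open>real\<close>-linear operators, with the operator norm.  All operators used below lie in the
  norm closure of a set of complex-linear ones, hence are complex-linear.\<close>

type_synonym 'a op = "'a ell2 \<Rightarrow>\<^sub>L 'a ell2"

lemma ell2_scaleC_norm: "norm (ell2_scaleC c f) = cmod c * norm f"
proof -
  have "(norm (ell2_scaleC c f))\<^sup>2 = (cmod c * norm f)\<^sup>2"
    unfolding ell2_norm_square ell2_scaleC.rep_eq norm_mult power_mult_distrib
    by (rule infsum_cmult_right')
  then show ?thesis
    by (rule power2_eq_imp_eq) simp_all
qed

lift_definition op_scalar :: "complex \<Rightarrow> 'a op" is ell2_scaleC
proof (rule bounded_linear_intro)
  fix c r and f g :: "'a ell2"
  show "ell2_scaleC c (f + g) = ell2_scaleC c f + ell2_scaleC c g"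
    by (rule ell2_eqI) (simp add: ell2_scaleC.rep_eq plus_ell2.rep_eq algebra_simps)
  show "ell2_scaleC c (r *\<^sub>R f) = r *\<^sub>R ell2_scaleC c f"
    by (rule ell2_eqI) (simp add: ell2_scaleC.rep_eq scaleR_ell2_def)
  show "norm (ell2_scaleC c f) \<le> norm f * cmod c"
    by (simp add: ell2_scaleC_norm)
qed

definition op_scaleC :: "complex \<Rightarrow> 'a op \<Rightarrow> 'a op" where
  "op_scaleC c T = op_scalar c o\<^sub>L T"

definition op_adj :: "'a op \<Rightarrow> 'a op" where
  "op_adj T = (THE S. \<forall>f g. ell2_cinner (blinfun_apply S f) g = ell2_cinner f (blinfun_apply T g))"

lemma op_adjI:
  assumes "\<And>f g. ell2_cinner (blinfun_apply S f) g = ell2_cinner f (blinfun_apply T g)"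
  shows "op_adj T = S"
  unfolding op_adj_def
proof (rule the_equality)
  fix S'
  assume "\<forall>f g. ell2_cinner (blinfun_apply S' f) g = ell2_cinner f (blinfun_apply T g)"
  then have "inner (blinfun_apply S' f) g = inner (blinfun_apply S f) g" for f g
    by (simp add: inner_ell2_def assms)
  then have "blinfun_apply S' f = blinfun_apply S f" for f
    using vector_eq_rdot by blast
  then show "S' = S"
    by (rule blinfun_eqI)
qed (simp add: assms)

text \<open>The Hilbert space of square-summable functions on \<open>carrier G\<close> is identified with the
  subspace of \<open>'a ell2\<close> of the functions vanishing outside \<open>carrier G\<close>, and its operators with
  the operators on \<open>'a ell2\<close> that vanish on the orthogonal complement and map into this
  subspace.  In particular the unit of \<open>C*\<^sub>r(G)\<close> is the projection onto this subspace.\<close>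

definition left_regular :: "('a, 'b) monoid_scheme \<Rightarrow> 'a \<Rightarrow> 'a op" where
  "left_regular G s = Blinfun (\<lambda>f. Abs_ell2
     (\<lambda>x. if x \<in> carrier G then ell2_coeff f (inv\<^bsub>G\<^esub> s \<otimes>\<^bsub>G\<^esub> x) else 0))"

definition reduced_group_cstar :: "('a, 'b) monoid_scheme \<Rightarrow> 'a op set" where
  "reduced_group_cstar G =
     closure {\<Sum>s\<in>F. op_scaleC (c s) (left_regular G s) | F c. finite F \<and> F \<subseteq> carrier G}"

lemma left_regular_aux:
  fixes f :: "'a ell2" and G (structure)
  assumes "group G" "s \<in> carrier G"
  defines "L \<equiv> \<lambda>f x. if x \<in> carrier G then ell2_coeff f (inv s \<otimes> x) else 0"
  shows "(\<lambda>x. (cmod (L f x))\<^sup>2) summable_on UNIV"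
    and "(\<Sum>\<^sub>\<infinity>x. (cmod (L f x))\<^sup>2) \<le> (norm f)\<^sup>2"
proof -
  interpret group G by fact
  let ?h = "\<lambda>x. (cmod (ell2_coeff f x))\<^sup>2"
  have inj: "inj_on (\<lambda>x. inv s \<otimes> x) (carrier G)"
    using assms(2) by (auto intro!: inj_onI)
  have sub: "?h summable_on A" for A
    using summable_on_subset_banach[OF ell2_coeff_summable] by auto
  have "(?h \<circ> (\<lambda>x. inv s \<otimes> x)) summable_on carrier G"
    using sub by (simp add: summable_on_reindex[OF inj, symmetric])
  then show "(\<lambda>x. (cmod (L f x))\<^sup>2) summable_on UNIV"
    by (subst summable_on_cong_neutral[where T = "carrier G" and g = "?h \<circ> (\<lambda>x. inv s \<otimes> x)"])
      (auto simp: L_def)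
  have "(\<Sum>\<^sub>\<infinity>x. (cmod (L f x))\<^sup>2) = infsum (?h \<circ> (\<lambda>x. inv s \<otimes> x)) (carrier G)"
    by (rule infsum_cong_neutral) (auto simp: L_def)
  also have "\<dots> = infsum ?h ((\<lambda>x. inv s \<otimes> x) ` carrier G)"
    by (rule infsum_reindex[OF inj, symmetric])
  also have "\<dots> \<le> infsum ?h UNIV"
    by (rule infsum_mono2) (auto intro: sub)
  finally show "(\<Sum>\<^sub>\<infinity>x. (cmod (L f x))\<^sup>2) \<le> (norm f)\<^sup>2"
    by (simp add: ell2_norm_square)
qed

lemma left_regular_apply:
  fixes G (structure)
  assumes "group G" "s \<in> carrier G"
  shows "ell2_coeff (blinfun_apply (left_regular G s) f) x =
    (if x \<in> carrier G then ell2_coeff f (inv s \<otimes> x) else 0)"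
proof -
  define L where "L = (\<lambda>f x. if x \<in> carrier G then ell2_coeff f (inv s \<otimes> x) else 0)"
  have aux: "(\<lambda>x. (cmod (L f x))\<^sup>2) summable_on UNIV" "(\<Sum>\<^sub>\<infinity>x. (cmod (L f x))\<^sup>2) \<le> (norm f)\<^sup>2" for f
    using left_regular_aux[OF assms] by (simp_all add: L_def)
  have coeff: "ell2_coeff (Abs_ell2 (L f)) = L f" for f
    using aux(1) by (simp add: Abs_ell2_inverse)
  have "bounded_linear (\<lambda>f. Abs_ell2 (L f))"
  proof (rule bounded_linear_intro)
    fix f g and r :: real
    show "Abs_ell2 (L (f + g)) = Abs_ell2 (L f) + Abs_ell2 (L g)"
      by (rule ell2_eqI, unfold plus_ell2.rep_eq coeff) (simp add: L_def plus_ell2.rep_eq)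
    show "Abs_ell2 (L (r *\<^sub>R f)) = r *\<^sub>R Abs_ell2 (L f)"
      by (rule ell2_eqI, unfold scaleR_ell2_def ell2_scaleC.rep_eq coeff) (simp add: L_def ell2_scaleC.rep_eq)
    have "(norm (Abs_ell2 (L f)))\<^sup>2 \<le> (norm f)\<^sup>2"
      using aux(2) by (simp add: ell2_norm_square coeff)
    then show "norm (Abs_ell2 (L f)) \<le> norm f * 1"
      by (simp add: power2_le_iff_abs_le)
  qed
  then have "blinfun_apply (left_regular G s) f = Abs_ell2 (L f)"
    unfolding left_regular_def L_def by (simp add: bounded_linear_Blinfun_apply)
  then show ?thesis
    by (simp add: coeff) (simp add: L_def)
qed


section \<open>States, approximate units and strictly positive elements\<close>

text \<open>In the following, \<open>A\<close> is meant to be a C*-algebra of operators, not necessarily unital.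
  Functionals on \<open>A\<close> are functions on all operators of which only the values on \<open>A\<close> matter.\<close>

definition op_positive :: "'a op set \<Rightarrow> 'a op \<Rightarrow> bool" where
  "op_positive A a \<longleftrightarrow> (\<exists>b\<in>A. a = op_adj b o\<^sub>L b)"

definition linear_functional :: "'a op set \<Rightarrow> ('a op \<Rightarrow> complex) \<Rightarrow> bool" where
  "linear_functional A \<phi> \<longleftrightarrow>
     (\<forall>a\<in>A. \<forall>b\<in>A. \<phi> (a + b) = \<phi> a + \<phi> b) \<and> (\<forall>c. \<forall>a\<in>A. \<phi> (op_scaleC c a) = c * \<phi> a)"

text \<open>A positive functional of norm 1.\<close>

definition cstar_state :: "'a op set \<Rightarrow> ('a op \<Rightarrow> complex) \<Rightarrow> bool" where
  "cstar_state A \<phi> \<longleftrightarrow>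
     linear_functional A \<phi> \<and>
     (\<forall>a. op_positive A a \<longrightarrow> \<phi> a \<in> \<real>\<^sub>\<ge>\<^sub>0) \<and>
     bdd_above {cmod (\<phi> a) | a. a \<in> A \<and> norm a \<le> 1} \<and>
     Sup {cmod (\<phi> a) | a. a \<in> A \<and> norm a \<le> 1} = 1"

text \<open>An extreme point of the set of states.\<close>

definition pure_state :: "'a op set \<Rightarrow> ('a op \<Rightarrow> complex) \<Rightarrow> bool" where
  "pure_state A \<phi> \<longleftrightarrow>
     cstar_state A \<phi> \<and>
     (\<forall>\<psi> \<rho> t. cstar_state A \<psi> \<longrightarrow> cstar_state A \<rho> \<longrightarrow> 0 < t \<longrightarrow> t < (1 :: real) \<longrightarrow>
        (\<forall>a\<in>A. \<phi> a = complex_of_real t * \<psi> a + complex_of_real (1 - t) * \<rho> a) \<longrightarrow>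
        (\<forall>a\<in>A. \<psi> a = \<phi> a \<and> \<rho> a = \<phi> a))"

definition hereditary_kernel :: "'a op set \<Rightarrow> ('a op \<Rightarrow> complex) \<Rightarrow> 'a op set" where
  "hereditary_kernel A \<phi> = {a \<in> A. \<phi> ((op_adj a o\<^sub>L a) + (a o\<^sub>L op_adj a)) = 0}"

text \<open>An approximate unit is an increasing net of positive contractions converging strictly to
  the identity; here the net is a sequence with commuting terms.\<close>

definition sequential_abelian_approximate_unit :: "'a op set \<Rightarrow> (nat \<Rightarrow> 'a op) \<Rightarrow> bool" where
  "sequential_abelian_approximate_unit B u \<longleftrightarrow>
     (\<forall>n. u n \<in> B \<and> op_positive B (u n) \<and> norm (u n) \<le> 1) \<and>
     (\<forall>m n. m \<le> n \<longrightarrow> op_positive B (u n - u m)) \<and>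
     (\<forall>m n. u m o\<^sub>L u n = u n o\<^sub>L u m) \<and>
     (\<forall>b\<in>B. (\<lambda>n. u n o\<^sub>L b) \<longlonglongrightarrow> b \<and> (\<lambda>n. b o\<^sub>L u n) \<longlonglongrightarrow> b)"

definition strictly_positive :: "'a op set \<Rightarrow> 'a op \<Rightarrow> bool" where
  "strictly_positive B h \<longleftrightarrow>
     h \<in> B \<and> op_positive B h \<and> (\<forall>\<psi>. cstar_state B \<psi> \<longrightarrow> Re (\<psi> h) > 0)"

end

theory Submission
  imports Defs "HOL-Algebra.Coset"
begin

text \<open>
  Let \<open>A\<close> be the reduced C*-algebra of the free group \<open>F\<close> on \<open>R\<close>, let \<open>H\<close> be the hereditary
  kernel of the pure state \<open>g\<close>, and for \<open>S \<subseteq> R\<close> let \<open>F\<^sub>S\<close> be the subgroup generated by \<open>S\<close> and \<open>A\<^sub>S\<close>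
  its algebra.  Purity enters only through transitivity: if \<open>y\<close> is not in the left kernel \<open>L\<close> of \<open>g\<close>,
  then \<open>1 - c y \<in> L\<close> for some \<open>c\<close> whose norm is at most 6 divided by the square root of \<open>g (y* y)\<close>.
  Applied to elements \<open>y\<close> of small trace norm in the algebra of one generator, this gives positive
  contractions in \<open>H\<close> whose traces tend to 1.

  Choose a countable \<open>S\<close> such that \<open>A\<^sub>S\<close> contains these contractions.  Since \<open>A\<^sub>S\<close> is separable,
  \<open>H \<inter> A\<^sub>S\<close> has a sequential abelian approximate unit \<open>u\<^sub>n\<close>, and the trace of \<open>a\<^sub>n = 1 - u\<^sub>n\<close> tends
  to 0.  If \<open>s \<notin> F\<^sub>S\<close>, then \<open>F\<close> is a union of two sets \<open>U\<close> and \<open>D\<close> such that \<open>U\<close> and \<open>s D\<close> meet each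
  right coset of \<open>F\<^sub>S\<close> at most once; this bounds the norm of \<open>a\<^sub>n s a\<^sub>n\<close> by twice the 2-norm of
  \<open>a\<^sub>n\<close>, so \<open>a\<^sub>n s a\<^sub>n\<close> tends to 0 and \<open>g s = 0\<close>.  Hence for \<open>b \<in> H\<close> the conditional expectation
  \<open>d\<close> of \<open>b* b\<close> onto \<open>A\<^sub>S\<close> is positive with \<open>g d = 0\<close>, so that \<open>d \<in> H \<inter> A\<^sub>S\<close>.  Since
  \<open>a\<^sub>n (b* b - d) a\<^sub>n\<close> and \<open>a\<^sub>n d a\<^sub>n\<close> tend to 0, so does \<open>b a\<^sub>n\<close>: the sequence \<open>u\<^sub>n\<close> is an
  approximate unit of \<open>H\<close>.
\<close>


section \<open>The Hilbert space\<close>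

text \<open>Why squares occur: let b be the sum of \<theta>^k p^k over k < N for a generator p and a
  phase \<theta>. Its 2-norm is sqrt N, but so is its GNS norm in the mean over the phases, so 1 - c
  b \<in> L says nothing about traces. The square b b keeps trace norm at most N, being a product of
  two elements of 2-norm sqrt N, while the additive energy of an interval makes its GNS norm of
  order N powr (3/2) for a suitable \<theta>. Hence the trace of c b b is of order at most 1 / sqrt
  N.

  The obstacle is an uncountable R: the algebra is then not separable, and an approximate unit of a
  separable part of H has no evident effect on group elements outside that part. The link is that
  the compression bound involves only the 2-norm of 1 minus the approximate unit, which is exactly
  what the trace estimate sends to 0.

  All terms of the sequence are 1 - (1 - h)^(2 n) for one h in H. Hence they commute, and h itself
  is the strictly positive element.\<close>

lemma cinner_summable:
  "(\<lambda>x. cnj (ell2_coeff f x) * ell2_coeff g x) summable_on UNIV"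
  by (rule abs_summable_summable[OF square_summable_mult[OF ell2_coeff_summable ell2_coeff_summable]])

lemma cinner_add_left: "ell2_cinner (f + g) h = ell2_cinner f h + ell2_cinner g h"
  by (simp add: ell2_cinner.rep_eq plus_ell2.rep_eq distrib_right infsum_add cinner_summable)

lemma cinner_add_right: "ell2_cinner f (g + h) = ell2_cinner f g + ell2_cinner f h"
  by (simp add: ell2_cinner.rep_eq plus_ell2.rep_eq distrib_left infsum_add cinner_summable)

lemma cinner_scaleC_left: "ell2_cinner (ell2_scaleC c f) g = cnj c * ell2_cinner f g"
  by (simp add: ell2_cinner.rep_eq ell2_scaleC.rep_eq mult.assoc infsum_cmult_right')

lemma cinner_scaleC_right: "ell2_cinner f (ell2_scaleC c g) = c * ell2_cinner f g"
  by (simp add: ell2_cinner.rep_eq ell2_scaleC.rep_eq mult.left_commute infsum_cmult_right')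

lemma cinner_commute: "ell2_cinner g f = cnj (ell2_cinner f g)"
  by (simp add: ell2_cinner.rep_eq mult.commute flip: infsum_cnj)

lemma cinner_diff_left: "ell2_cinner (f - g) h = ell2_cinner f h - ell2_cinner g h"
  using cinner_add_left[of "f - g" g h] by simp

lemma cinner_diff_right: "ell2_cinner f (g - h) = ell2_cinner f g - ell2_cinner f h"
  using cinner_add_right[of f "g - h" h] by simp

text \<open>Expresses the complex inner product through the real one, so that limits of
  \<open>ell2_cinner\<close> reduce to limits of \<open>inner\<close>.\<close>

lemma cinner_eq_Complex:
  "ell2_cinner f g = Complex (inner f g) (- inner f (ell2_scaleC \<i> g))"
  by (rule complex_eqI) (simp_all add: inner_ell2_def cinner_scaleC_right)

lemma cinner_self: "ell2_cinner f f = of_real ((norm f)\<^sup>2)"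
proof (rule complex_eqI)
  show "Im (ell2_cinner f f) = Im (of_real ((norm f)\<^sup>2))"
    using cinner_commute[of f f] by (simp add: complex_eq_iff)
qed (simp add: power2_norm_eq_inner inner_ell2_def)

lemma of_real_cmod_square: "(complex_of_real (cmod z))\<^sup>2 = z * cnj z"
  by (metis complex_norm_square of_real_power)

lemma cinner_Cauchy_Schwarz: "cmod (ell2_cinner f g) \<le> norm f * norm g"
proof (cases "ell2_cinner f g = 0")
  case False
  define c where "c = cnj (sgn (ell2_cinner f g))"
  have c: "c * ell2_cinner f g = cmod (ell2_cinner f g)"
    using False by (simp add: c_def sgn_eq mult.commute[of "cnj _"] complex_norm_square[symmetric] power2_eq_square)
  have "cmod c = 1"
    using False by (simp add: c_def norm_sgn)
  have "cmod (ell2_cinner f g) = inner f (ell2_scaleC c g)"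
    by (simp add: inner_ell2_def cinner_scaleC_right c)
  also have "\<dots> \<le> norm f * norm (ell2_scaleC c g)"
    by (rule norm_cauchy_schwarz)
  finally show ?thesis
    by (simp add: ell2_scaleC_norm \<open>cmod c = 1\<close>)
qed simp

lemma norm_coeff_le: "cmod (ell2_coeff f x) \<le> norm f"
proof -
  have "(\<Sum>\<^sub>\<infinity>y\<in>{x}. (cmod (ell2_coeff f y))\<^sup>2) \<le> (\<Sum>\<^sub>\<infinity>y. (cmod (ell2_coeff f y))\<^sup>2)"
    by (rule infsum_mono2) (auto simp: ell2_coeff_summable)
  then show ?thesis
    by (simp add: power2_le_iff_abs_le flip: ell2_norm_square)
qed

lemma sum_coeff_square_le:
  assumes "finite F" shows "(\<Sum>x\<in>F. (cmod (ell2_coeff f x))\<^sup>2) \<le> (norm f)\<^sup>2"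
proof -
  have "(\<Sum>\<^sub>\<infinity>y\<in>F. (cmod (ell2_coeff f y))\<^sup>2) \<le> (\<Sum>\<^sub>\<infinity>y. (cmod (ell2_coeff f y))\<^sup>2)"
    by (rule infsum_mono2) (auto simp: ell2_coeff_summable assms)
  then show ?thesis
    by (simp add: assms ell2_norm_square)
qed

instance ell2 :: (type) banach
proof
  fix X :: "nat \<Rightarrow> 'a ell2" assume X: "Cauchy X"
  have "Cauchy (\<lambda>n. ell2_coeff (X n) x)" for x
  proof (rule metric_CauchyI)
    fix e :: real assume "0 < e"
    from metric_CauchyD[OF X this] obtain M where M: "\<forall>m\<ge>M. \<forall>n\<ge>M. dist (X m) (X n) < e" by blast
    have "dist (ell2_coeff (X m) x) (ell2_coeff (X n) x) \<le> dist (X m) (X n)" for m n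
      using norm_coeff_le[of "X m - X n" x] by (simp add: dist_norm minus_ell2.rep_eq)
    then show "\<exists>M. \<forall>m\<ge>M. \<forall>n\<ge>M. dist (ell2_coeff (X m) x) (ell2_coeff (X n) x) < e"
      using M by (meson order.strict_trans1)
  qed
  then have "\<exists>l. (\<lambda>n. ell2_coeff (X n) x) \<longlonglongrightarrow> l" for x
    by (simp add: Cauchy_convergent_iff convergent_def)
  then obtain l where l: "\<And>x. (\<lambda>n. ell2_coeff (X n) x) \<longlonglongrightarrow> l x" by metis
  \<comment> \<open>Sums over finitely many coordinates pass to the limit in \<open>m\<close>. As
    the bound does not depend on \<open>F\<close>, it then holds for the sum over all
    coordinates.\<close>
  have fin: "(\<Sum>x\<in>F. (cmod (l x - ell2_coeff (X n) x))\<^sup>2) \<le> e\<^sup>2"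
    if "finite F" "\<forall>m\<ge>M. \<forall>n\<ge>M. dist (X m) (X n) < e" "n \<ge> M" for F M n and e :: real
  proof (rule LIMSEQ_le_const2)
    show "(\<lambda>m. \<Sum>x\<in>F. (cmod (ell2_coeff (X m) x - ell2_coeff (X n) x))\<^sup>2)
        \<longlonglongrightarrow> (\<Sum>x\<in>F. (cmod (l x - ell2_coeff (X n) x))\<^sup>2)"
      by (intro tendsto_intros l)
    have "(\<Sum>x\<in>F. (cmod (ell2_coeff (X m) x - ell2_coeff (X n) x))\<^sup>2) \<le> e\<^sup>2" if "m \<ge> M" for m
    proof -
      have "(\<Sum>x\<in>F. (cmod (ell2_coeff (X m - X n) x))\<^sup>2) \<le> (dist (X m) (X n))\<^sup>2"
        unfolding dist_norm by (rule sum_coeff_square_le) fact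
      also have "\<dots> \<le> e\<^sup>2"
        using that \<open>\<forall>m\<ge>M. _\<close> \<open>n \<ge> M\<close> by (intro power_mono) (auto intro: less_imp_le)
      finally show ?thesis by (simp add: minus_ell2.rep_eq)
    qed
    then show "\<exists>N. \<forall>m\<ge>N. (\<Sum>x\<in>F. (cmod (ell2_coeff (X m) x - ell2_coeff (X n) x))\<^sup>2) \<le> e\<^sup>2"
      by blast
  qed
  have summ: "(\<lambda>x. (cmod (l x - ell2_coeff (X n) x))\<^sup>2) summable_on UNIV"
    and le: "(\<Sum>\<^sub>\<infinity>x. (cmod (l x - ell2_coeff (X n) x))\<^sup>2) \<le> e\<^sup>2"
    if "\<forall>m\<ge>M. \<forall>n\<ge>M. dist (X m) (X n) < e" "n \<ge> M" for M n and e :: real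
  proof -
    show s: "(\<lambda>x. (cmod (l x - ell2_coeff (X n) x))\<^sup>2) summable_on UNIV"
      using fin[OF _ that] by (intro nonneg_bdd_above_summable_on) (auto intro!: bdd_aboveI2)
    show "(\<Sum>\<^sub>\<infinity>x. (cmod (l x - ell2_coeff (X n) x))\<^sup>2) \<le> e\<^sup>2"
      using fin[OF _ that] s by (intro infsum_le_finite_sums) auto
  qed
  obtain M where M: "\<forall>m\<ge>M. \<forall>n\<ge>M. dist (X m) (X n) < 1"
    using metric_CauchyD[OF X, of 1] by auto
  have lsum: "(\<lambda>x. (cmod (l x))\<^sup>2) summable_on UNIV"
    using square_summable_add[OF summ[OF M order_refl] ell2_coeff_summable[of "X M"]] by simp
  define L where "L = Abs_ell2 l"
  have L: "ell2_coeff L = l"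
    using lsum by (simp add: L_def Abs_ell2_inverse)
  have "X \<longlonglongrightarrow> L"
  proof (rule metric_LIMSEQ_I)
    fix e :: real assume "0 < e"
    then obtain M where M: "\<forall>m\<ge>M. \<forall>n\<ge>M. dist (X m) (X n) < e / 2"
      using metric_CauchyD[OF X, of "e/2"] by auto
    have "dist (X n) L < e" if "n \<ge> M" for n
    proof -
      have "(norm (L - X n))\<^sup>2 \<le> (e/2)\<^sup>2"
        using le[OF M that] by (simp add: ell2_norm_square minus_ell2.rep_eq L)
      from power2_le_imp_le[OF this] have "norm (L - X n) \<le> e / 2"
        using \<open>0 < e\<close> by simp
      then show ?thesis
        using \<open>0 < e\<close> by (simp add: dist_norm norm_minus_commute)
    qed
    then show "\<exists>no. \<forall>n\<ge>no. dist (X n) L < e" by blast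
  qed
  then show "convergent X" by (auto simp: convergent_def)
qed


section \<open>Adjointable operators\<close>

text \<open>A merely real-linear operator has no adjoint for the complex inner product, and
  \<open>op_adj\<close> is then an arbitrary value. Adjoints are therefore handled as a relation
  until the type \<open>bop\<close> makes them total.\<close>

definition adjoint_pair :: "'a op \<Rightarrow> 'a op \<Rightarrow> bool" where
  "adjoint_pair S T \<longleftrightarrow> (\<forall>f g. ell2_cinner (blinfun_apply S f) g = ell2_cinner f (blinfun_apply T g))"

lemma adjoint_pair_sym: "adjoint_pair S T \<Longrightarrow> adjoint_pair T S"
  unfolding adjoint_pair_def by (metis cinner_commute)

lemma op_adj_eq: "adjoint_pair S T \<Longrightarrow> op_adj T = S"
  unfolding adjoint_pair_def by (rule op_adjI) blast

lemma adjoint_pair_norm_le: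
  assumes "adjoint_pair S T" shows "norm S \<le> norm T"
proof (rule norm_blinfun_bound)
  fix f
  have "(norm (blinfun_apply S f))\<^sup>2 = inner f (blinfun_apply T (blinfun_apply S f))"
    using assms unfolding adjoint_pair_def power2_norm_eq_inner inner_ell2_def by metis
  also have "\<dots> \<le> norm f * (norm T * norm (blinfun_apply S f))"
    by (rule order_trans[OF norm_cauchy_schwarz]) (simp add: mult_left_mono norm_blinfun)
  finally have "norm (blinfun_apply S f) * norm (blinfun_apply S f)
      \<le> (norm T * norm f) * norm (blinfun_apply S f)"
    by (simp add: power2_eq_square algebra_simps)
  then show "norm (blinfun_apply S f) \<le> norm T * norm f"
    by (cases "norm (blinfun_apply S f) = 0") (auto simp: mult_le_cancel_right)
qed simp

lemma adjoint_pair_norm: "adjoint_pair S T \<Longrightarrow> norm S = norm T"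
  by (meson adjoint_pair_norm_le adjoint_pair_sym antisym)

lemma adjoint_pair_add: "adjoint_pair S T \<Longrightarrow> adjoint_pair S' T' \<Longrightarrow> adjoint_pair (S + S') (T + T')"
  by (simp add: adjoint_pair_def blinfun.add_left cinner_add_left cinner_add_right)

lemma adjoint_pair_diff: "adjoint_pair S T \<Longrightarrow> adjoint_pair S' T' \<Longrightarrow> adjoint_pair (S - S') (T - T')"
  by (simp add: adjoint_pair_def blinfun.diff_left cinner_diff_left cinner_diff_right)

lemma adjoint_pair_compose: "adjoint_pair S T \<Longrightarrow> adjoint_pair S' T' \<Longrightarrow> adjoint_pair (S' o\<^sub>L S) (T o\<^sub>L T')"
  by (simp add: adjoint_pair_def)

lemma adjoint_pair_zero: "adjoint_pair 0 0"
  by (simp add: adjoint_pair_def ell2_cinner.rep_eq zero_ell2.rep_eq)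

lemma adjoint_pair_id: "adjoint_pair id_blinfun id_blinfun"
  by (simp add: adjoint_pair_def)

lemma adjoint_pair_scalar: "adjoint_pair (op_scalar (cnj c)) (op_scalar c)"
  by (simp add: adjoint_pair_def op_scalar.rep_eq cinner_scaleC_left cinner_scaleC_right)

lemma adjoint_pair_scaleR:
  assumes "adjoint_pair S T" shows "adjoint_pair (r *\<^sub>R S) (r *\<^sub>R T)"
  using assms
  by (simp add: adjoint_pair_def blinfun.scaleR_left scaleR_ell2_def cinner_scaleC_left cinner_scaleC_right)

lemma adjoint_pair_uminus: "adjoint_pair S T \<Longrightarrow> adjoint_pair (- S) (- T)"
  using adjoint_pair_scaleR[of S T "-1"] by simp

lemma tendsto_cinner:
  assumes "f \<longlonglongrightarrow> a" "g \<longlonglongrightarrow> b"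
  shows "(\<lambda>n. ell2_cinner (f n) (g n)) \<longlonglongrightarrow> ell2_cinner a b"
proof -
  have "bounded_linear (ell2_scaleC \<i> :: 'a ell2 \<Rightarrow> 'a ell2)"
    using blinfun.bounded_linear_right[of "op_scalar \<i> :: 'a op"] by (simp add: op_scalar.rep_eq)
  then have "(\<lambda>n. ell2_scaleC \<i> (g n)) \<longlonglongrightarrow> ell2_scaleC \<i> b"
    using assms(2) by (rule bounded_linear.tendsto)
  then show ?thesis
    unfolding cinner_eq_Complex using assms by (intro tendsto_intros)
qed

text \<open>Taking adjoints is isometric, so the adjoints of a convergent sequence form a Cauchy
  sequence. This makes the set of adjointable operators norm closed.\<close>

lemma adjoint_pair_limit:
  assumes "\<And>n. adjoint_pair (S n) (T n)" "T \<longlonglongrightarrow> T'"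
  shows "\<exists>S'. adjoint_pair S' T'"
proof -
  have "dist (S m) (S n) = dist (T m) (T n)" for m n
    unfolding dist_norm by (intro adjoint_pair_norm adjoint_pair_diff assms(1))
  moreover have "Cauchy T"
    using assms(2) by (rule LIMSEQ_imp_Cauchy)
  ultimately have "Cauchy S"
    by (simp add: Cauchy_def)
  then obtain S' where "S \<longlonglongrightarrow> S'"
    by (auto simp: Cauchy_convergent_iff convergent_def)
  have "ell2_cinner (blinfun_apply S' f) g = ell2_cinner f (blinfun_apply T' g)" for f g
  proof (rule LIMSEQ_unique)
    show "(\<lambda>n. ell2_cinner (blinfun_apply (S n) f) g) \<longlonglongrightarrow> ell2_cinner (blinfun_apply S' f) g"
      by (intro tendsto_cinner tendsto_const blinfun.tendsto \<open>S \<longlonglongrightarrow> S'\<close>)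
    show "(\<lambda>n. ell2_cinner (blinfun_apply (S n) f) g) \<longlonglongrightarrow> ell2_cinner f (blinfun_apply T' g)"
      using assms(1) unfolding adjoint_pair_def
      by (simp add: tendsto_cinner[OF tendsto_const blinfun.tendsto[OF assms(2) tendsto_const]])
  qed
  then show ?thesis unfolding adjoint_pair_def by blast
qed

text \<open>On this type the adjoint is total, and it is a Banach algebra containing \<open>C*\<^sub>r(G)\<close>.\<close>

typedef 'a bop = "{T :: 'a op. \<exists>S. adjoint_pair S T}"
  morphisms op_of Abs_bop
  using adjoint_pair_zero by blast

setup_lifting type_definition_bop

definition delta :: "'a \<Rightarrow> 'a ell2" where
  "delta x = Abs_ell2 (\<lambda>y. if y = x then 1 else 0)"

lemma coeff_delta: "ell2_coeff (delta x) y = (if y = x then 1 else 0)"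
proof -
  have "(\<lambda>y. (cmod (if y = x then 1 else 0))\<^sup>2) summable_on UNIV"
    by (subst summable_on_cong_neutral[where T = "{x}" and g = "\<lambda>_. 1"]) auto
  then show ?thesis by (simp add: delta_def Abs_ell2_inverse)
qed

lemma delta_nonzero: "delta x \<noteq> 0"
  by (metis coeff_delta zero_ell2.rep_eq zero_neq_one)

lemma op_of_adjoint: "adjoint_pair (op_adj (op_of a)) (op_of a)"
  using op_of[of a] op_adj_eq by fastforce

instantiation bop :: (type) real_normed_algebra_1
begin

lift_definition zero_bop :: "'a bop" is 0 using adjoint_pair_zero by blast
lift_definition one_bop :: "'a bop" is id_blinfun using adjoint_pair_id by blast
lift_definition plus_bop :: "'a bop \<Rightarrow> 'a bop \<Rightarrow> 'a bop" is "(+)" using adjoint_pair_add by blast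
lift_definition minus_bop :: "'a bop \<Rightarrow> 'a bop \<Rightarrow> 'a bop" is "(-)" using adjoint_pair_diff by blast
lift_definition uminus_bop :: "'a bop \<Rightarrow> 'a bop" is uminus using adjoint_pair_uminus by blast
lift_definition times_bop :: "'a bop \<Rightarrow> 'a bop \<Rightarrow> 'a bop" is "(o\<^sub>L)" using adjoint_pair_compose by blast
lift_definition scaleR_bop :: "real \<Rightarrow> 'a bop \<Rightarrow> 'a bop" is "(*\<^sub>R)" using adjoint_pair_scaleR by blast
lift_definition norm_bop :: "'a bop \<Rightarrow> real" is norm .

definition sgn_bop :: "'a bop \<Rightarrow> 'a bop" where "sgn_bop a = scaleR (inverse (norm a)) a"
definition dist_bop :: "'a bop \<Rightarrow> 'a bop \<Rightarrow> real" where "dist_bop a b = norm (a - b)"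
definition uniformity_bop :: "('a bop \<times> 'a bop) filter" where
  "uniformity_bop = (INF e\<in>{0<..}. principal {(f, g). dist f g < e})"
definition open_bop :: "'a bop set \<Rightarrow> bool" where
  "open_bop U \<longleftrightarrow> (\<forall>f\<in>U. eventually (\<lambda>(f', g). f' = f \<longrightarrow> g \<in> U) uniformity)"

instance
proof
  fix a b c :: "'a bop" and r s :: real
  show "a + b + c = a + (b + c)" "a + b = b + a" "0 + a = a" "- a + a = 0" "a - b = a + - b"
    "r *\<^sub>R (a + b) = r *\<^sub>R a + r *\<^sub>R b" "(r + s) *\<^sub>R a = r *\<^sub>R a + s *\<^sub>R a"
    "r *\<^sub>R s *\<^sub>R a = (r * s) *\<^sub>R a" "1 *\<^sub>R a = a"
    by (transfer; simp add: algebra_simps)+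
  show "a * b * c = a * (b * c)"
    by transfer (rule blinfun_eqI, simp)
  show "(a + b) * c = a * c + b * c" "a * (b + c) = a * b + a * c"
    "r *\<^sub>R a * b = r *\<^sub>R (a * b)" "a * r *\<^sub>R b = r *\<^sub>R (a * b)" "1 * a = a" "a * 1 = a"
    by (transfer; auto intro!: blinfun_eqI simp: blinfun.bilinear_simps)+
  show "(0 :: 'a bop) \<noteq> 1"
  proof (transfer, rule notI)
    assume "(0 :: 'a op) = id_blinfun"
    then have "blinfun_apply (0 :: 'a op) f = blinfun_apply id_blinfun f" for f by metis
    then show False using delta_nonzero[of "undefined :: 'a"] by simp
  qed
  show "dist a b = norm (a - b)" "sgn a = scaleR (inverse (norm a)) a"
    "uniformity = (INF e\<in>{0<..}. principal {(f, g :: 'a bop). dist f g < e})"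
    by (simp_all add: dist_bop_def sgn_bop_def uniformity_bop_def)
  show "open U \<longleftrightarrow> (\<forall>f\<in>U. \<forall>\<^sub>F (f', g) in uniformity. f' = f \<longrightarrow> g \<in> U)" for U :: "'a bop set"
    by (simp add: open_bop_def)
  show "(norm a = 0) = (a = 0)" "norm (a + b) \<le> norm a + norm b" "norm (r *\<^sub>R a) = \<bar>r\<bar> * norm a"
    by (transfer; simp add: norm_triangle_ineq)+
  show "norm (a * b) \<le> norm a * norm b"
    by transfer (rule norm_blinfun_compose)
  show "norm (1 :: 'a bop) = 1"
  proof (transfer, rule antisym)
    show "norm (id_blinfun :: 'a op) \<le> 1" by (rule norm_blinfun_bound) auto
    have "norm (blinfun_apply id_blinfun (delta undefined :: 'a ell2))
        \<le> norm (id_blinfun :: 'a op) * norm (delta undefined :: 'a ell2)"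
      by (rule norm_blinfun)
    then show "1 \<le> norm (id_blinfun :: 'a op)"
      using delta_nonzero[of "undefined :: 'a"] by simp
  qed
qed

end

lemma dist_op_of: "dist (op_of a) (op_of b) = dist a b"
  by (simp add: dist_norm norm_bop.rep_eq minus_bop.rep_eq)

lemma tendsto_op_of_iff: "(\<lambda>n. op_of (X n)) \<longlonglongrightarrow> op_of a \<longleftrightarrow> X \<longlonglongrightarrow> a"
  by (simp add: tendsto_iff dist_op_of)

instance bop :: (type) banach
proof
  fix X :: "nat \<Rightarrow> 'a bop" assume "Cauchy X"
  then have "Cauchy (\<lambda>n. op_of (X n))" by (simp add: Cauchy_def dist_op_of)
  then obtain T where T: "(\<lambda>n. op_of (X n)) \<longlonglongrightarrow> T"
    by (auto simp: Cauchy_convergent_iff convergent_def)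
  have "\<exists>S. adjoint_pair S T"
    by (rule adjoint_pair_limit[OF op_of_adjoint T])
  then have "op_of (Abs_bop T) = T" by (simp add: Abs_bop_inverse)
  then have "X \<longlonglongrightarrow> Abs_bop T" using T by (simp flip: tendsto_op_of_iff)
  then show "convergent X" by (auto simp: convergent_def)
qed

section \<open>The star operation, complex scalars and the action on vectors\<close>

lift_definition star :: "'a bop \<Rightarrow> 'a bop" is op_adj
  using op_adj_eq adjoint_pair_sym by blast

text \<open>Complex multiples are written as products \<open>cs c * a\<close> with central elements,
  because the type class structure of \<open>bop\<close> carries real scalars only.\<close>

lift_definition cs :: "complex \<Rightarrow> 'a bop" is op_scalar
  using adjoint_pair_scalar by blast

definition act :: "'a bop \<Rightarrow> 'a ell2 \<Rightarrow> 'a ell2" (infixr "\<cdot>" 72) where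
  "act a f = blinfun_apply (op_of a) f"

lemma act_star_cinner: "ell2_cinner (star a \<cdot> f) g = ell2_cinner f (a \<cdot> g)"
  using op_of_adjoint[of a] by (simp add: act_def star.rep_eq adjoint_pair_def)

lemma act_star_inner: "inner (star a \<cdot> f) g = inner f (a \<cdot> g)"
  by (simp add: inner_ell2_def act_star_cinner)

lemma act_simps:
  "(a + b) \<cdot> f = a \<cdot> f + b \<cdot> f" "(a - b) \<cdot> f = a \<cdot> f - b \<cdot> f" "(- a) \<cdot> f = - (a \<cdot> f)"
  "(a * b) \<cdot> f = a \<cdot> b \<cdot> f" "(r *\<^sub>R a) \<cdot> f = r *\<^sub>R (a \<cdot> f)" "0 \<cdot> f = 0" "1 \<cdot> f = f"
  "a \<cdot> (f + g) = a \<cdot> f + a \<cdot> g" "a \<cdot> (f - g) = a \<cdot> f - a \<cdot> g" "a \<cdot> (r *\<^sub>R f) = r *\<^sub>R (a \<cdot> f)"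
  "a \<cdot> (- f) = - (a \<cdot> f)" "a \<cdot> 0 = 0"
  "cs c \<cdot> f = ell2_scaleC c f"
  by (simp_all add: act_def plus_bop.rep_eq minus_bop.rep_eq uminus_bop.rep_eq times_bop.rep_eq
      scaleR_bop.rep_eq zero_bop.rep_eq one_bop.rep_eq cs.rep_eq op_scalar.rep_eq blinfun.bilinear_simps)

lemma bop_eqI: "(\<And>f. a \<cdot> f = b \<cdot> f) \<Longrightarrow> a = b"
  by (metis act_def blinfun_eqI op_of_inject)

lemma star_eqI:
  assumes "\<And>f g. ell2_cinner (b \<cdot> f) g = ell2_cinner f (a \<cdot> g)"
  shows "star a = b"
  using op_adj_eq[of "op_of b" "op_of a"] assms
  by (metis act_def adjoint_pair_def op_of_inject star.rep_eq)

lemma star_star [simp]: "star (star a) = a"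
  by (rule star_eqI) (metis act_star_cinner cinner_commute)

lemma star_simps [simp]:
  fixes a b :: "'a bop"
  shows "star (a + b) = star a + star b" "star (a - b) = star a - star b" "star (a * b) = star b * star a"
  "star (- a) = - star a" "star (r *\<^sub>R a) = r *\<^sub>R star a" "star 0 = (0 :: 'a bop)" "star 1 = (1 :: 'a bop)"
  "star (cs c) = (cs (cnj c) :: 'a bop)"
proof -
  show add: "star (a + b) = star a + star b"
    by (rule star_eqI) (simp add: act_simps act_star_cinner cinner_add_left cinner_add_right)
  show "star (a - b) = star a - star b"
    by (rule star_eqI) (simp add: act_simps act_star_cinner cinner_diff_left cinner_diff_right)
  show "star (a * b) = star b * star a"
    by (rule star_eqI) (simp add: act_simps act_star_cinner)
  show scal: "star (r *\<^sub>R a) = r *\<^sub>R star a" for r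
    by (rule star_eqI) (simp add: act_simps act_star_cinner scaleR_ell2_def cinner_scaleC_left cinner_scaleC_right)
  show "star (- a) = - star a"
    using scal[of "-1"] by simp
  show "star 0 = (0::'a bop)" "star 1 = (1::'a bop)"
    by (rule star_eqI, simp add: act_simps ell2_cinner.rep_eq zero_ell2.rep_eq)+
  show "star (cs c) = (cs (cnj c) :: 'a bop)"
    by (rule star_eqI) (simp add: act_simps cinner_scaleC_left cinner_scaleC_right)
qed

text \<open>Complex linearity is forced by the existence of an adjoint: the scalar is moved through
  the complex inner product.\<close>

lemma act_scaleC: "a \<cdot> ell2_scaleC c f = ell2_scaleC c (a \<cdot> f)"
proof -
  have "inner g (a \<cdot> ell2_scaleC c f) = inner g (ell2_scaleC c (a \<cdot> f))" for g
    by (metis act_star_cinner cinner_scaleC_right inner_ell2_def)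
  then show ?thesis using vector_eq_ldot by blast
qed

lemma cs_commute: "a * cs c = cs c * a"
  by (rule bop_eqI) (simp add: act_simps act_scaleC)

lemma cs_left_commute: "a * (cs c * b) = cs c * (a * b)"
  by (metis cs_commute mult.assoc)

lemma cs_mult: "cs (c * d) = cs c * cs d"
  by (rule bop_eqI, rule ell2_eqI) (simp add: act_simps ell2_scaleC.rep_eq)

lemma cs_add: "cs (c + d) = cs c + cs d"
  by (rule bop_eqI, rule ell2_eqI) (simp add: act_simps ell2_scaleC.rep_eq plus_ell2.rep_eq algebra_simps)

lemma cs_of_real: "cs (of_real r) = r *\<^sub>R 1"
  by (rule bop_eqI) (simp add: act_simps scaleR_ell2_def)

lemma cs_0: "cs 0 = 0" using cs_of_real[of 0] by simp

lemma cs_1: "cs 1 = 1" using cs_of_real[of 1] by simp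

lemma op_of_cs_mult: "op_of (cs c * a) = op_scaleC c (op_of a)"
  by (simp add: times_bop.rep_eq cs.rep_eq op_scaleC_def)

lemma norm_star [simp]: "norm (star a) = norm a"
  by (metis adjoint_pair_norm norm_bop.rep_eq op_of_adjoint star.rep_eq)

lemma norm_act_le: "norm (a \<cdot> f) \<le> norm a * norm f"
  by (simp add: act_def norm_bop.rep_eq norm_blinfun)

lemma norm_bop_bound: "0 \<le> b \<Longrightarrow> (\<And>f. norm (a \<cdot> f) \<le> b * norm f) \<Longrightarrow> norm a \<le> b"
  by (simp add: act_def norm_bop.rep_eq norm_blinfun_bound)

lemma norm_cs [simp]: "norm (cs c :: 'a bop) = cmod c"
proof (rule antisym)
  show "norm (cs c :: 'a bop) \<le> cmod c"
    by (rule norm_bop_bound) (simp_all add: act_simps ell2_scaleC_norm)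
  show "cmod c \<le> norm (cs c :: 'a bop)"
    using norm_act_le[of "cs c" "delta undefined :: 'a ell2"] delta_nonzero[of "undefined::'a"]
    by (simp add: act_simps ell2_scaleC_norm)
qed

lemma bounded_bilinear_act: "bounded_bilinear act"
  by (rule bounded_bilinear.intro)
    (auto simp: act_simps mult.commute intro!: exI[of _ 1] order_trans[OF norm_act_le])

lemmas tendsto_act = bounded_bilinear.tendsto[OF bounded_bilinear_act]

lemma bounded_linear_star: "bounded_linear star"
  by (rule bounded_linear_intro[of _ 1]) simp_all

lemmas tendsto_star = bounded_linear.tendsto[OF bounded_linear_star]

text \<open>The C*-identity.\<close>

lemma norm_star_mult: "norm (star a * a) = (norm a)\<^sup>2"
proof (rule antisym)
  show "norm (star a * a) \<le> (norm a)\<^sup>2"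
    using norm_mult_ineq[of "star a" a] by (simp add: power2_eq_square)
  have "norm a \<le> sqrt (norm (star a * a))"
  proof (rule norm_bop_bound)
    fix f
    have "(norm (a \<cdot> f))\<^sup>2 = inner ((star a * a) \<cdot> f) f"
      by (simp add: power2_norm_eq_inner act_simps act_star_inner)
    also have "\<dots> \<le> norm ((star a * a) \<cdot> f) * norm f"
      by (rule norm_cauchy_schwarz)
    also have "\<dots> \<le> (norm (star a * a) * norm f) * norm f"
      by (intro mult_right_mono norm_act_le) simp
    also have "\<dots> = (sqrt (norm (star a * a)) * norm f)\<^sup>2"
      by (simp add: power_mult_distrib) (simp add: power2_eq_square)
    finally show "norm (a \<cdot> f) \<le> sqrt (norm (star a * a)) * norm f"
      by (rule power2_le_imp_le) simp
  qed simp
  then show "(norm a)\<^sup>2 \<le> norm (star a * a)"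
    by (metis norm_ge_zero power_mono real_sqrt_pow2)
qed


section \<open>Positive operators\<close>

text \<open>Self-adjointness is a separate condition because \<open>inner\<close> is a real part:
  the form of a skew-adjoint operator vanishes.\<close>

definition pos :: "'a bop \<Rightarrow> bool" where
  "pos a \<longleftrightarrow> star a = a \<and> (\<forall>f. 0 \<le> inner f (a \<cdot> f))"

lemma pos_star: "pos a \<Longrightarrow> star a = a"
  by (simp add: pos_def)

lemma inner_star_mult: "inner f ((star b * a) \<cdot> g) = inner (b \<cdot> f) (a \<cdot> g)"
  by (metis act_simps(4) act_star_inner star_star)

lemma inner_act_star: "inner f (star b \<cdot> f) = inner f (b \<cdot> f)"
  using act_star_inner[of b f f] by (simp add: inner_commute)

lemma pos_star_mult: "pos (star a * a)"
  by (simp add: pos_def inner_star_mult)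

lemma pos_square: "star a = a \<Longrightarrow> pos (a * a)"
  using pos_star_mult[of a] by simp

lemma pos_conj: "pos a \<Longrightarrow> pos (star b * a * b)"
  by (simp add: pos_def mult.assoc inner_star_mult) (simp add: act_simps)

lemma pos_add: "pos a \<Longrightarrow> pos b \<Longrightarrow> pos (a + b)"
  by (simp add: pos_def act_simps inner_add_right)

lemma pos_scaleR: "pos a \<Longrightarrow> 0 \<le> r \<Longrightarrow> pos (r *\<^sub>R a)"
  by (simp add: pos_def act_simps)

lemma pos_0 [simp]: "pos 0" and pos_1 [simp]: "pos 1"
  by (simp_all add: pos_def act_simps)

lemma pos_limit:
  assumes "X \<longlonglongrightarrow> a" "\<And>n. pos (X n)" shows "pos a"
  unfolding pos_def
proof (intro conjI allI)
  have "X \<longlonglongrightarrow> star a"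
    using tendsto_star[OF assms(1)] assms(2) by (simp add: pos_star)
  then show "star a = a"
    using assms(1) LIMSEQ_unique by blast
  show "0 \<le> inner f (a \<cdot> f)" for f
  proof (rule LIMSEQ_le_const)
    show "(\<lambda>n. inner f (X n \<cdot> f)) \<longlonglongrightarrow> inner f (a \<cdot> f)"
      by (intro tendsto_intros tendsto_act assms(1))
    show "\<exists>N. \<forall>n\<ge>N. 0 \<le> inner f (X n \<cdot> f)"
      using assms(2) by (simp add: pos_def)
  qed
qed

lemma inner_act_le: "\<bar>inner f (a \<cdot> f)\<bar> \<le> norm a * (norm f)\<^sup>2"
proof -
  have "\<bar>inner f (a \<cdot> f)\<bar> \<le> norm f * norm (a \<cdot> f)"
    by (rule Cauchy_Schwarz_ineq2)
  also have "\<dots> \<le> norm f * (norm a * norm f)"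
    by (intro mult_left_mono norm_act_le) simp
  finally show ?thesis by (simp add: power2_eq_square ac_simps)
qed

text \<open>The norm of a self-adjoint operator is its numerical radius. Polarisation and the
  parallelogram law bound \<open>inner g (a \<cdot> f)\<close>, where \<open>g\<close> has the
  length of \<open>f\<close> and the direction of \<open>a \<cdot> f\<close>.\<close>

lemma norm_le_of_form:
  assumes "star a = a" "0 \<le> t" "\<And>f. \<bar>inner f (a \<cdot> f)\<bar> \<le> t * (norm f)\<^sup>2"
  shows "norm a \<le> t"
proof (rule norm_bop_bound[OF assms(2)])
  fix f
  show "norm (a \<cdot> f) \<le> t * norm f"
  proof (cases "a \<cdot> f = 0 \<or> f = 0")
    case True
    then show ?thesis using assms(2) by (auto simp: act_simps)
  next
    case False
    define g where "g = (norm f / norm (a \<cdot> f)) *\<^sub>R (a \<cdot> f)"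
    have ng: "norm g = norm f" using False by (simp add: g_def)
    have sym: "inner f (a \<cdot> g) = inner g (a \<cdot> f)"
      using act_star_inner[of a f g] assms(1) by (simp add: inner_commute)
    have "4 * inner g (a \<cdot> f) = inner (f + g) (a \<cdot> (f + g)) - inner (f - g) (a \<cdot> (f - g))"
      using sym by (simp add: act_simps algebra_simps)
    also have "\<dots> \<le> t * (norm (f + g))\<^sup>2 + t * (norm (f - g))\<^sup>2"
      using assms(3)[of "f + g"] assms(3)[of "f - g"] by linarith
    also have "\<dots> = t * (2 * (norm f)\<^sup>2 + 2 * (norm g)\<^sup>2)"
      unfolding power2_norm_eq_inner by (simp add: algebra_simps)
    also have "\<dots> = 4 * (t * (norm f)\<^sup>2)" by (simp add: ng)
    finally have "inner g (a \<cdot> f) \<le> t * (norm f)\<^sup>2" by simp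
    moreover have "inner g (a \<cdot> f) = norm f * norm (a \<cdot> f)"
      using False by (simp add: g_def dot_square_norm power2_eq_square)
    ultimately have "norm f * norm (a \<cdot> f) \<le> norm f * (t * norm f)"
      by (simp add: power2_eq_square ac_simps)
    then show ?thesis using False by (simp add: mult_le_cancel_left)
  qed
qed

lemma pos_le_norm:
  assumes "pos a" "pos (b - a)" shows "norm a \<le> norm b"
proof (rule norm_le_of_form)
  fix f
  have "inner f (a \<cdot> f) \<le> inner f (b \<cdot> f)"
    using assms(2) by (simp add: pos_def act_simps inner_diff_right)
  then show "\<bar>inner f (a \<cdot> f)\<bar> \<le> norm b * (norm f)\<^sup>2"
    using inner_act_le[of f b] assms(1) by (simp add: pos_def)
qed (use assms(1) in \<open>simp_all add: pos_def\<close>)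

lemma pos_scaleR_1_diff:
  assumes "star a = a" "norm a \<le> t" shows "pos (t *\<^sub>R 1 - a)"
proof -
  have "inner f (a \<cdot> f) \<le> t * inner f f" for f
    using inner_act_le[of f a] mult_right_mono[OF assms(2), of "(norm f)\<^sup>2"]
    by (simp add: power2_norm_eq_inner)
  then show ?thesis
    using assms(1) by (simp add: pos_def act_simps inner_diff_right)
qed

lemma pos_1_diff: "pos a \<Longrightarrow> norm a \<le> 1 \<Longrightarrow> pos (1 - a)"
  using pos_scaleR_1_diff[of a 1] by (simp add: pos_star)

lemma norm_le_1_of_pos: "pos a \<Longrightarrow> pos (1 - a) \<Longrightarrow> norm a \<le> 1"
  using pos_le_norm[of a 1] by simp

lemma star_power [simp]: "star (a ^ n) = star a ^ n"
  by (induction n) (simp_all flip: power_Suc2)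


section \<open>Closed star-subalgebras and square roots\<close>

locale star_subalgebra =
  fixes A :: "'a bop set"
  assumes closed: "closed A"
    and zero: "0 \<in> A"
    and add: "a \<in> A \<Longrightarrow> b \<in> A \<Longrightarrow> a + b \<in> A"
    and mult: "a \<in> A \<Longrightarrow> b \<in> A \<Longrightarrow> a * b \<in> A"
    and cs_mult_closed: "a \<in> A \<Longrightarrow> cs c * a \<in> A"
    and star_closed: "a \<in> A \<Longrightarrow> star a \<in> A"
begin

lemma scaleR: "a \<in> A \<Longrightarrow> r *\<^sub>R a \<in> A"
  using cs_mult_closed[of a "of_real r"] by (simp add: cs_of_real)

lemma uminus: "a \<in> A \<Longrightarrow> - a \<in> A"
  using scaleR[of a "-1"] by simp

lemma diff: "a \<in> A \<Longrightarrow> b \<in> A \<Longrightarrow> a - b \<in> A"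
  using add[of a "- b"] uminus[of b] by simp

lemma sum: "(\<And>i. i \<in> I \<Longrightarrow> f i \<in> A) \<Longrightarrow> sum f I \<in> A"
  by (induction I rule: infinite_finite_induct) (auto simp: zero add)

lemma limit: "(\<And>n. X n \<in> A) \<Longrightarrow> X \<longlonglongrightarrow> a \<Longrightarrow> a \<in> A"
  using closed closed_sequentially by blast

lemmas closure_rules = zero add mult cs_mult_closed star_closed scaleR uminus diff sum

end

lemma star_subalgebra_UNIV: "star_subalgebra UNIV"
  by unfold_locales auto

text \<open>Iteration towards the fixed point y = (x + y y) / 2, which means (1 - y)^2 = 1 - x. It
  is defined in any normed algebra because the real iteration at 1 serves as a majorant for every x
  of norm at most 1.\<close>

fun sqrt_iter :: "'b::real_normed_algebra_1 \<Rightarrow> nat \<Rightarrow> 'b" where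
  "sqrt_iter x 0 = 0"
| "sqrt_iter x (Suc n) = (1/2) *\<^sub>R (x + sqrt_iter x n * sqrt_iter x n)"

lemma sqrt_iter_real: "0 \<le> sqrt_iter (1::real) n \<and> sqrt_iter (1::real) n \<le> 1
    \<and> sqrt_iter (1::real) n \<le> sqrt_iter (1::real) (Suc n)"
proof (induction n)
  case (Suc n)
  define t where "t = sqrt_iter (1::real) n"
  define s where "s = sqrt_iter (1::real) (Suc n)"
  have t: "0 \<le> t" "t \<le> 1" "t \<le> s" and s: "s = (1 + t * t) / 2"
    using Suc by (simp_all add: t_def s_def)
  have "t * t \<le> 1" using t by (simp add: mult_le_one)
  moreover have "t * t \<le> s * s" by (rule mult_mono) (use t in linarith)+
  moreover have "0 \<le> t * t" by simp
  moreover have "0 \<le> s \<and> s \<le> 1 \<and> s \<le> (1 + q) / 2"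
    if "p \<le> 1" "p \<le> q" "0 \<le> p" "s = (1 + p) / 2" for p q
    using that by auto
  ultimately have "0 \<le> s \<and> s \<le> 1 \<and> s \<le> (1 + s * s) / 2"
    using s by blast
  then show ?case by (simp add: s_def)
qed simp

lemma sqrt_iter_real_tendsto: "sqrt_iter (1::real) \<longlonglongrightarrow> 1"
proof -
  have "incseq (sqrt_iter (1::real))"
    using sqrt_iter_real by (intro incseq_SucI) blast
  moreover have "bdd_above (range (sqrt_iter (1::real)))"
    using sqrt_iter_real by (intro bdd_aboveI[of _ 1]) blast
  ultimately obtain L where L: "sqrt_iter (1::real) \<longlonglongrightarrow> L"
    using LIMSEQ_incseq_SUP by blast
  have "(\<lambda>n. sqrt_iter (1::real) (Suc n)) \<longlonglongrightarrow> (1/2) *\<^sub>R (1 + L * L)"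
    by (simp only: sqrt_iter.simps) (intro tendsto_intros L)
  from LIMSEQ_unique[OF this LIMSEQ_Suc[OF L]] have "(L - 1) * (L - 1) = 0"
    by (simp add: field_simps)
  then show ?thesis using L by simp
qed

lemma sqrt_iter_commute: "x * sqrt_iter x n = sqrt_iter x n * x"
proof (induction n)
  case (Suc n)
  have "x * (sqrt_iter x n * sqrt_iter x n) = sqrt_iter x n * sqrt_iter x n * x"
    by (metis Suc mult.assoc)
  then show ?case by (simp add: distrib_left distrib_right)
qed simp

lemma sqrt_iter_commute2: "sqrt_iter x m * sqrt_iter x n = sqrt_iter x n * sqrt_iter x m"
proof (induction m)
  case (Suc m)
  have "sqrt_iter x m * sqrt_iter x m * sqrt_iter x n = sqrt_iter x n * (sqrt_iter x m * sqrt_iter x m)"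
    by (metis Suc mult.assoc)
  then show ?case by (simp add: distrib_left distrib_right sqrt_iter_commute)
qed simp

lemma norm_sqrt_iter:
  assumes "norm x \<le> 1" shows "norm (sqrt_iter x n) \<le> sqrt_iter 1 n"
proof (induction n)
  case (Suc n)
  have "norm (x + sqrt_iter x n * sqrt_iter x n) \<le> norm x + norm (sqrt_iter x n) * norm (sqrt_iter x n)"
    by (rule order_trans[OF norm_triangle_ineq]) (simp add: norm_mult_ineq)
  also have "\<dots> \<le> 1 + sqrt_iter 1 n * sqrt_iter 1 n"
    using Suc assms sqrt_iter_real[of n] by (intro add_mono mult_mono) auto
  finally show ?case by simp
qed simp

text \<open>The iterates commute, so y y - z z = (y - z) (y + z), and each increment is dominated by
  the corresponding increment of the real iteration at 1.\<close>

lemma norm_sqrt_iter_diff: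
  assumes "norm x \<le> 1" "n \<le> m"
  shows "norm (sqrt_iter x m - sqrt_iter x n) \<le> sqrt_iter 1 m - sqrt_iter 1 n"
proof -
  have incr: "norm (sqrt_iter x (Suc n) - sqrt_iter x n) \<le> sqrt_iter 1 (Suc n) - sqrt_iter 1 n" for n
  proof (induction n)
    case 0
    show ?case using norm_sqrt_iter[OF assms(1), of 1] by simp
  next
    case (Suc n)
    define y z where "y = sqrt_iter x (Suc n)" and "z = sqrt_iter x n"
    define s t where "s = sqrt_iter (1::real) (Suc n)" and "t = sqrt_iter (1::real) n"
    have "sqrt_iter x (Suc (Suc n)) - sqrt_iter x (Suc n) = (1/2) *\<^sub>R (y * y - z * z)"
      by (simp add: y_def z_def flip: scaleR_diff_right)
    also have "y * y - z * z = (y - z) * (y + z)"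
      using sqrt_iter_commute2[of x "Suc n" n] unfolding y_def z_def by (simp only: algebra_simps)
    finally have eq: "sqrt_iter x (Suc (Suc n)) - sqrt_iter x (Suc n) = (1/2) *\<^sub>R ((y - z) * (y + z))" .
    have "norm ((y - z) * (y + z)) \<le> norm (y - z) * norm (y + z)"
      by (rule norm_mult_ineq)
    also have "\<dots> \<le> (s - t) * (s + t)"
    proof (intro mult_mono)
      show "norm (y - z) \<le> s - t" using Suc by (simp only: y_def z_def s_def t_def)
      show "norm (y + z) \<le> s + t"
        using norm_triangle_ineq[of y z] norm_sqrt_iter[OF assms(1), of n] norm_sqrt_iter[OF assms(1), of "Suc n"]
        unfolding y_def z_def s_def t_def by linarith
      show "0 \<le> s - t" using sqrt_iter_real[of n] by (simp add: s_def t_def)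
    qed simp
    finally have "norm (sqrt_iter x (Suc (Suc n)) - sqrt_iter x (Suc n)) \<le> (1/2) * ((s - t) * (s + t))"
      unfolding eq by simp
    also have "\<dots> = (1/2) *\<^sub>R (1 + s * s) - (1/2) *\<^sub>R (1 + t * t)"
      by (simp add: algebra_simps)
    also have "\<dots> = sqrt_iter 1 (Suc (Suc n)) - sqrt_iter 1 (Suc n)"
      by (simp add: s_def t_def)
    finally show ?case .
  qed
  show ?thesis
    using assms(2)
  proof (induction rule: dec_induct)
    case (step k)
    have eq: "sqrt_iter x (Suc k) - sqrt_iter x n = (sqrt_iter x (Suc k) - sqrt_iter x k) + (sqrt_iter x k - sqrt_iter x n)"
      by simp
    have "norm (sqrt_iter x (Suc k) - sqrt_iter x n)
        \<le> norm (sqrt_iter x (Suc k) - sqrt_iter x k) + norm (sqrt_iter x k - sqrt_iter x n)"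
      unfolding eq by (rule norm_triangle_ineq)
    then show ?case
      using incr[of k] step.IH by linarith
  qed simp
qed

lemma (in star_subalgebra) sqrt_exists_contraction:
  assumes "a \<in> A" "pos a" "norm a \<le> 1"
  shows "\<exists>b\<in>A. star b = b \<and> b * b = a"
proof -
  define x where "x = 1 - a"
  define y where "y = sqrt_iter x"
  have "norm x \<le> 1"
    unfolding x_def
    by (rule norm_le_1_of_pos) (use assms pos_1_diff in auto)
  note nd = norm_sqrt_iter_diff[OF this]
  have "Cauchy y"
  proof (rule metric_CauchyI)
    fix e :: real assume "0 < e"
    have "Cauchy (sqrt_iter (1::real))"
      using sqrt_iter_real_tendsto by (rule LIMSEQ_imp_Cauchy)
    from metric_CauchyD[OF this \<open>0 < e\<close>] obtain M
      where M: "\<forall>m\<ge>M. \<forall>n\<ge>M. dist (sqrt_iter (1::real) m) (sqrt_iter 1 n) < e" by blast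
    have "dist (y m) (y n) < e" if "m \<ge> M" "n \<ge> M" "n \<le> m" for m n
      using nd[OF \<open>n \<le> m\<close>] M[rule_format, of m n] that by (simp add: dist_norm y_def)
    then have "dist (y m) (y n) < e" if "m \<ge> M" "n \<ge> M" for m n
      using that by (metis dist_commute nat_le_linear)
    then show "\<exists>M. \<forall>m\<ge>M. \<forall>n\<ge>M. dist (y m) (y n) < e" by blast
  qed
  then obtain Y where Y: "y \<longlonglongrightarrow> Y"
    by (auto simp: Cauchy_convergent_iff convergent_def)
  have "(\<lambda>n. y (Suc n)) \<longlonglongrightarrow> (1/2) *\<^sub>R (x + Y * Y)"
    unfolding y_def sqrt_iter.simps by (intro tendsto_intros Y[unfolded y_def])
  from LIMSEQ_unique[OF this LIMSEQ_Suc[OF Y]] have "2 *\<^sub>R Y = x + Y * Y"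
    by (metis (no_types, lifting) mult.commute nonzero_mult_div_cancel_left scaleR_one scaleR_scaleR times_divide_eq_right zero_neq_numeral mult.right_neutral)
  then have "(1 - Y) * (1 - Y) = a"
    by (simp add: algebra_simps x_def scaleR_2)
  moreover have "star (1 - Y) = 1 - Y"
  proof -
    have "star (y n) = y n" for n
      using pos_star[OF assms(2)] by (induction n) (simp_all add: y_def x_def)
    then have "star Y = Y"
      using tendsto_star[OF Y] Y LIMSEQ_unique by fastforce
    then show ?thesis by simp
  qed
  moreover have "1 - Y \<in> A"
  proof (rule limit)
    \<comment> \<open>Since \<open>A\<close> need not contain 1, each iterate is subtracted from the
      value of the real iteration. This leaves a polynomial in \<open>a\<close> without constant
      term, and the real values tend to 1.\<close>
    define b where "b n = sqrt_iter (1::real) n *\<^sub>R 1 - y n" for n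
    show "b n \<in> A" for n
    proof (induction n)
      case 0
      show ?case by (simp add: b_def y_def zero)
    next
      case (Suc n)
      define t where "t = sqrt_iter (1::real) n"
      have yn: "y n = t *\<^sub>R 1 - b n" by (simp add: b_def t_def)
      have "y (Suc n) = (1/2) *\<^sub>R (x + y n * y n)" "sqrt_iter 1 (Suc n) = (1 + t * t) / 2"
        by (simp_all add: y_def t_def)
      then have "b (Suc n) = (1/2) *\<^sub>R (a + (2 * t) *\<^sub>R b n - b n * b n)"
        unfolding b_def[of "Suc n"] yn x_def
        by (simp add: algebra_simps flip: scaleR_add_left)
      moreover have "(1/2) *\<^sub>R (a + (2 * t) *\<^sub>R b n - b n * b n) \<in> A"
        using Suc assms(1) by (intro closure_rules)
      ultimately show ?case by simp
    qed
    have "b \<longlonglongrightarrow> 1 *\<^sub>R 1 - Y"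
      unfolding b_def by (intro tendsto_intros Y sqrt_iter_real_tendsto)
    then show "b \<longlonglongrightarrow> 1 - Y" by simp
  qed
  ultimately show ?thesis by blast
qed

lemma (in star_subalgebra) sqrt_exists:
  assumes "a \<in> A" "pos a"
  obtains b where "b \<in> A" "star b = b" "b * b = a"
proof (cases "a = 0")
  case True
  then show ?thesis using that[of 0] zero by simp
next
  case False
  have "(1 / norm a) *\<^sub>R a \<in> A" "pos ((1 / norm a) *\<^sub>R a)" "norm ((1 / norm a) *\<^sub>R a) \<le> 1"
    using assms by (simp_all add: scaleR pos_scaleR)
  from sqrt_exists_contraction[OF this] obtain b
    where b: "b \<in> A" "star b = b" "b * b = (1 / norm a) *\<^sub>R a" by blast
  show ?thesis
    by (rule that[of "sqrt (norm a) *\<^sub>R b"]) (use b False in \<open>simp_all add: scaleR\<close>)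
qed

text \<open>With a self-adjoint square root r of h, the difference is r (1 - h) r.\<close>

lemma pos_diff_square:
  assumes "pos h" "norm h \<le> 1" shows "pos (h - h * h)"
proof -
  obtain r where r: "star r = r" "r * r = h"
    using star_subalgebra.sqrt_exists[OF star_subalgebra_UNIV _ assms(1)] by blast
  have "pos (star r * (1 - h) * r)"
    by (intro pos_conj pos_1_diff assms)
  also have "star r * (1 - h) * r = h - h * h"
    unfolding r(1) using r(2) by (simp add: algebra_simps) (metis mult.assoc)
  finally show ?thesis .
qed


section \<open>Powers of a contraction\<close>

text \<open>\<open>w\<close> is a square so that \<open>w ^ n\<close> is visibly positive, as the
  square of the self-adjoint element \<open>(1 - h) ^ n\<close>. The elements
  \<open>1 - w ^ n\<close> become the approximate unit.\<close>

locale contraction_powers =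
  fixes h w :: "'a bop"
  assumes pos_h: "pos h" and norm_h: "norm h \<le> 1" and w_def: "w = (1 - h) * (1 - h)"
begin

lemma norm_1_diff_h: "norm (1 - h) \<le> 1"
  using pos_h norm_h by (intro norm_le_1_of_pos) (auto simp: pos_1_diff)

lemma star_h: "star h = h"
  using pos_h by (rule pos_star)

lemma w_power: "w ^ n = (1 - h) ^ n * (1 - h) ^ n"
proof -
  have "w ^ n = (1 - h) ^ (2 * n)"
    by (simp only: w_def power_mult power2_eq_square)
  then show ?thesis by (simp only: mult_2 power_add)
qed

lemma star_w_power [simp]: "star (w ^ n) = w ^ n"
  by (simp add: w_def star_h)

lemma pos_w_power: "pos (w ^ n)"
  unfolding w_power by (rule pos_square) (simp add: star_h)

lemma norm_w_power: "norm (w ^ n) \<le> 1"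
proof -
  have "norm (w ^ n) \<le> norm (1 - h) ^ n * norm (1 - h) ^ n"
    unfolding w_power by (rule order_trans[OF norm_mult_ineq]) (intro mult_mono norm_power_ineq; simp)
  also have "\<dots> \<le> 1"
    using norm_1_diff_h by (intro mult_le_one power_le_one) auto
  finally show ?thesis .
qed

lemma pos_1_diff_w_power: "pos (1 - w ^ n)"
  by (intro pos_1_diff pos_w_power norm_w_power)

lemma pos_w_power_diff:
  assumes "m \<le> n" shows "pos (w ^ m - w ^ n)"
proof -
  have "pos (star ((1 - h) ^ m) * (1 - w ^ (n - m)) * (1 - h) ^ m)"
    by (intro pos_conj pos_1_diff_w_power)
  also have "star ((1 - h) ^ m) * (1 - w ^ (n - m)) * (1 - h) ^ m
      = (1 - h) ^ m * (1 - h) ^ m - (1 - h) ^ m * w ^ (n - m) * (1 - h) ^ m"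
    by (simp add: star_h algebra_simps)
  also have "(1 - h) ^ m * w ^ (n - m) * (1 - h) ^ m = w ^ n"
    unfolding w_power using assms by (simp flip: power_add add: ac_simps)
  finally show ?thesis by (simp add: w_power)
qed

text \<open>An order-theoretic substitute for maximising t^n (1 - t) on the spectrum: the elements
  w^k (1 - w) decrease in k, and those with k < n add up to 1 - w^n, so that n w^n (1 - w) is at
  most 1.\<close>

lemma norm_w_power_1_diff: "real n * norm (w ^ n * (1 - w)) \<le> 1"
proof -
  have w_conj: "w ^ k * (1 - w) = star ((1 - h) ^ k) * (1 - w) * (1 - h) ^ k" for k
  proof -
    have "(1 - h) ^ k * (1 - w) = (1 - w) * (1 - h) ^ k"
      by (rule power_commuting_commutes) (simp add: w_def algebra_simps)
    then show ?thesis
      unfolding w_power by (simp only: star_power star_simps star_h) (metis mult.assoc)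
  qed
  have pos_k: "pos (w ^ k * (1 - w))" for k
    unfolding w_conj using pos_1_diff_w_power[of 1] by (intro pos_conj) simp
  have "pos (1 - w ^ n - real n *\<^sub>R (w ^ n * (1 - w)))"
  proof (induction n)
    case (Suc n)
    have "pos ((w ^ n * (1 - w)) - w * (w ^ n * (1 - w)))"
    proof -
      have "star ((1 - h) ^ n * (1 - w)) * ((1 - h) ^ n * (1 - w)) = (1 - w) * (w ^ n * (1 - w))"
        using star_w_power[of 1] by (simp add: w_power star_h mult.assoc)
      then show ?thesis
        using pos_star_mult[of "(1 - h) ^ n * (1 - w)"] by (simp add: left_diff_distrib)
    qed
    from pos_add[OF Suc pos_scaleR[OF this, of "real (Suc n)"]] show ?case
      by (simp add: algebra_simps power_commutes)
  qed simp
  from pos_add[OF this pos_w_power[of n]]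
  have "pos (1 - real n *\<^sub>R (w ^ n * (1 - w)))" by simp
  from pos_le_norm[OF pos_scaleR[OF pos_k] this] show ?thesis by simp
qed

text \<open>From 1 - w - h = h - h h \<ge> 0 one gets star x x \<le> C h \<le> C (1 - w).
  Conjugating by w^n bounds the squared norm of x w^n by C / n.\<close>

lemma mult_w_power_tendsto_0:
  assumes "pos (C *\<^sub>R h - star x * x)" "0 \<le> C"
  shows "(\<lambda>n. x * w ^ n) \<longlonglongrightarrow> 0"
proof -
  have "pos (C *\<^sub>R ((1 - w) - h) + (C *\<^sub>R h - star x * x))"
  proof (intro pos_add pos_scaleR assms)
    have "1 - w - h = h - h * h" by (simp add: w_def algebra_simps)
    then show "pos (1 - w - h)" using pos_diff_square[OF pos_h norm_h] by simp
  qed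
  then have le: "pos (C *\<^sub>R (1 - w) - star x * x)"
    by (simp add: algebra_simps)
  have bound: "(norm (x * w ^ n))\<^sup>2 \<le> C * (1 / real n)" if "n > 0" for n
  proof -
    have "(norm (x * w ^ n))\<^sup>2 = norm (star (w ^ n) * (star x * x) * w ^ n)"
      by (simp flip: norm_star_mult add: mult.assoc del: star_w_power star_power)
    also have "\<dots> \<le> norm (star (w ^ n) * (C *\<^sub>R (1 - w)) * w ^ n)"
    proof (rule pos_le_norm)
      show "pos (star (w ^ n) * (star x * x) * w ^ n)"
        by (intro pos_conj pos_star_mult)
      have "pos (star (w ^ n) * (C *\<^sub>R (1 - w) - star x * x) * w ^ n)"
        by (intro pos_conj le)
      then show "pos (star (w ^ n) * C *\<^sub>R (1 - w) * w ^ n - star (w ^ n) * (star x * x) * w ^ n)"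
        by (simp add: left_diff_distrib right_diff_distrib)
    qed
    also have "\<dots> = C * norm ((w ^ n * (1 - w)) * w ^ n)"
      unfolding star_w_power using assms(2) by simp
    also have "\<dots> \<le> C * (norm (w ^ n * (1 - w)) * 1)"
      using assms(2) norm_w_power[of n]
      by (intro mult_left_mono order_trans[OF norm_mult_ineq] mult_mono) auto
    also have "\<dots> \<le> C * (1 / real n)"
      using norm_w_power_1_diff[of n] that assms(2) by (intro mult_left_mono) (simp_all add: field_simps)
    finally show ?thesis .
  qed
  have "(\<lambda>n. (norm (x * w ^ n))\<^sup>2) \<longlonglongrightarrow> 0"
  proof (rule tendsto_sandwich[where f = "\<lambda>_. 0"])
    show "\<forall>\<^sub>F n in sequentially. (norm (x * w ^ n))\<^sup>2 \<le> C * (1 / real n)"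
      using bound eventually_gt_at_top[of 0] by (rule eventually_mono[rotated])
    show "(\<lambda>n. C * (1 / real n)) \<longlonglongrightarrow> 0"
      using tendsto_mult[OF tendsto_const lim_1_over_n, of C] by simp
  qed auto
  from tendsto_real_sqrt[OF this] show ?thesis
    by (simp add: tendsto_norm_zero_iff)
qed

end


section \<open>Sublinear functionals and semi-inner products\<close>

definition sublinear :: "('v::real_vector \<Rightarrow> real) \<Rightarrow> bool" where
  "sublinear p \<longleftrightarrow> (\<forall>x y. p (x + y) \<le> p x + p y) \<and> (\<forall>r x. 0 \<le> r \<longrightarrow> p (r *\<^sub>R x) = r * p x)"

lemma sublinear_0: "sublinear p \<Longrightarrow> p 0 = 0"
  unfolding sublinear_def by (metis mult_zero_left order_refl scaleR_zero_left)

lemma sublinear_minus: "sublinear p \<Longrightarrow> - p (- x) \<le> p x"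
  using sublinear_0[of p] unfolding sublinear_def by (metis add.right_inverse diff_0 diff_le_eq)

text \<open>A minimal sublinear functional \<open>s\<close> is linear, since the sublinear functional
  \<open>\<lambda>x. INF t\<ge>0. s (x + t a) - t s a\<close> lies below it.\<close>

lemma minimal_sublinear_additive:
  assumes s: "sublinear s" and min: "\<And>s'. sublinear s' \<Longrightarrow> (\<And>x. s' x \<le> s x) \<Longrightarrow> s' = s"
  shows "s (x + a) = s x + s a"
proof -
  note add = s[unfolded sublinear_def, THEN conjunct1, rule_format]
  note hom = s[unfolded sublinear_def, THEN conjunct2, rule_format]
  define S where "S x = (\<lambda>t. s (x + t *\<^sub>R a) - t * s a) ` {0..}" for x
  define s' where "s' x = Inf (S x)" for x
  \<comment> \<open>Subadditivity is applied to
    \<open>t *\<^sub>R a = (x + t *\<^sub>R a) + (- x)\<close>, so the infimum defining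
    \<open>s'\<close> is finite.\<close>
  have lower: "- s (- x) \<le> s (x + t *\<^sub>R a) - t * s a" if "0 \<le> t" for x t
    using add[of "x + t *\<^sub>R a" "- x"] hom[OF that, of a] by simp
  have bdd: "bdd_below (S x)" for x
    using lower unfolding S_def by (intro bdd_belowI2[of _ "- s (- x)"]) auto
  have ne: "S x \<noteq> {}" for x by (auto simp: S_def)
  have le: "s' x \<le> s (x + t *\<^sub>R a) - t * s a" if "0 \<le> t" for x t
    unfolding s'_def using that by (intro cInf_lower bdd) (auto simp: S_def)
  have "sublinear s'"
    unfolding sublinear_def
  proof (intro conjI allI impI)
    fix x y
    have "s' (x + y) - (s (y + u *\<^sub>R a) - u * s a) \<le> s (x + t *\<^sub>R a) - t * s a" if "0 \<le> t" "0 \<le> u" for t u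
    proof -
      have "s' (x + y) \<le> s ((x + t *\<^sub>R a) + (y + u *\<^sub>R a)) - (t + u) * s a"
        using le[of "t + u" "x + y"] that by (simp add: algebra_simps)
      then show ?thesis using add[of "x + t *\<^sub>R a" "y + u *\<^sub>R a"] by (simp add: algebra_simps)
    qed
    then have "s' (x + y) - (s (y + u *\<^sub>R a) - u * s a) \<le> s' x" if "0 \<le> u" for u
      unfolding s'_def[of x] using that ne by (intro cInf_greatest) (auto simp: S_def)
    then have "s' (x + y) - s' x \<le> s (y + u *\<^sub>R a) - u * s a" if "0 \<le> u" for u
      using that by (simp add: algebra_simps)
    then have "s' (x + y) - s' x \<le> s' y"
      unfolding s'_def[of y] using ne by (intro cInf_greatest) (auto simp: S_def)
    then show "s' (x + y) \<le> s' x + s' y" by simp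
  next
    fix r :: real and x :: 'a assume "0 \<le> r"
    have pos: "s' (r *\<^sub>R x) \<le> r * s' x" if "0 < r" for r x
    proof -
      have "s' (r *\<^sub>R x) / r \<le> s (x + t *\<^sub>R a) - t * s a" if "0 \<le> t" for t
        using le[of "r * t" "r *\<^sub>R x"] hom[of r "x + t *\<^sub>R a"] that \<open>0 < r\<close>
        by (simp add: scaleR_right_distrib field_simps)
      then have "s' (r *\<^sub>R x) / r \<le> s' x"
        unfolding s'_def[of x] using ne by (intro cInf_greatest) (auto simp: S_def)
      then show ?thesis using that by (simp add: field_simps)
    qed
    show "s' (r *\<^sub>R x) = r * s' x"
    proof (cases "r = 0")
      case True
      have "S 0 = {0}"
        using hom sublinear_0[OF s] by (auto simp: S_def image_iff intro: exI[of _ 0])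
      then show ?thesis by (simp add: True s'_def)
    next
      case False
      then have "0 < r" using \<open>0 \<le> r\<close> by simp
      have "s' x \<le> (1/r) * s' (r *\<^sub>R x)"
        using pos[of "1/r" "r *\<^sub>R x"] \<open>0 < r\<close> by simp
      then show ?thesis
        using pos[OF \<open>0 < r\<close>, of x] \<open>0 < r\<close> by (simp add: field_simps)
    qed
  qed
  moreover have "s' x \<le> s x" for x using le[of 0 x] by simp
  ultimately have "s' = s" by (rule min)
  then show ?thesis
    using le[of 1 x] add[of x a] by simp
qed

text \<open>Zorn's lemma is applied to the sublinear functionals below \<open>p\<close>, with the
  relation \<open>r\<close> pointing downwards; a minimal one is linear. No functional has to be
  extended from a subspace.\<close>

theorem Hahn_Banach_sublinear:
  fixes p :: "'v::real_vector \<Rightarrow> real"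
  assumes p: "sublinear p"
  obtains F where "\<And>x y. F (x + y) = F x + F y" "\<And>r x. F (r *\<^sub>R x) = r * F x" "\<And>x. F x \<le> p x"
proof -
  define r where "r = {(s, s'). sublinear s \<and> sublinear s' \<and> (\<forall>x. s' x \<le> s x) \<and> (\<forall>x. s x \<le> p x)}"
  have lower: "- p (- x) \<le> s x" if "sublinear s" "\<forall>x. s x \<le> p x" for s x
    using sublinear_minus[OF that(1), of x] that(2)[rule_format, of "- x"] by linarith
  have Field: "Field r = {s. sublinear s \<and> (\<forall>x. s x \<le> p x)}"
    using order_trans by (fastforce simp: r_def Field_def)
  have "\<exists>m\<in>Field r. \<forall>a\<in>Field r. (m, a) \<in> r \<longrightarrow> a = m"
  proof (rule Zorns_po_lemma)
    show "Partial_order r"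
      unfolding partial_order_on_def preorder_on_def
    proof (intro conjI)
      show "r \<subseteq> Field r \<times> Field r" by (auto simp: Field_def)
      show "refl_on (Field r) r" unfolding refl_on_def Field by (auto simp: r_def)
      show "trans r" unfolding trans_def r_def by (auto intro: order_trans)
      show "antisym r" unfolding antisym_def r_def by (auto intro!: ext antisym)
    qed
    fix C assume C: "C \<in> Chains r"
    then have CF: "C \<subseteq> Field r"
      unfolding Chains_def by (auto simp: Field_def)
    show "\<exists>u\<in>Field r. \<forall>a\<in>C. (a, u) \<in> r"
    proof (cases "C = {}")
      case True
      have "p \<in> Field r" using p by (simp add: Field)
      then show ?thesis using True by blast
    next
      case False
      define u where "u x = (INF s\<in>C. s x)" for x
      have bdd: "bdd_below ((\<lambda>s. s x) ` C)" for x
        using CF lower by (intro bdd_belowI2[of _ "- p (- x)"]) (auto simp: Field)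
      have u_le: "u x \<le> s x" if "s \<in> C" for s x
        unfolding u_def using that by (intro cINF_lower bdd)
      have sub: "sublinear u"
        unfolding sublinear_def
      proof (intro conjI allI impI)
        fix x y
        \<comment> \<open>Of two members of a chain one lies below the other. This smaller
          \<open>t\<close> serves for both summands and makes the infimum subadditive.\<close>
        have *: "u (x + y) \<le> s x + s' y" if C': "s \<in> C" "s' \<in> C" for s s'
        proof -
          have "(s, s') \<in> r \<or> (s', s) \<in> r" using C C' by (auto simp: Chains_def)
          then have "(\<forall>x. s' x \<le> s x) \<or> (\<forall>x. s x \<le> s' x)" by (auto simp: r_def)
          then obtain t where t: "t \<in> C" "\<forall>x. t x \<le> s x" "\<forall>x. t x \<le> s' x"
            using C' by (metis order_refl)
          have "u (x + y) \<le> t (x + y)" using u_le t(1) .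
          also have "\<dots> \<le> t x + t y" using t(1) CF by (auto simp: Field sublinear_def)
          finally show ?thesis using t(2)[rule_format, of x] t(3)[rule_format, of y] by linarith
        qed
        have "u (x + y) - s' y \<le> u x" if "s' \<in> C" for s'
          unfolding u_def[of x] using False *[OF _ that] by (intro cINF_greatest) (auto simp: algebra_simps)
        then have "u (x + y) - u x \<le> s' y" if "s' \<in> C" for s'
          using that by (simp add: algebra_simps)
        then have "u (x + y) - u x \<le> u y"
          unfolding u_def[of y] using False by (intro cINF_greatest)
        then show "u (x + y) \<le> u x + u y" by simp
      next
        fix r :: real and x :: 'v assume "0 \<le> r"
        have *: "s (r *\<^sub>R x) = r * s x" if "0 \<le> r" "s \<in> C" for s r x
          using that CF by (auto simp: Field sublinear_def)
        have pos: "u (r *\<^sub>R x) \<le> r * u x" if "0 < r" for r x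
        proof -
          have "u (r *\<^sub>R x) / r \<le> u x"
            unfolding u_def[of x]
          proof (rule cINF_greatest[OF False])
            fix s assume "s \<in> C"
            then show "u (r *\<^sub>R x) / r \<le> s x"
              using u_le[of s "r *\<^sub>R x"] *[of r s x] that by (simp add: field_simps)
          qed
          then show ?thesis using that by (simp add: field_simps)
        qed
        show "u (r *\<^sub>R x) = r * u x"
        proof (cases "r = 0")
          case True
          have "(\<lambda>s. s 0) ` C = {0 :: real}" using *[of 0 _ 0] False by (auto simp: image_iff)
          then show ?thesis by (simp add: True u_def)
        next
          case r: False
          then have "0 < r" using \<open>0 \<le> r\<close> by simp
          have "u x \<le> (1/r) * u (r *\<^sub>R x)"
            using pos[of "1/r" "r *\<^sub>R x"] \<open>0 < r\<close> by simp
          then show ?thesis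
            using pos[OF \<open>0 < r\<close>, of x] \<open>0 < r\<close> by (simp add: field_simps)
        qed
      qed
      moreover have up: "u x \<le> p x" for x
      proof -
        obtain s where "s \<in> C" using False by blast
        then show ?thesis using u_le[of s x] CF by (force simp: Field intro: order_trans)
      qed
      ultimately have "u \<in> Field r" by (simp add: Field)
      moreover have "(s, u) \<in> r" if "s \<in> C" for s
      proof -
        have "sublinear s \<and> (\<forall>x. s x \<le> p x)" using that CF by (auto simp: Field)
        then show ?thesis using that sub u_le by (auto simp: r_def)
      qed
      ultimately show ?thesis by blast
    qed
  qed
  then obtain m where m: "m \<in> Field r" "\<And>a. (m, a) \<in> r \<Longrightarrow> a = m"
    by (meson FieldI2)
  then have sub: "sublinear m" and mp: "\<And>x. m x \<le> p x" by (auto simp: Field)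
  have add: "m (x + y) = m x + m y" for x y
    by (rule minimal_sublinear_additive[OF sub]) (use m sub mp in \<open>auto simp: r_def\<close>)
  have neg: "m (- x) = - m x" for x
    using add[of x "- x"] sublinear_0[OF sub] by simp
  have "m (t *\<^sub>R x) = t * m x" for t x
  proof (cases "0 \<le> t")
    case False
    then have "m ((- t) *\<^sub>R x) = (- t) * m x"
      using sub unfolding sublinear_def by (metis le_cases neg_0_le_iff_le)
    then show ?thesis using neg[of "t *\<^sub>R x"] by simp
  qed (use sub in \<open>simp add: sublinear_def\<close>)
  then show ?thesis using that add mp by blast
qed

section \<open>Semi-inner products without completeness\<close>

lemma quadratic_nonneg_imp:
  fixes a b c :: real
  assumes "\<And>t. 0 \<le> c - 2 * t * b + t\<^sup>2 * a" "0 \<le> a" "0 \<le> c"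
  shows "b\<^sup>2 \<le> a * c"
proof (cases "a = 0")
  case True
  have "b = 0"
  proof (rule ccontr)
    assume "b \<noteq> 0"
    \<comment> \<open>At this point the expression, which is linear in \<open>t\<close> when
      \<open>a = 0\<close>, equals -1.\<close>
    then show False using assms(1)[of "(c + 1) / (2 * b)"] True by simp
  qed
  then show ?thesis using True by simp
next
  case False
  then have "0 < a" using assms(2) by simp
  have "0 \<le> c - b\<^sup>2 / a"
    using assms(1)[of "b / a"] \<open>0 < a\<close> by (simp add: power2_eq_square field_simps)
  then show ?thesis using \<open>0 < a\<close> by (simp add: field_simps)
qed

text \<open>Neither definiteness nor completeness is demanded. A positive functional on an algebra
  is thus an instance as it stands, without a quotient or a completion.\<close>

locale semi_inner =
  fixes V :: "'v::real_vector set" and B :: "'v \<Rightarrow> 'v \<Rightarrow> real"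
  assumes V_0: "0 \<in> V"
    and V_add: "x \<in> V \<Longrightarrow> y \<in> V \<Longrightarrow> x + y \<in> V"
    and V_scaleR: "x \<in> V \<Longrightarrow> r *\<^sub>R x \<in> V"
    and B_sym: "x \<in> V \<Longrightarrow> y \<in> V \<Longrightarrow> B x y = B y x"
    and B_add: "x \<in> V \<Longrightarrow> y \<in> V \<Longrightarrow> z \<in> V \<Longrightarrow> B (x + y) z = B x z + B y z"
    and B_scaleR: "x \<in> V \<Longrightarrow> y \<in> V \<Longrightarrow> B (r *\<^sub>R x) y = r * B x y"
    and B_nonneg: "x \<in> V \<Longrightarrow> 0 \<le> B x x"
begin

definition sn :: "'v \<Rightarrow> real" where "sn x = sqrt (B x x)"

lemma V_diff: "x \<in> V \<Longrightarrow> y \<in> V \<Longrightarrow> x - y \<in> V"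
  using V_add[of x "(-1) *\<^sub>R y"] V_scaleR[of y "-1"] by simp

lemma B_add_right: "x \<in> V \<Longrightarrow> y \<in> V \<Longrightarrow> z \<in> V \<Longrightarrow> B z (x + y) = B z x + B z y"
  by (simp add: B_sym[of z] B_add V_add)

lemma B_scaleR_right: "x \<in> V \<Longrightarrow> y \<in> V \<Longrightarrow> B y (r *\<^sub>R x) = r * B y x"
  by (simp add: B_sym[of y] B_scaleR V_scaleR)

lemma B_diff: "x \<in> V \<Longrightarrow> y \<in> V \<Longrightarrow> z \<in> V \<Longrightarrow> B (x - y) z = B x z - B y z"
  using B_add[of x "(-1) *\<^sub>R y" z] B_scaleR[of y z "-1"] V_scaleR[of y "-1"] by simp

lemma B_diff_right: "x \<in> V \<Longrightarrow> y \<in> V \<Longrightarrow> z \<in> V \<Longrightarrow> B z (x - y) = B z x - B z y"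
  by (simp add: B_sym[of z] B_diff V_diff)

lemmas B_simps = B_add B_add_right B_diff B_diff_right B_scaleR B_scaleR_right
  V_0 V_add V_diff V_scaleR

lemma sn_nonneg: "x \<in> V \<Longrightarrow> 0 \<le> sn x"
  by (simp add: sn_def B_nonneg)

lemma sn_square: "x \<in> V \<Longrightarrow> (sn x)\<^sup>2 = B x x"
  by (simp add: sn_def B_nonneg)

lemma Cauchy_Schwarz:
  assumes "x \<in> V" "y \<in> V" shows "\<bar>B x y\<bar> \<le> sn x * sn y"
proof -
  have "0 \<le> B x x - 2 * t * B x y + t\<^sup>2 * B y y" for t
    using B_nonneg[of "x - t *\<^sub>R y"] assms
    by (simp add: B_simps B_sym[of y x] power2_eq_square algebra_simps)
  then have "(B x y)\<^sup>2 \<le> B y y * B x x"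
    using B_nonneg assms by (intro quadratic_nonneg_imp) auto
  then have "sqrt ((B x y)\<^sup>2) \<le> sqrt (B y y * B x x)" by (rule real_sqrt_le_mono)
  then show ?thesis by (simp add: sn_def real_sqrt_mult mult.commute)
qed

lemma sn_triangle:
  assumes "x \<in> V" "y \<in> V" shows "sn (x + y) \<le> sn x + sn y"
proof (rule power2_le_imp_le)
  have "(sn (x + y))\<^sup>2 = (sn x)\<^sup>2 + 2 * B x y + (sn y)\<^sup>2"
    using assms by (simp add: sn_square B_simps B_sym[of y x])
  also have "\<dots> \<le> (sn x + sn y)\<^sup>2"
    using Cauchy_Schwarz[OF assms] by (simp add: power2_sum)
  finally show "(sn (x + y))\<^sup>2 \<le> (sn x + sn y)\<^sup>2" .
qed (use assms sn_nonneg in simp)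

lemma sn_scaleR: "x \<in> V \<Longrightarrow> sn (r *\<^sub>R x) = \<bar>r\<bar> * sn x"
  by (simp add: sn_def B_simps real_sqrt_mult flip: mult.assoc)

text \<open>Without completeness, a bounded functional is represented up to an arbitrarily small error by
  an approximate minimiser of \<open>B x x - 2 l x\<close>.\<close>

lemma approximate_representation:
  assumes l_add: "\<And>x y. x \<in> V \<Longrightarrow> y \<in> V \<Longrightarrow> l (x + y) = l x + l y"
    and l_scaleR: "\<And>x r. x \<in> V \<Longrightarrow> l (r *\<^sub>R x) = r * l x"
    and l_bound: "\<And>x. x \<in> V \<Longrightarrow> \<bar>l x\<bar> \<le> sn x"
    and "0 < \<epsilon>"
  obtains x where "x \<in> V" "\<And>a. a \<in> V \<Longrightarrow> \<bar>B x a - l a\<bar> \<le> \<epsilon> * sn a"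
proof -
  define P where "P x = B x x - 2 * l x" for x
  have lower: "-1 \<le> P x" if "x \<in> V" for x
    using l_bound[OF that] sn_square[OF that] zero_le_power2[of "sn x - 1"]
    by (simp add: P_def power2_diff)
  have bdd: "bdd_below (P ` V)" using lower by (intro bdd_belowI2) auto
  have "Inf (P ` V) < Inf (P ` V) + \<epsilon>\<^sup>2" using \<open>0 < \<epsilon>\<close> by simp
  then obtain x where x: "x \<in> V" "P x < Inf (P ` V) + \<epsilon>\<^sup>2"
    using V_0 bdd by (subst (asm) cInf_less_iff) auto
  have "\<bar>B x a - l a\<bar> \<le> \<epsilon> * sn a" if "a \<in> V" for a
  proof -
    \<comment> \<open>\<open>x\<close> minimises \<open>P\<close> up to \<epsilon>^2. Comparing with
      the competitor \<open>x - t *\<^sub>R a\<close> for all \<open>t\<close>, the discriminant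
      turns this slack into the error \<epsilon>.\<close>
    have "0 \<le> \<epsilon>\<^sup>2 - 2 * t * (B x a - l a) + t\<^sup>2 * B a a" for t
    proof -
      have "Inf (P ` V) \<le> P (x - t *\<^sub>R a)"
        using x(1) that bdd by (intro cInf_lower) (auto simp: V_diff V_scaleR)
      also have "P (x - t *\<^sub>R a) = P x - 2 * t * (B x a - l a) + t\<^sup>2 * B a a"
        using x(1) that l_add[of x "(-t) *\<^sub>R a"] l_scaleR[of a "-t"] V_scaleR[of a "-t"]
        by (simp add: P_def B_simps B_sym[of a x] power2_eq_square algebra_simps)
      finally show ?thesis using x(2) by linarith
    qed
    then have "(B x a - l a)\<^sup>2 \<le> B a a * \<epsilon>\<^sup>2"
      using B_nonneg[OF that] by (intro quadratic_nonneg_imp) auto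
    from real_sqrt_le_mono[OF this] show ?thesis
      using \<open>0 < \<epsilon>\<close> by (simp add: sn_def real_sqrt_mult mult.commute)
  qed
  then show ?thesis using that x(1) by blast
qed

text \<open>Two approximate representers are close to each other, as one sees by testing both
  against their difference. The sequence is therefore Cauchy for \<open>sn\<close> and can stand for
  a vector of the completion.\<close>

lemma approximate_representation_sequence:
  assumes "\<And>x y. x \<in> V \<Longrightarrow> y \<in> V \<Longrightarrow> l (x + y) = l x + l y"
    and "\<And>x r. x \<in> V \<Longrightarrow> l (r *\<^sub>R x) = r * l x"
    and "\<And>x. x \<in> V \<Longrightarrow> \<bar>l x\<bar> \<le> sn x"
  obtains X where "\<And>n. X n \<in> V" "\<And>n a. a \<in> V \<Longrightarrow> \<bar>B (X n) a - l a\<bar> \<le> inverse (real (Suc n)) * sn a"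
    "\<And>m n. sn (X m - X n) \<le> inverse (real (Suc m)) + inverse (real (Suc n))"
proof -
  have "\<exists>x. x \<in> V \<and> (\<forall>a\<in>V. \<bar>B x a - l a\<bar> \<le> inverse (real (Suc n)) * sn a)" for n
    by (rule approximate_representation[of l "inverse (real (Suc n))"]) (use assms in auto)
  then obtain X where X: "\<And>n. X n \<in> V"
    "\<And>n a. a \<in> V \<Longrightarrow> \<bar>B (X n) a - l a\<bar> \<le> inverse (real (Suc n)) * sn a"
    by metis
  have "sn (X m - X n) \<le> inverse (real (Suc m)) + inverse (real (Suc n))" for m n
  proof -
    define a where "a = X m - X n"
    have a: "a \<in> V" using X(1) by (simp add: a_def V_diff)
    have "(sn a)\<^sup>2 = (B (X m) a - l a) - (B (X n) a - l a)"
      using a X(1) by (simp add: sn_square a_def B_simps)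
    also have "\<dots> \<le> (inverse (real (Suc m)) + inverse (real (Suc n))) * sn a"
      using X(2)[OF a, of m] X(2)[OF a, of n] by (simp add: distrib_right)
    finally have "sn a * sn a \<le> (inverse (real (Suc m)) + inverse (real (Suc n))) * sn a"
      by (simp add: power2_eq_square)
    then show ?thesis
      using sn_nonneg[OF a] unfolding a_def[symmetric]
      by (cases "sn a = 0") (auto simp: mult_le_cancel_right)
  qed
  then show ?thesis using that X by blast
qed

text \<open>Without completeness there need be no nearest point of \<open>D\<close>. A
  near-minimiser \<open>c0\<close> of the distance takes its place, and \<open>z = x - c0\<close>
  still separates because \<open>d\<close> leaves room.\<close>

lemma separation:
  assumes D: "D \<subseteq> V" "D \<noteq> {}" and x: "x \<in> V" and "0 < d"
    and far: "\<And>c. c \<in> D \<Longrightarrow> d \<le> sn (x - c)" and bound: "\<And>c. c \<in> D \<Longrightarrow> sn c \<le> M"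
    and convex: "\<And>c c' t. c \<in> D \<Longrightarrow> c' \<in> D \<Longrightarrow> 0 \<le> t \<Longrightarrow> t \<le> 1 \<Longrightarrow> c + t *\<^sub>R (c' - c) \<in> D"
  obtains z where "z \<in> V" "\<And>c. c \<in> D \<Longrightarrow> B c z < B x z"
proof -
  define Q where "Q c = B (x - c) (x - c)" for c
  define \<delta> where "\<delta> = Inf (Q ` D)"
  have dQ: "d\<^sup>2 \<le> Q c" if "c \<in> D" for c
  proof -
    have "d\<^sup>2 \<le> (sn (x - c))\<^sup>2" using far[OF that] \<open>0 < d\<close> by (intro power_mono) auto
    then show ?thesis using that D x by (subst (asm) sn_square) (auto simp: Q_def V_diff)
  qed
  have bdd: "bdd_below (Q ` D)" using dQ by (intro bdd_belowI2) auto
  have "d\<^sup>2 \<le> \<delta>" unfolding \<delta>_def using D(2) dQ by (intro cInf_greatest) auto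
  then have "0 < \<delta>" using \<open>0 < d\<close> by (meson less_le_trans zero_less_power)
  have "0 \<le> M" using D bound sn_nonneg by (meson all_not_in_conv order_trans subsetD)
  \<comment> \<open>Moving from \<open>c0\<close> towards \<open>c\<close> by the fraction
    \<open>t\<close> changes \<open>Q\<close> by -2 t B u z + t^2 B u u, where B u u \<le> K. With t
    = \<delta> / K and slack t \<delta> / 2, minimality yields 2 B u z \<le> 3 \<delta> / 2, whereas
    2 B z z \<ge> 2 \<delta>. The summand \<delta> in \<open>K\<close> ensures t \<le> 1.\<close>
  define K where "K = (2 * M)\<^sup>2 + \<delta>"
  define t where "t = \<delta> / K"
  have "0 < K" using \<open>0 < \<delta>\<close> by (simp add: K_def add_nonneg_pos)
  have t: "0 < t" "t \<le> 1" "t * K = \<delta>"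
    using \<open>0 < \<delta>\<close> \<open>0 < K\<close> by (simp_all add: t_def) (simp add: K_def)
  have "\<delta> < \<delta> + t * \<delta> / 2" using t \<open>0 < \<delta>\<close> by simp
  then obtain c0 where c0: "c0 \<in> D" "Q c0 < \<delta> + t * \<delta> / 2"
    unfolding \<delta>_def using D(2) bdd by (subst (asm) cInf_less_iff) auto
  define z where "z = x - c0"
  have c0V: "c0 \<in> V" and z: "z \<in> V" using c0 D x by (auto simp: z_def V_diff)
  have "B c z < B x z" if "c \<in> D" for c
  proof -
    have cV: "c \<in> V" using that D by auto
    define u where "u = c - c0"
    have u: "u \<in> V" using cV c0V by (simp add: u_def V_diff)
    have "\<delta> \<le> Q (c0 + t *\<^sub>R u)"
      unfolding \<delta>_def u_def using that c0 t bdd convex by (intro cInf_lower) auto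
    also have "Q (c0 + t *\<^sub>R u) = Q c0 - 2 * t * B u z + t * t * B u u"
    proof -
      have eq: "x - (c0 + t *\<^sub>R u) = z - t *\<^sub>R u" by (simp add: z_def)
      show ?thesis
        unfolding Q_def eq z_def[symmetric]
        using u z by (simp add: B_simps B_sym[of u z] algebra_simps)
    qed
    finally have 1: "2 * t * B u z \<le> t * \<delta> / 2 + t * (t * B u u)"
      using c0(2) by (simp add: mult.assoc)
    have "sn u \<le> 2 * M"
    proof -
      have "sn u \<le> sn c + sn ((-1) *\<^sub>R c0)"
        using sn_triangle[of c "(-1) *\<^sub>R c0"] cV c0V V_scaleR[of c0 "-1"] by (simp add: u_def)
      then show ?thesis using bound[OF that] bound[OF c0(1)] c0V sn_scaleR[of c0 "-1"] by simp
    qed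
    then have "B u u \<le> K"
      using power_mono[OF _ sn_nonneg[OF u], of "2 * M" 2] u \<open>0 < \<delta>\<close> by (simp add: sn_square K_def)
    then have "t * B u u \<le> \<delta>" using t by (metis mult_left_mono less_imp_le)
    then have "t * (t * B u u) \<le> t * \<delta>" using t by (intro mult_left_mono) auto
    then have "t * (2 * B u z) \<le> t * (3 / 2 * \<delta>)" using 1 by (simp add: algebra_simps)
    then have "2 * B u z \<le> 3 / 2 * \<delta>" using t by (simp add: mult_le_cancel_left)
    moreover have "\<delta> \<le> B z z"
      unfolding \<delta>_def z_def using c0 bdd by (intro cInf_lower) (auto simp: Q_def)
    ultimately have "B u z < B z z" using \<open>0 < \<delta>\<close> by linarith
    then show ?thesis using cV c0V x z by (simp add: u_def B_simps) (simp add: z_def B_simps)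
  qed
  then show ?thesis using that z by blast
qed

end


section \<open>Positive functionals\<close>

text \<open>The unit is allowed to differ from 1: that of a group algebra is the projection onto the
  functions supported on the carrier, inside the space over the whole type.\<close>

locale unital_star_subalgebra = star_subalgebra A for A :: "'a bop set" +
  fixes e :: "'a bop"
  assumes unit: "e \<in> A" and unit_left: "a \<in> A \<Longrightarrow> e * a = a" and unit_right: "a \<in> A \<Longrightarrow> a * e = a"
begin

lemma star_unit: "star e = e"
  by (metis star_simps(3) star_star unit star_closed unit_right)

lemma pos_unit: "pos e"
  using pos_square[OF star_unit] unit_left[OF unit] by simp

lemma norm_unit: "norm e \<le> 1"
proof -
  have "norm e = norm e * norm e"
    using norm_star_mult[of e] by (simp only: star_unit unit_left[OF unit] power2_eq_square)
  then have "norm e = 0 \<or> norm e = 1" by (simp only: mult_cancel_left1)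
  then show ?thesis by linarith
qed

lemma pos_unit_diff:
  assumes "a \<in> A" "star a = a" "norm a \<le> t" shows "pos (t *\<^sub>R e - a)"
proof -
  have "pos (star e * (t *\<^sub>R 1 - a) * e)"
    by (intro pos_conj pos_scaleR_1_diff assms)
  then show ?thesis
    using assms(1) unit by (simp add: star_unit right_diff_distrib left_diff_distrib unit_left unit_right)
qed

text \<open>Functionals will be known to be nonnegative only on elements \<open>star r * r\<close>
  with \<open>r\<close> in the algebra. The inequality between \<open>star c * c\<close> and its
  norm times the unit is put in this form.\<close>

lemma domination:
  assumes "c \<in> A"
  obtains r where "r \<in> A" "star r * r = (norm c)\<^sup>2 *\<^sub>R e - star c * c"
proof -
  have "star c * c \<in> A" using assms by (intro closure_rules)
  moreover have "norm (star c * c) \<le> (norm c)\<^sup>2" by (simp add: norm_star_mult)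
  ultimately have "pos ((norm c)\<^sup>2 *\<^sub>R e - star c * c)"
    by (intro pos_unit_diff) auto
  moreover have "(norm c)\<^sup>2 *\<^sub>R e - star c * c \<in> A"
    using assms unit by (intro closure_rules)
  ultimately show ?thesis using that by (metis sqrt_exists)
qed

end

locale real_positive = unital_star_subalgebra A e for A :: "'a bop set" and e +
  fixes \<omega> :: "'a bop \<Rightarrow> real"
  assumes fun_add: "a \<in> A \<Longrightarrow> b \<in> A \<Longrightarrow> \<omega> (a + b) = \<omega> a + \<omega> b"
    and fun_scaleR: "a \<in> A \<Longrightarrow> \<omega> (r *\<^sub>R a) = r * \<omega> a"
    and fun_star: "a \<in> A \<Longrightarrow> \<omega> (star a) = \<omega> a"
    and fun_nonneg: "a \<in> A \<Longrightarrow> 0 \<le> \<omega> (star a * a)"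
begin

sublocale semi_inner A "\<lambda>a b. \<omega> (star b * a)"
proof
  fix x y z r assume "x \<in> A" "y \<in> A"
  show "\<omega> (star y * x) = \<omega> (star x * y)"
    using fun_star[of "star x * y"] \<open>x \<in> A\<close> \<open>y \<in> A\<close> by (simp add: closure_rules)
qed (simp_all add: closure_rules fun_add fun_scaleR fun_nonneg distrib_left)

text \<open>In GNS terms, left multiplication by \<open>c\<close> is a bounded operator of norm at
  most \<open>norm c\<close>.\<close>

lemma sn_mult_le:
  assumes "c \<in> A" "a \<in> A" shows "sn (c * a) \<le> norm c * sn a"
proof (rule power2_le_imp_le)
  obtain r where r: "r \<in> A" "star r * r = (norm c)\<^sup>2 *\<^sub>R e - star c * c"
    using domination[OF assms(1)] .
  have "0 \<le> \<omega> (star (r * a) * (r * a))" using r assms by (intro fun_nonneg closure_rules)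
  also have "star (r * a) * (r * a) = star a * (star r * r) * a" by (simp add: mult.assoc)
  also have "\<dots> = (norm c)\<^sup>2 *\<^sub>R (star a * a) - star (c * a) * (c * a)"
    unfolding r(2) using assms by (simp add: algebra_simps unit_left)
  also have "\<omega> \<dots> = (norm c)\<^sup>2 * \<omega> (star a * a) - \<omega> (star (c * a) * (c * a))"
    using fun_add[of "(norm c)\<^sup>2 *\<^sub>R (star a * a)" "(-1) *\<^sub>R (star (c * a) * (c * a))"]
      fun_scaleR[of "star (c * a) * (c * a)" "-1"] fun_scaleR[of "star a * a"] assms
    by (simp add: closure_rules)
  finally show "(sn (c * a))\<^sup>2 \<le> (norm c * sn a)\<^sup>2"
    using assms by (simp add: power_mult_distrib sn_square closure_rules)
qed (use assms sn_nonneg in simp)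

end

locale positive_functional = unital_star_subalgebra A e for A :: "'a bop set" and e +
  fixes g :: "'a bop \<Rightarrow> complex"
  assumes g_add: "a \<in> A \<Longrightarrow> b \<in> A \<Longrightarrow> g (a + b) = g a + g b"
    and g_cs: "a \<in> A \<Longrightarrow> g (cs c * a) = c * g a"
    and g_pos: "a \<in> A \<Longrightarrow> g (star a * a) \<in> \<real>\<^sub>\<ge>\<^sub>0"
begin

lemma g_scaleR: "a \<in> A \<Longrightarrow> g (r *\<^sub>R a) = r * g a"
  using g_cs[of a "of_real r"] by (simp add: cs_of_real)

lemma g_minus: "a \<in> A \<Longrightarrow> g (- a) = - g a"
  using g_scaleR[of a "-1"] by simp

lemma g_diff: "a \<in> A \<Longrightarrow> b \<in> A \<Longrightarrow> g (a - b) = g a - g b"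
  using g_add[of a "- b"] g_minus[of b] uminus[of b] by simp

lemma g_0 [simp]: "g 0 = 0"
  using g_scaleR[of 0 0] zero by simp

lemma g_sum: "(\<And>i. i \<in> I \<Longrightarrow> f i \<in> A) \<Longrightarrow> g (sum f I) = (\<Sum>i\<in>I. g (f i))"
  by (induction I rule: infinite_finite_induct) (auto simp: g_add sum)

lemma g_pos_Re: "a \<in> A \<Longrightarrow> 0 \<le> Re (g (star a * a))" "a \<in> A \<Longrightarrow> Im (g (star a * a)) = 0"
  using g_pos[of a] by (auto simp: nonneg_Reals_def)

text \<open>Positivity at \<open>a + e\<close> makes g a + g (star a) real. The same for
  \<open>cs \<i> * a\<close> gives equality of the real parts.\<close>

lemma g_star:
  assumes "a \<in> A" shows "g (star a) = cnj (g a)"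
proof -
  have *: "Im (g a) + Im (g (star a)) = 0" if "a \<in> A" for a
  proof -
    have "star (a + e) * (a + e) = star a * a + star a + a + e"
      using that by (simp add: algebra_simps star_unit unit unit_left unit_right star_closed)
    then have "g (star (a + e) * (a + e)) = g (star a * a) + g (star a) + g a + g e"
      using that by (simp add: g_add closure_rules unit)
    moreover have "Im (g e) = 0" using g_pos_Re(2)[OF unit] by (simp add: star_unit unit unit_left)
    ultimately show ?thesis
      using g_pos_Re(2)[of a] g_pos_Re(2)[of "a + e"] that by (simp add: add unit)
  qed
  have "star (cs \<i> * a) = cs (- \<i>) * star a" by (simp add: cs_commute)
  then have "Re (g a) = Re (g (star a))"
    using *[of "cs \<i> * a"] assms by (simp add: closure_rules g_cs)
  then show ?thesis
    using *[OF assms] by (simp add: complex_eq_iff)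
qed

sublocale real_positive A e "\<lambda>a. Re (g a)"
proof
  fix a b r assume a: "a \<in> A"
  show "Re (g (a + b)) = Re (g a) + Re (g b)" if "b \<in> A" using a that by (simp add: g_add)
  show "Re (g (r *\<^sub>R a)) = r * Re (g a)" using a by (simp add: g_scaleR)
  show "Re (g (star a)) = Re (g a)" using a by (simp add: g_star)
  show "0 \<le> Re (g (star a * a))" using a by (rule g_pos_Re)
qed

lemma sn_cs_mult: "a \<in> A \<Longrightarrow> sn (cs c * a) = cmod c * sn a"
proof -
  assume a: "a \<in> A"
  have "star (cs c * a) * (cs c * a) = cs (cnj c * c) * (star a * a)"
    by (simp only: star_simps cs_mult mult.assoc cs_left_commute[of "star a"] cs_commute[of "star a"])
  then have "star (cs c * a) * (cs c * a) = cs (of_real ((cmod c)\<^sup>2)) * (star a * a)"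
    by (simp only: complex_norm_square mult.commute[of "cnj c"])
  then have "Re (g (star (cs c * a) * (cs c * a))) = (cmod c)\<^sup>2 * Re (g (star a * a))"
    using a by (simp only: g_cs closure_rules Re_complex_of_real) simp
  then show ?thesis by (simp add: sn_def real_sqrt_mult)
qed

lemma g_Cauchy_Schwarz:
  assumes "a \<in> A" "b \<in> A" shows "cmod (g (star b * a)) \<le> sn a * sn b"
proof (cases "g (star b * a) = 0")
  case False
  define c where "c = cnj (sgn (g (star b * a)))"
  have c: "c * g (star b * a) = cmod (g (star b * a))"
    using False by (simp add: c_def sgn_eq mult.commute[of "cnj _"] complex_norm_square[symmetric] power2_eq_square)
  have [simp]: "cmod c = 1" using False by (simp add: c_def norm_sgn)
  have "cmod (g (star b * a)) = Re (g (star b * (cs c * a)))"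
    using assms by (simp add: cs_left_commute[of "star b"] g_cs closure_rules c)
  also have "\<dots> \<le> sn (cs c * a) * sn b"
    using Cauchy_Schwarz[of "cs c * a" b] assms by (simp add: closure_rules)
  finally show ?thesis using assms by (simp add: sn_cs_mult)
qed (use assms sn_nonneg in simp)

text \<open>Continuity is a consequence of positivity: Cauchy-Schwarz against the unit, then
  boundedness of left multiplication.\<close>

lemma g_bound: "a \<in> A \<Longrightarrow> cmod (g a) \<le> Re (g e) * norm a"
proof -
  assume a: "a \<in> A"
  have "cmod (g a) \<le> sn a * sn e"
    using g_Cauchy_Schwarz[OF a unit] by (simp add: star_unit unit_left a)
  also have "\<dots> \<le> (norm a * sn e) * sn e"
    using sn_mult_le[OF a unit] sn_nonneg[OF unit] by (intro mult_right_mono) (simp_all add: unit_right a)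
  also have "\<dots> = norm a * (sn e)\<^sup>2"
    by (simp add: power2_eq_square)
  also have "(sn e)\<^sup>2 = Re (g e)"
    using sn_square[OF unit] by (simp add: star_unit unit_left unit)
  finally show ?thesis by (simp add: mult.commute)
qed

lemma g_tendsto:
  assumes "X \<longlonglongrightarrow> a" "\<And>n. X n \<in> A" shows "(\<lambda>n. g (X n)) \<longlonglongrightarrow> g a"
proof -
  have a: "a \<in> A" using limit assms by blast
  have "(\<lambda>n. g (X n) - g a) \<longlonglongrightarrow> 0"
  proof (rule tendsto_norm_zero_cancel, rule tendsto_sandwich[where f = "\<lambda>_. 0"])
    show "\<forall>\<^sub>F n in sequentially. norm (g (X n) - g a) \<le> Re (g e) * norm (X n - a)"
      using g_bound[OF diff[OF assms(2) a]] assms(2) a by (simp add: g_diff)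
    show "(\<lambda>n. Re (g e) * norm (X n - a)) \<longlonglongrightarrow> 0"
      using tendsto_mult_right_zero[OF tendsto_norm_zero[OF LIM_zero[OF assms(1)]]] .
  qed auto
  then show ?thesis by (rule LIM_zero_cancel)
qed

end


section \<open>Irreducible states\<close>

text \<open>The assumption \<open>schur\<close> says that the commutant of the GNS representation of the state is
  trivial.  The GNS space is not constructed: \<open>sn a\<close> is the norm of the vector of \<open>a\<close>.\<close>

locale irreducible_state = positive_functional A e g for A :: "'a bop set" and e g +
  assumes g_unit: "g e = 1"
    and schur: "\<And>\<theta>. (\<And>a b. a \<in> A \<Longrightarrow> b \<in> A \<Longrightarrow> \<theta> (a + b) = \<theta> a + \<theta> b) \<Longrightarrow>
      (\<And>a c. a \<in> A \<Longrightarrow> \<theta> (cs c * a) = c * \<theta> a) \<Longrightarrow>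
      (\<And>a b. a \<in> A \<Longrightarrow> b \<in> A \<Longrightarrow> cmod (\<theta> (star b * a)) \<le> sn a * sn b) \<Longrightarrow>
      \<exists>c. \<forall>a\<in>A. \<theta> a = c * g a"
begin

lemma sn_unit: "sn e = 1"
  by (simp add: sn_def star_unit unit_left unit g_unit)

lemma sn_le_norm: "a \<in> A \<Longrightarrow> sn a \<le> norm a"
  using sn_mult_le[of a e] by (simp add: sn_unit unit unit_right)

lemma g_le_sn: "a \<in> A \<Longrightarrow> cmod (g a) \<le> sn a"
  using g_Cauchy_Schwarz[of a e] by (simp add: star_unit unit unit_left sn_unit)

text \<open>Vector states of orthogonal vectors of an irreducible representation are orthogonal as
  functionals.  The functional \<open>\<omega>\<close> gives another GNS space, into which the GNS space of \<open>g\<close> is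
  mapped by two intertwiners; \<open>X n\<close> and \<open>W n\<close> approximate the images of the cyclic vector.\<close>

theorem orthogonal_vector_states:
  assumes \<omega>: "real_positive A e \<omega>" and m: "m \<in> A" and n: "n \<in> A"
    and m_le: "\<And>a. a \<in> A \<Longrightarrow> sn (a * m) \<le> semi_inner.sn (\<lambda>a b. \<omega> (star b * a)) a"
    and n_le: "\<And>a. a \<in> A \<Longrightarrow> sn (a * n) \<le> semi_inner.sn (\<lambda>a b. \<omega> (star b * a)) a"
    and orth: "g (star n * m) = 0"
  shows "(sn m)\<^sup>2 + (sn n)\<^sup>2 \<le> \<omega> e"
proof -
  interpret \<omega>: real_positive A e \<omega> by (rule \<omega>)
  define \<epsilon> where "\<epsilon> k = inverse (real (Suc k))" for k
  have \<epsilon>: "\<epsilon> \<longlonglongrightarrow> 0" unfolding \<epsilon>_def by (rule LIMSEQ_inverse_real_of_nat)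
  have ex: "\<exists>X. (\<forall>k. X k \<in> A) \<and> (\<forall>k a. a \<in> A \<longrightarrow> \<bar>\<omega> (star a * X k) - Re (g (a * p))\<bar> \<le> \<epsilon> k * \<omega>.sn a) \<and>
      (\<forall>j k. \<omega>.sn (X j - X k) \<le> \<epsilon> j + \<epsilon> k)"
    if p: "p \<in> A" and le: "\<And>a. a \<in> A \<Longrightarrow> sn (a * p) \<le> \<omega>.sn a" for p
    unfolding \<epsilon>_def
  proof (rule \<omega>.approximate_representation_sequence[of "\<lambda>a. Re (g (a * p))"])
    fix a assume a: "a \<in> A"
    show "\<bar>Re (g (a * p))\<bar> \<le> \<omega>.sn a"
      using abs_Re_le_cmod[of "g (a * p)"] g_le_sn[of "a * p"] le[OF a] mult[OF a p] by linarith
  qed (use p in \<open>auto simp: distrib_right closure_rules g_add g_scaleR\<close>)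
  from ex[OF m m_le] obtain X where X: "\<And>k. X k \<in> A"
    "\<And>k a. a \<in> A \<Longrightarrow> \<bar>\<omega> (star a * X k) - Re (g (a * m))\<bar> \<le> \<epsilon> k * \<omega>.sn a"
    "\<And>j k. \<omega>.sn (X j - X k) \<le> \<epsilon> j + \<epsilon> k" by blast
  from ex[OF n n_le] obtain W where W: "\<And>k. W k \<in> A"
    "\<And>k a. a \<in> A \<Longrightarrow> \<bar>\<omega> (star a * W k) - Re (g (a * n))\<bar> \<le> \<epsilon> k * \<omega>.sn a" by blast
  \<comment> \<open>The element \<open>a * Y k\<close> stands for the image of the vector of
    \<open>a\<close> under the adjoint of an intertwiner. The estimate says, up to an error, that
    this adjoint is a contraction.\<close>
  have Z: "\<omega>.sn (a * Y k) \<le> sn a + \<epsilon> k * norm a"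
    if Y: "\<And>k. Y k \<in> A" "\<And>k a. a \<in> A \<Longrightarrow> \<bar>\<omega> (star a * Y k) - Re (g (a * p))\<bar> \<le> \<epsilon> k * \<omega>.sn a"
      and p: "p \<in> A" "\<And>a. a \<in> A \<Longrightarrow> sn (a * p) \<le> \<omega>.sn a" and a: "a \<in> A" for Y p a k
  proof -
    define z where "z = \<omega>.sn (a * Y k)"
    have aY: "a * Y k \<in> A" "star a * (a * Y k) \<in> A" "star (star a * (a * Y k)) * Y k \<in> A"
      using a Y(1) by (auto intro!: closure_rules)
    have "z\<^sup>2 = \<omega> (star (star a * (a * Y k)) * Y k)"
      using aY by (simp add: z_def \<omega>.sn_square mult.assoc)
    also have "\<dots> \<le> Re (g (star a * (a * Y k) * p)) + \<epsilon> k * \<omega>.sn (star a * (a * Y k))"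
      using Y(2)[OF aY(2), of k] by linarith
    also have "Re (g (star a * (a * Y k) * p)) \<le> sn a * z"
    proof -
      have "Re (g (star a * (a * Y k * p))) \<le> sn (a * Y k * p) * sn a"
        by (rule order_trans[OF complex_Re_le_cmod g_Cauchy_Schwarz]) (use a aY(1) p(1) mult in auto)
      also have "\<dots> \<le> z * sn a"
        using p(2)[OF aY(1)] a by (intro mult_right_mono) (auto simp: z_def sn_nonneg)
      finally show ?thesis by (simp add: mult.assoc mult.commute)
    qed
    also have "\<omega>.sn (star a * (a * Y k)) \<le> norm a * z"
      using \<omega>.sn_mult_le[OF star_closed[OF a] aY(1)] by (simp add: z_def)
    finally have "z * z \<le> (sn a + \<epsilon> k * norm a) * z"
      by (simp add: power2_eq_square algebra_simps \<epsilon>_def)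
    moreover have "0 \<le> z" "0 \<le> sn a + \<epsilon> k * norm a"
      using aY a by (simp_all add: z_def \<omega>.sn_nonneg sn_nonneg \<epsilon>_def)
    ultimately show ?thesis
      unfolding z_def[symmetric] by (cases "z = 0") (auto simp: mult_le_cancel_right)
  qed
  have ZX: "\<omega>.sn (a * X k) \<le> sn a + \<epsilon> k * norm a" if "a \<in> A" for a k
    using Z[of X m a k] X m m_le that by blast
  have ZW: "\<omega>.sn (a * W k) \<le> sn a + \<epsilon> k * norm a" if "a \<in> A" for a k
    using Z[of W n a k] W n n_le that by blast
  \<comment> \<open>The limit \<theta> is the matrix coefficient of one intertwiner composed with
    the adjoint of the other. This composition commutes with the representation, so
    \<open>schur\<close> makes \<theta> a multiple of \<open>g\<close>.\<close>
  have "\<exists>l. (\<lambda>k. g (a * X k * n)) \<longlonglongrightarrow> l" if a: "a \<in> A" for a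
  proof -
    have le: "cmod (g (a * X j * n) - g (a * X k * n)) \<le> sn (star a) * (\<epsilon> j + \<epsilon> k)" for j k
    proof -
      have "g (a * X j * n) - g (a * X k * n) = g (star (star a) * ((X j - X k) * n))"
        using a X(1) n by (simp add: algebra_simps g_diff closure_rules)
      also have "cmod \<dots> \<le> sn ((X j - X k) * n) * sn (star a)"
        using a X(1) n by (intro g_Cauchy_Schwarz closure_rules)
      also have "\<dots> \<le> (\<epsilon> j + \<epsilon> k) * sn (star a)"
        using n_le[of "X j - X k"] X(3)[of j k] a X(1)
        by (intro mult_right_mono) (auto simp: closure_rules sn_nonneg)
      finally show ?thesis by (simp add: mult.commute)
    qed
    have "Cauchy (\<lambda>k. g (a * X k * n))"
    proof (rule metric_CauchyI)
      fix r :: real assume "0 < r"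
      have "(\<lambda>k. 2 * (sn (star a) * \<epsilon> k)) \<longlonglongrightarrow> 2 * (sn (star a) * 0)"
        by (intro tendsto_intros \<epsilon>)
      then have "\<forall>\<^sub>F k in sequentially. 2 * (sn (star a) * \<epsilon> k) < r"
        using \<open>0 < r\<close> by (intro order_tendstoD(2)) auto
      then obtain M where M: "\<And>k. k \<ge> M \<Longrightarrow> 2 * (sn (star a) * \<epsilon> k) < r"
        by (auto simp: eventually_sequentially)
      have "dist (g (a * X j * n)) (g (a * X k * n)) < r" if "j \<ge> M" "k \<ge> M" for j k
        using le[of j k] M[OF that(1)] M[OF that(2)] by (simp add: dist_norm algebra_simps)
      then show "\<exists>M. \<forall>j\<ge>M. \<forall>k\<ge>M. dist (g (a * X j * n)) (g (a * X k * n)) < r" by blast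
    qed
    then show ?thesis by (auto simp: Cauchy_convergent_iff convergent_def)
  qed
  then obtain \<theta> where \<theta>: "\<And>a. a \<in> A \<Longrightarrow> (\<lambda>k. g (a * X k * n)) \<longlonglongrightarrow> \<theta> a" by metis
  have "\<exists>c. \<forall>a\<in>A. \<theta> a = c * g a"
  proof (rule schur)
    fix a b assume a: "a \<in> A" and b: "b \<in> A"
    show "\<theta> (a + b) = \<theta> a + \<theta> b"
    proof (rule LIMSEQ_unique[OF \<theta>])
      show "(\<lambda>k. g ((a + b) * X k * n)) \<longlonglongrightarrow> \<theta> a + \<theta> b"
        using tendsto_add[OF \<theta>[OF a] \<theta>[OF b]] a b X(1) n
        by (simp add: distrib_right g_add closure_rules)
    qed (use a b in \<open>simp add: add\<close>)
    show "cmod (\<theta> (star b * a)) \<le> sn a * sn b"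
    proof (rule LIMSEQ_le)
      show "(\<lambda>k. cmod (g (star b * a * X k * n))) \<longlonglongrightarrow> cmod (\<theta> (star b * a))"
        using a b by (intro tendsto_norm \<theta> closure_rules)
      show "(\<lambda>k. (sn a + \<epsilon> k * norm a) * sn b) \<longlonglongrightarrow> sn a * sn b"
        using tendsto_mult[OF tendsto_add[OF tendsto_const tendsto_mult[OF \<epsilon> tendsto_const]] tendsto_const, of "sn a" "norm a" "sn b"]
        by simp
      have "cmod (g (star b * a * X k * n)) \<le> (sn a + \<epsilon> k * norm a) * sn b" for k
      proof -
        have aX: "a * X k \<in> A" using a X(1) by (intro closure_rules)
        have "cmod (g (star b * (a * X k * n))) \<le> sn (a * X k * n) * sn b"
          using aX b n by (intro g_Cauchy_Schwarz mult[OF aX])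
        also have "\<dots> \<le> (sn a + \<epsilon> k * norm a) * sn b"
          using n_le[OF aX] ZX[OF a, of k] b by (intro mult_right_mono) (auto simp: sn_nonneg)
        finally show ?thesis by (simp add: mult.assoc)
      qed
      then show "\<exists>N. \<forall>k\<ge>N. cmod (g (star b * a * X k * n)) \<le> (sn a + \<epsilon> k * norm a) * sn b" by blast
    qed
  next
    fix a c assume a: "a \<in> A"
    show "\<theta> (cs c * a) = c * \<theta> a"
    proof (rule LIMSEQ_unique[OF \<theta>])
      show "(\<lambda>k. g (cs c * a * X k * n)) \<longlonglongrightarrow> c * \<theta> a"
        using tendsto_mult[OF tendsto_const \<theta>[OF a], of c] a X(1) n
        by (simp add: mult.assoc g_cs closure_rules)
    qed (use a in \<open>simp add: cs_mult_closed\<close>)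
  qed
  then obtain c where c: "\<And>a. a \<in> A \<Longrightarrow> \<theta> a = c * g a" by blast
  define q where "q = star n * m"
  have q: "q \<in> A" using m n by (simp add: q_def closure_rules)
  have cross: "(\<lambda>k. Re (g (q * X k * n))) \<longlonglongrightarrow> 0"
    using tendsto_Re[OF \<theta>[OF q]] by (simp add: c[OF q]) (simp add: q_def orth)
  \<comment> \<open>An upper bound for \<omega> (star V V) with V = m X k + n W k - e. The cross
    term tends to a multiple of g (star n m) = 0, so the bound tends to \<omega> e - (sn m)^2 - (sn
    n)^2.\<close>
  define bound where "bound k = (sn m + \<epsilon> k * norm m)\<^sup>2 + (sn n + \<epsilon> k * norm n)\<^sup>2 + \<omega> e
      + 2 * (Re (g (q * X k * n)) + \<epsilon> k * (sn q + \<epsilon> k * norm q))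
      - 2 * ((sn m)\<^sup>2 - \<epsilon> k * \<omega>.sn (star m)) - 2 * ((sn n)\<^sup>2 - \<epsilon> k * \<omega>.sn (star n))" for k
  have "0 \<le> bound k" for k
  proof -
    define P where "P = m * X k"
    define N where "N = n * W k"
    have P: "P \<in> A" and N: "N \<in> A" using m n X(1) W(1) by (auto simp: P_def N_def closure_rules)
    have "0 \<le> \<omega> (star (P + N - e) * (P + N - e))"
      using P N unit by (intro fun_nonneg \<omega>.fun_nonneg closure_rules)
    also have "\<dots> = \<omega> (star P * P) + \<omega> (star N * N) + \<omega> e + 2 * \<omega> (star N * P) - 2 * \<omega> P - 2 * \<omega> N"
    proof -
      have s: "\<omega> (star P * N) = \<omega> (star N * P)" "\<omega> (star P) = \<omega> P" "\<omega> (star N) = \<omega> N"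
        using \<omega>.B_sym[OF P N] \<omega>.fun_star P N by auto
      have "\<omega> (star (P + N - e) * (P + N - e)) = \<omega> (star P * P) + \<omega> (star N * P) - \<omega> (star e * P)
        + (\<omega> (star P * N) + \<omega> (star N * N) - \<omega> (star e * N))
        - (\<omega> (star P * e) + \<omega> (star N * e) - \<omega> (star e * e))"
        using P N unit by (simp only: \<omega>.B_simps)
      then show ?thesis using P N unit by (simp add: s star_unit unit_left unit_right star_closed)
    qed
    finally have 0: "0 \<le> \<omega> (star P * P) + \<omega> (star N * N) + \<omega> e + 2 * \<omega> (star N * P) - 2 * \<omega> P - 2 * \<omega> N" .
    have sq: "\<omega> (star Y * Y) \<le> r\<^sup>2" if "\<omega>.sn Y \<le> r" "Y \<in> A" for Y r
      using power_mono[OF that(1) \<omega>.sn_nonneg[OF that(2)], of 2] that(2) by (simp add: \<omega>.sn_square)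
    have 1: "\<omega> (star P * P) \<le> (sn m + \<epsilon> k * norm m)\<^sup>2"
      using ZX[OF m] P by (intro sq) (auto simp: P_def)
    have 2: "\<omega> (star N * N) \<le> (sn n + \<epsilon> k * norm n)\<^sup>2"
      using ZW[OF n] N by (intro sq) (auto simp: N_def)
    have 3: "\<omega> (star N * P) \<le> Re (g (q * X k * n)) + \<epsilon> k * (sn q + \<epsilon> k * norm q)"
    proof -
      have qX: "q * X k \<in> A" using q X(1) by (simp add: mult)
      have "\<omega> (star N * P) = \<omega> (star P * N)" using \<omega>.B_sym[OF P N] by simp
      also have "star P * N = star (q * X k) * W k" by (simp add: P_def N_def q_def mult.assoc)
      also have "\<omega> \<dots> \<le> Re (g (q * X k * n)) + \<epsilon> k * \<omega>.sn (q * X k)"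
        using W(2)[OF qX, of k] by linarith
      also have "\<epsilon> k * \<omega>.sn (q * X k) \<le> \<epsilon> k * (sn q + \<epsilon> k * norm q)"
        using ZX[OF q] by (intro mult_left_mono) (auto simp: \<epsilon>_def)
      finally show ?thesis by simp
    qed
    have 4: "(sn m)\<^sup>2 - \<epsilon> k * \<omega>.sn (star m) \<le> \<omega> P"
      using X(2)[OF star_closed[OF m], of k] m by (simp add: P_def sn_square)
    have 5: "(sn n)\<^sup>2 - \<epsilon> k * \<omega>.sn (star n) \<le> \<omega> N"
      using W(2)[OF star_closed[OF n], of k] n by (simp add: N_def sn_square)
    have "0 \<le> b1 + b2 + u + 2 * b3 - 2 * b4 - 2 * b5"
      if "0 \<le> a1 + a2 + u + 2 * a3 - 2 * a4 - 2 * a5" "a1 \<le> b1" "a2 \<le> b2" "a3 \<le> b3" "b4 \<le> a4" "b5 \<le> a5"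
      for a1 a2 a3 a4 a5 b1 b2 b3 b4 b5 u :: real
      using that by linarith
    from this[OF 0 1 2 3 4 5] show ?thesis unfolding bound_def .
  qed
  moreover have "bound \<longlonglongrightarrow> (sn m + 0 * norm m)\<^sup>2 + (sn n + 0 * norm n)\<^sup>2 + \<omega> e
      + 2 * (0 + 0 * (sn q + 0 * norm q))
      - 2 * ((sn m)\<^sup>2 - 0 * \<omega>.sn (star m)) - 2 * ((sn n)\<^sup>2 - 0 * \<omega>.sn (star n))"
    unfolding bound_def by (intro tendsto_intros \<epsilon> cross)
  ultimately have "0 \<le> (sn m + 0 * norm m)\<^sup>2 + (sn n + 0 * norm n)\<^sup>2 + \<omega> e
      + 2 * (0 + 0 * (sn q + 0 * norm q))
      - 2 * ((sn m)\<^sup>2 - 0 * \<omega>.sn (star m)) - 2 * ((sn n)\<^sup>2 - 0 * \<omega>.sn (star n))"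
    by (meson LIMSEQ_le_const)
  then show ?thesis by simp
qed

end

text \<open>For a hermitian \<theta> bounded by the GNS norms, g + \<theta>/2 and g - \<theta>/2 are
  positive and become states after normalisation. They average to \<open>g\<close>, so extremality
  makes \<theta> a multiple of \<open>g\<close>. A general \<theta> is split into two hermitian
  parts.\<close>

lemma (in positive_functional) irreducible_stateI:
  assumes g_unit: "g e = 1"
    and extreme: "\<And>\<psi> \<rho> t. positive_functional A e \<psi> \<Longrightarrow> \<psi> e = 1 \<Longrightarrow> positive_functional A e \<rho> \<Longrightarrow> \<rho> e = 1 \<Longrightarrow>
      0 < t \<Longrightarrow> t < (1::real) \<Longrightarrow> (\<And>a. a \<in> A \<Longrightarrow> g a = t * \<psi> a + (1 - t) * \<rho> a) \<Longrightarrow> (\<And>a. a \<in> A \<Longrightarrow> \<psi> a = g a)"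
  shows "irreducible_state A e g"
proof unfold_locales
  have sn_e: "sn e = 1"
    by (simp add: sn_def star_unit unit_left unit g_unit)
  have herm: "\<exists>c. \<forall>a\<in>A. \<theta> a = c * g a"
    if add\<theta>: "\<And>a b. a \<in> A \<Longrightarrow> b \<in> A \<Longrightarrow> \<theta> (a + b) = \<theta> a + \<theta> b"
      and cs\<theta>: "\<And>a c. a \<in> A \<Longrightarrow> \<theta> (cs c * a) = c * \<theta> a"
      and bound: "\<And>a b. a \<in> A \<Longrightarrow> b \<in> A \<Longrightarrow> cmod (\<theta> (star b * a)) \<le> sn a * sn b"
      and star\<theta>: "\<And>a. a \<in> A \<Longrightarrow> \<theta> (star a) = cnj (\<theta> a)" for \<theta>
  proof -
    have real\<theta>: "Im (\<theta> a) = 0" if "a \<in> A" "star a = a" for a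
      using star\<theta>[OF that(1)] that(2) by (simp add: complex_eq_iff)
    have le: "\<bar>Re (\<theta> (star a * a))\<bar> \<le> Re (g (star a * a))" if "a \<in> A" for a
      using bound[OF that that] abs_Re_le_cmod[of "\<theta> (star a * a)"] sn_square[OF that]
      by (simp add: power2_eq_square)
    define x where "x = Re (\<theta> e)"
    have x: "\<theta> e = of_real x" "\<bar>x\<bar> \<le> 1"
      using real\<theta>[OF unit star_unit] le[OF unit] unit
      by (auto simp: x_def complex_eq_iff star_unit unit_left g_unit)
    have pf: "positive_functional A e (\<lambda>a. (g a + of_real s * \<theta> a) / of_real r)"
      if "\<bar>s\<bar> \<le> 1" "0 < r" for s r :: real
    proof (unfold_locales)
      fix a assume a: "a \<in> A"
      have "\<bar>s * Re (\<theta> (star a * a))\<bar> \<le> 1 * Re (g (star a * a))"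
        unfolding abs_mult using that le[OF a] by (intro mult_mono) auto
      then have "0 \<le> Re (g (star a * a)) + s * Re (\<theta> (star a * a))" by linarith
      moreover have "Im (\<theta> (star a * a)) = 0" using a by (intro real\<theta>) (auto simp: closure_rules)
      ultimately show "(g (star a * a) + of_real s * \<theta> (star a * a)) / of_real r \<in> \<real>\<^sub>\<ge>\<^sub>0"
        using g_pos_Re(2)[OF a] that by (simp add: complex_nonneg_Reals_iff Re_divide_of_real Im_divide_of_real)
      show "(g (cs c * a) + of_real s * \<theta> (cs c * a)) / of_real r = c * ((g a + of_real s * \<theta> a) / of_real r)" for c
        using a by (simp add: g_cs cs\<theta> field_simps)
      show "(g (a + b) + of_real s * \<theta> (a + b)) / of_real r
          = (g a + of_real s * \<theta> a) / of_real r + (g b + of_real s * \<theta> b) / of_real r" if "b \<in> A" for b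
        using a that by (simp add: g_add add\<theta> distrib_left add_divide_distrib)
    qed
    \<comment> \<open>The value of g + \<theta>/2 at the unit. As \<bar>x\<bar> \<le> 1, halving
      \<theta> keeps the weights r/2 and 1 - r/2 strictly between 0 and 1.\<close>
    define r where "r = 1 + x / 2"
    have r: "0 < r" "r < 2" using x(2) by (auto simp: r_def)
    have "(g a + of_real (1/2) * \<theta> a) / of_real r = g a" if "a \<in> A" for a
    proof (rule extreme[OF _ _ _ _ _ _ _ that])
      show "positive_functional A e (\<lambda>a. (g a + of_real (1/2) * \<theta> a) / of_real r)"
        using r by (intro pf) auto
      show "positive_functional A e (\<lambda>a. (g a + of_real (-1/2) * \<theta> a) / of_real (2 - r))"
        using r by (intro pf) auto
      have "complex_of_real r \<noteq> 0" "complex_of_real (2 - r) \<noteq> 0"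
        using r unfolding of_real_eq_0_iff by linarith+
      moreover have "1 + of_real (1/2) * complex_of_real x = of_real r" "1 + of_real (-1/2) * complex_of_real x = of_real (2 - r)"
        by (simp_all add: r_def)
      ultimately show "(g e + of_real (1/2) * \<theta> e) / of_real r = 1" "(g e + of_real (-1/2) * \<theta> e) / of_real (2 - r) = 1"
        unfolding g_unit x(1) by simp_all
      show "0 < r / 2" "r / 2 < 1" using r by auto
      show "g a = of_real (r / 2) * ((g a + of_real (1/2) * \<theta> a) / of_real r)
          + (1 - of_real (r / 2)) * ((g a + of_real (-1/2) * \<theta> a) / of_real (2 - r))" for a
      proof -
        have "(1 - of_real (r / 2)) = complex_of_real (2 - r) / 2" by (simp add: field_simps)
        then show ?thesis using \<open>complex_of_real r \<noteq> 0\<close> \<open>complex_of_real (2 - r) \<noteq> 0\<close>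
          by (simp add: field_simps)
      qed
    qed
    then have "\<theta> a = of_real (2 * (r - 1)) * g a" if "a \<in> A" for a
      using that r by (simp add: field_simps)
    then show ?thesis by blast
  qed
  fix \<theta> :: "'a bop \<Rightarrow> complex"
  assume add\<theta>: "\<And>a b. a \<in> A \<Longrightarrow> b \<in> A \<Longrightarrow> \<theta> (a + b) = \<theta> a + \<theta> b"
    and cs\<theta>: "\<And>a c. a \<in> A \<Longrightarrow> \<theta> (cs c * a) = c * \<theta> a"
    and bound: "\<And>a b. a \<in> A \<Longrightarrow> b \<in> A \<Longrightarrow> cmod (\<theta> (star b * a)) \<le> sn a * sn b"
  have star_cs: "\<theta> (star (cs c * a)) = cnj c * \<theta> (star a)" if "a \<in> A" for a c
  proof -
    have "star (cs c * a) = cs (cnj c) * star a" by (simp add: cs_commute)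
    then show ?thesis using that by (simp add: cs\<theta> star_closed)
  qed
  have bound': "cmod (\<theta> (star (star b * a))) \<le> sn a * sn b" if "a \<in> A" "b \<in> A" for a b
    using bound[OF that(2) that(1)] by (simp add: mult.commute)
  have ex: "\<exists>c. \<forall>a\<in>A. (u * \<theta> a + cnj (u * \<theta> (star a))) / 2 = c * g a" if u: "cmod u = 1" for u
  proof (rule herm)
    fix a b c assume a: "a \<in> A"
    show "(u * \<theta> (cs c * a) + cnj (u * \<theta> (star (cs c * a)))) / 2 = c * ((u * \<theta> a + cnj (u * \<theta> (star a))) / 2)"
      unfolding star_cs[OF a] cs\<theta>[OF a] by (simp add: algebra_simps)
    show "(u * \<theta> (star a) + cnj (u * \<theta> (star (star a)))) / 2 = cnj ((u * \<theta> a + cnj (u * \<theta> (star a))) / 2)"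
      by simp
    assume b: "b \<in> A"
    show "(u * \<theta> (a + b) + cnj (u * \<theta> (star (a + b)))) / 2
      = (u * \<theta> a + cnj (u * \<theta> (star a))) / 2 + (u * \<theta> b + cnj (u * \<theta> (star b))) / 2"
      using a b by (simp add: add\<theta> star_closed algebra_simps add_divide_distrib)
    have "cmod ((u * \<theta> (star b * a) + cnj (u * \<theta> (star (star b * a)))) / 2)
        \<le> (cmod (u * \<theta> (star b * a)) + cmod (cnj (u * \<theta> (star (star b * a))))) / 2"
      using norm_triangle_ineq[of "u * \<theta> (star b * a)"] by (simp add: norm_divide)
    also have "\<dots> \<le> sn a * sn b"
      using bound[OF a b] bound'[OF a b] by (simp only: norm_mult u complex_mod_cnj) simp
    finally show "cmod ((u * \<theta> (star b * a) + cnj (u * \<theta> (star (star b * a)))) / 2) \<le> sn a * sn b" .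
  qed
  \<comment> \<open>The choices u = 1 and u = \<i> give the hermitian parts of \<theta> and of \<i>
    \<theta>. If these are P and Q, then \<theta> = P - \<i> Q.\<close>
  obtain c1 where c1: "\<And>a. a \<in> A \<Longrightarrow> (\<theta> a + cnj (\<theta> (star a))) / 2 = c1 * g a"
    using ex[of 1] by auto
  obtain c2 where c2: "\<And>a. a \<in> A \<Longrightarrow> (\<i> * \<theta> a + cnj (\<i> * \<theta> (star a))) / 2 = c2 * g a"
    using ex[of \<i>] by (auto simp: norm_ii)
  have "\<theta> a = (c1 - \<i> * c2) * g a" if "a \<in> A" for a
  proof -
    have "\<theta> a = (\<theta> a + cnj (\<theta> (star a))) / 2 - \<i> * ((\<i> * \<theta> a + cnj (\<i> * \<theta> (star a))) / 2)"
      by (simp add: field_simps)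
    then show ?thesis unfolding c1[OF that] c2[OF that] by (simp add: algebra_simps)
  qed
  then show "\<exists>c. \<forall>a\<in>A. \<theta> a = c * g a" by blast
qed (fact g_unit)


section \<open>Transitivity\<close>

context irreducible_state
begin

text \<open>Hahn-Banach yields a positive \<open>F\<close> that dominates the real functional h k =
  Re (g (star z k y)) on positive elements and satisfies F e \<le> \<beta>. Orthogonality of the
  vector states of y + z and y - z then prevents \<beta> from being small.\<close>

lemma off_diagonal_norm_normalized:
  assumes y: "y \<in> A" and z: "z \<in> A" and ny: "sn y = 1" and nz: "sn z = 1"
    and real: "Im (g (star z * y)) = 0" "0 \<le> Re (g (star z * y))"
    and bound: "\<And>c. c \<in> A \<Longrightarrow> cmod (g (star z * c * y)) \<le> \<beta> * norm c"
  shows "1 / 2 \<le> \<beta>"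
proof -
  have "0 \<le> \<beta> * norm e" using bound[OF unit] norm_ge_zero order_trans by blast
  moreover have "0 < norm e" using sn_le_norm[OF unit] sn_unit by linarith
  ultimately have \<beta>: "0 \<le> \<beta>" by (simp add: zero_le_mult_iff)
  define h where "h k = Re (g (star z * k * y))" for k
  have h_add: "h (k + l) = h k + h l" if "k \<in> A" "l \<in> A" for k l
    using that y z by (simp add: h_def distrib_left distrib_right g_add closure_rules)
  have h_scale: "h (r *\<^sub>R k) = r * h k" if "k \<in> A" for r k
    using that y z by (simp add: h_def g_scaleR closure_rules)
  have h_0: "h 0 = 0" by (simp add: h_def)
  \<comment> \<open>A pair (t, k) in \<open>S c\<close> says that c + k \<le> t as quadratic forms.
    The functional \<open>q\<close> is built so that a linear F \<le> q satisfies F 1 \<le> \<beta>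
    (take c = 1), is positive (c = -a, k = 0) and dominates \<open>h\<close> (c = -k, t =
    0).\<close>
  define S where "S c = {(t, k). 0 \<le> t \<and> k \<in> A \<and> pos k \<and>
    (\<forall>f. inner f (c \<cdot> f) + inner f (k \<cdot> f) \<le> t * inner f f)}" for c
  define q where "q c = Inf ((\<lambda>(t, k). \<beta> * t - h k) ` S c)" for c
  have ne: "(norm c, 0) \<in> S c" for c
    using inner_act_le[of _ c] by (auto simp: S_def zero act_simps power2_norm_eq_inner abs_le_iff)
  have h_le: "h k \<le> \<beta> * s" if "k \<in> A" "pos k" "0 \<le> s" "\<And>f. inner f (k \<cdot> f) \<le> s * inner f f" for k s
  proof -
    have "norm k \<le> s"
      by (rule norm_le_of_form) (use that in \<open>auto simp: pos_def power2_norm_eq_inner\<close>)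
    then have "\<beta> * norm k \<le> \<beta> * s" using \<beta> by (rule mult_left_mono)
    then show ?thesis
      using bound[OF that(1)] complex_Re_le_cmod[of "g (star z * k * y)"] by (simp add: h_def)
  qed
  have lower: "- \<beta> * norm c \<le> \<beta> * t - h k" if "(t, k) \<in> S c" for c t k
  proof -
    have "inner f (k \<cdot> f) \<le> (t + norm c) * inner f f" for f
    proof -
      have "inner f (c \<cdot> f) + inner f (k \<cdot> f) \<le> t * inner f f" using that by (simp add: S_def)
      then show ?thesis
        using inner_act_le[of f c] by (simp add: power2_norm_eq_inner distrib_right abs_le_iff)
    qed
    then have "h k \<le> \<beta> * (t + norm c)" using that by (intro h_le) (auto simp: S_def)
    then show ?thesis by (simp add: algebra_simps)
  qed
  have bdd: "bdd_below ((\<lambda>(t, k). \<beta> * t - h k) ` S c)" for c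
    using lower by (intro bdd_belowI2[of _ "- \<beta> * norm c"]) auto
  have q_le: "q c \<le> \<beta> * t - h k" if "(t, k) \<in> S c" for c t k
    unfolding q_def by (rule cInf_lower[OF _ bdd]) (use that in force)
  have q_ge: "s \<le> q c" if "\<And>t k. (t, k) \<in> S c \<Longrightarrow> s \<le> \<beta> * t - h k" for s c
    unfolding q_def by (rule cInf_greatest) (use ne that in auto)
  have "sublinear q"
    unfolding sublinear_def
  proof (intro conjI allI impI)
    fix c d :: "'a bop"
    have "q (c + d) - (\<beta> * u - h l) \<le> \<beta> * t - h k" if "(t, k) \<in> S c" "(u, l) \<in> S d" for t k u l
    proof -
      have "(t + u, k + l) \<in> S (c + d)"
        using that by (auto simp: S_def add pos_add act_simps inner_add_right distrib_right)
          (smt (verit) inner_add_right)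
      from q_le[OF this] show ?thesis
        using that by (simp add: S_def h_add algebra_simps)
    qed
    then have *: "q (c + d) - (\<beta> * u - h l) \<le> q c" if "(u, l) \<in> S d" for u l
      using that by (intro q_ge)
    have "q (c + d) - q c \<le> \<beta> * u - h l" if "(u, l) \<in> S d" for u l
      using *[OF that] by linarith
    then have "q (c + d) - q c \<le> q d" by (rule q_ge)
    then show "q (c + d) \<le> q c + q d" by simp
  next
    fix r :: real and c :: "'a bop" assume "0 \<le> r"
    have pos: "q (r *\<^sub>R c) \<le> r * q c" if "0 < r" for r c
    proof -
      have "q (r *\<^sub>R c) / r \<le> \<beta> * t - h k" if tk: "(t, k) \<in> S c" for t k
      proof -
        have "(r * t, r *\<^sub>R k) \<in> S (r *\<^sub>R c)"
          using tk \<open>0 < r\<close> by (auto simp: S_def scaleR pos_scaleR act_simps mult.assoc simp flip: distrib_left)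
        from q_le[OF this] show ?thesis
          using tk \<open>0 < r\<close> by (simp add: S_def h_scale field_simps)
      qed
      then have "q (r *\<^sub>R c) / r \<le> q c" by (rule q_ge)
      then show ?thesis using that by (simp add: field_simps)
    qed
    show "q (r *\<^sub>R c) = r * q c"
    proof (cases "r = 0")
      case True
      have "q 0 \<le> 0" using q_le[OF ne[of 0]] by (simp add: h_0)
      moreover have "0 \<le> q 0" using lower[of _ _ 0] by (intro q_ge) simp
      ultimately show ?thesis by (simp add: True)
    next
      case False
      then have "0 < r" using \<open>0 \<le> r\<close> by simp
      have "q c \<le> (1/r) * q (r *\<^sub>R c)" using pos[of "1/r" "r *\<^sub>R c"] \<open>0 < r\<close> by simp
      then show ?thesis using pos[OF \<open>0 < r\<close>, of c] \<open>0 < r\<close> by (simp add: field_simps)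
    qed
  qed
  then obtain F where F_add: "\<And>a b. F (a + b) = F a + F b"
    and F_scale: "\<And>r a. F (r *\<^sub>R a) = r * F a" and Fq: "\<And>a. F a \<le> q a"
    by (rule Hahn_Banach_sublinear) blast
  have F_minus: "F (- a) = - F a" for a using F_scale[of "-1" a] by simp
  have F_le: "F a \<le> \<beta> * t - h k" if "(t, k) \<in> S a" for a t k
    using Fq[of a] q_le[OF that] by linarith
  have F_pos: "0 \<le> F a" if "pos a" for a
    using F_le[of 0 0 "- a"] that by (simp add: S_def zero h_0 F_minus act_simps pos_def)
  have F_h: "h k \<le> F k" if "k \<in> A" "pos k" for k
    using F_le[of 0 k "- k"] that by (simp add: S_def F_minus act_simps)
  \<comment> \<open>The quadratic form of \<open>b - star b\<close> vanishes, so (0, 0) lies in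
    \<open>S (b - star b)\<close> and \<open>F\<close> does not see skew parts.\<close>
  have F_star: "F (star a) = F a" for a
  proof -
    have form: "inner f (star b \<cdot> f) = inner f (b \<cdot> f)" for f b
      using act_star_inner[of b f f] by (simp add: inner_commute)
    have "F (b - star b) \<le> 0" for b
      using F_le[of 0 0 "b - star b"] by (simp add: S_def zero h_0 act_simps inner_diff_right form)
    from this[of a] this[of "star a"] show ?thesis
      using F_add[of a "- star a"] F_add[of "star a" "- a"] by (simp add: F_minus)
  qed
  have "F e \<le> \<beta>"
  proof -
    have "(1, 0) \<in> S 1" by (simp add: S_def zero act_simps)
    from F_le[OF this] have "F 1 \<le> \<beta>" by (simp add: h_0)
    moreover have "0 \<le> F (1 - e)" by (intro F_pos pos_1_diff pos_unit norm_unit)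
    ultimately show ?thesis using F_add[of e "1 - e"] by simp
  qed
  \<comment> \<open>Since \<open>y\<close> and \<open>z\<close> are unit vectors with real inner
    product, \<open>m\<close> and \<open>n\<close> are orthogonal. By polarisation the vector
    functionals of \<open>m\<close> and \<open>n\<close> differ by 4 h on positive elements, so that
    of \<open>n\<close> plus 4 F dominates both.\<close>
  define m n where "m = y + z" and "n = y - z"
  have m: "m \<in> A" and n: "n \<in> A" using y z by (simp_all add: m_def n_def add diff)
  define \<omega> where "\<omega> a = 4 * F a + Re (g (star n * a * n))" for a
  have rp: "real_positive A e \<omega>"
  proof unfold_locales
    fix a b r assume a: "a \<in> A"
    show "\<omega> (a + b) = \<omega> a + \<omega> b" if "b \<in> A"
      using a that n by (simp add: \<omega>_def F_add distrib_left distrib_right g_add closure_rules)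
    show "\<omega> (r *\<^sub>R a) = r * \<omega> a"
      using a n by (simp add: \<omega>_def F_scale g_scaleR closure_rules distrib_left)
    have "g (star n * star a * n) = cnj (g (star n * a * n))"
      using g_star[of "star n * a * n"] a n by (simp add: closure_rules mult.assoc)
    then show "\<omega> (star a) = \<omega> a" by (simp add: \<omega>_def F_star)
    show "0 \<le> \<omega> (star a * a)"
      using F_pos[OF pos_star_mult[of a]] g_pos_Re(1)[OF mult[OF a n]]
      by (simp add: \<omega>_def mult.assoc)
  qed
  have sn_le: "sn (a * p) \<le> semi_inner.sn (\<lambda>a b. \<omega> (star b * a)) a"
    if "a \<in> A" "Re (g (star p * (star a * a) * p)) \<le> \<omega> (star a * a)" for a p
  proof -
    interpret \<omega>: real_positive A e \<omega> by (rule rp)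
    show ?thesis using that(2) by (simp add: sn_def \<omega>.sn_def mult.assoc)
  qed
  have "(sn m)\<^sup>2 + (sn n)\<^sup>2 \<le> \<omega> e"
  proof (rule orthogonal_vector_states[OF rp m n])
    fix a assume a: "a \<in> A"
    define k where "k = star a * a"
    have k: "k \<in> A" "pos k" "star k = k" using a by (auto simp: k_def closure_rules pos_star_mult)
    show "sn (a * n) \<le> semi_inner.sn (\<lambda>a b. \<omega> (star b * a)) a"
      using F_pos[OF pos_star_mult[of a]] by (intro sn_le[OF a]) (simp add: \<omega>_def)
    have "g (star m * k * m) - g (star n * k * n) = 2 * g (star z * k * y) + 2 * g (star y * k * z)"
      using y z k(1) by (simp add: m_def n_def algebra_simps g_add g_diff closure_rules)
    moreover have "g (star y * k * z) = cnj (g (star z * k * y))"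
      using g_star[of "star z * k * y"] y z k by (simp add: closure_rules mult.assoc)
    ultimately have "Re (g (star m * k * m)) = 4 * h k + Re (g (star n * k * n))"
      by (simp add: complex_eq_iff h_def)
    then show "sn (a * m) \<le> semi_inner.sn (\<lambda>a b. \<omega> (star b * a)) a"
      using F_h[OF k(1,2)] by (intro sn_le[OF a]) (simp add: \<omega>_def k_def)
  next
    have sq: "g (star a * a) = 1" if "a \<in> A" "sn a = 1" for a
      using g_pos_Re(2)[OF that(1)] sn_square[OF that(1)] that(2) by (simp add: complex_eq_iff)
    have "g (star y * z) = cnj (g (star z * y))"
      using g_star[of "star z * y"] y z by (simp add: closure_rules)
    then show "g (star n * m) = 0"
      using y z real(1) sq[OF y ny] sq[OF z nz]
      by (simp add: m_def n_def algebra_simps g_add g_diff closure_rules complex_eq_iff)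
  qed
  moreover have "\<omega> e = 4 * F e + (sn n)\<^sup>2"
    using n by (simp add: \<omega>_def sn_square mult.assoc unit_left)
  ultimately have "(sn m)\<^sup>2 \<le> 4 * \<beta>" using \<open>F e \<le> \<beta>\<close> by linarith
  moreover have "(sn m)\<^sup>2 = (sn y)\<^sup>2 + (sn z)\<^sup>2 + 2 * Re (g (star z * y))"
    unfolding sn_square[OF m] sn_square[OF y] sn_square[OF z]
    using B_sym[OF y z] y z by (simp add: m_def distrib_left distrib_right g_add closure_rules)
  ultimately show ?thesis using ny nz real(2) by simp
qed

text \<open>Both vectors are normalised, and \<open>z\<close> is multiplied by a phase that makes
  its inner product with \<open>y\<close> nonnegative. The factor 2 is the reciprocal of the bound
  for unit vectors.\<close>

lemma off_diagonal_norm: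
  assumes y: "y \<in> A" and z: "z \<in> A"
    and bound: "\<And>c. c \<in> A \<Longrightarrow> cmod (g (star z * c * y)) \<le> \<beta> * norm c"
  shows "sn y * sn z \<le> 2 * \<beta>"
proof (cases "sn y = 0 \<or> sn z = 0")
  case True
  have "0 \<le> \<beta> * norm e" using bound[OF unit] norm_ge_zero order_trans by blast
  moreover have "0 < norm e" using sn_le_norm[OF unit] sn_unit by linarith
  ultimately have "0 \<le> \<beta>" by (simp add: zero_le_mult_iff)
  then show ?thesis using True by auto
next
  case False
  define p where "p = g (star z * y)"
  define u where "u = (if p = 0 then 1 else sgn p)"
  have u: "cmod u = 1" "cnj u * p = of_real (cmod p)"
    by (simp add: u_def norm_sgn)
      (auto simp: u_def sgn_eq complex_norm_square[symmetric] mult.commute[of "cnj p"] power2_eq_square)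
  define y' z' where "y' = inverse (sn y) *\<^sub>R y" and "z' = inverse (sn z) *\<^sub>R (cs u * z)"
  define s where "s = inverse (sn y) * inverse (sn z)"
  have s: "0 < s" "s * (sn y * sn z) = 1"
    using False sn_nonneg[OF y] sn_nonneg[OF z] by (auto simp: s_def field_simps)
  have zy: "g (star z' * c * y') = s * (cnj u * g (star z * c * y))" if "c \<in> A" for c
  proof -
    have "star z' * c * y' = s *\<^sub>R (cs (cnj u) * (star z * c * y))"
      by (simp add: y'_def z'_def s_def mult.assoc cs_commute[of "star z"])
    then show ?thesis using that y z by (simp add: g_scaleR g_cs closure_rules)
  qed
  have "1 / 2 \<le> s * \<beta>"
  proof (rule off_diagonal_norm_normalized)
    show "y' \<in> A" "z' \<in> A" using y z by (simp_all add: y'_def z'_def closure_rules)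
    show "sn y' = 1" "sn z' = 1"
      using y z False sn_nonneg[OF y] sn_nonneg[OF z]
      by (simp_all add: y'_def z'_def sn_scaleR sn_cs_mult closure_rules u)
    have "g (star z' * y') = of_real (s * cmod p)"
      using zy[OF unit] y z u(2) by (simp add: y'_def z'_def unit_right star_closed closure_rules p_def mult.assoc unit_left)
    then show "Im (g (star z' * y')) = 0" "0 \<le> Re (g (star z' * y'))"
      using s by auto
    show "cmod (g (star z' * c * y')) \<le> s * \<beta> * norm c" if "c \<in> A" for c
      unfolding zy[OF that] using bound[OF that] s u by (simp add: norm_mult mult_left_mono mult.assoc)
  qed
  then have "s * (sn y * sn z) \<le> s * (2 * \<beta>)" using s by simp
  then show ?thesis using s(1) by (simp only: mult_le_cancel_left)
qed

text \<open>Otherwise some \<open>z\<close> separates \<open>x\<close> from the vectors of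
  \<open>c * y\<close> with norm c \<le> 1. The functional c \<mapsto> g (star z c y) then has norm
  at most sn x sn z, and the off-diagonal bound contradicts 2 sn x < sn y.\<close>

lemma approximate_transitivity_unscaled:
  assumes x: "x \<in> A" and y: "y \<in> A" and lt: "2 * sn x < sn y" and "0 < d"
  obtains c where "c \<in> A" "norm c \<le> 1" "sn (x - c * y) < d"
proof (rule ccontr)
  assume none: "\<not> thesis"
  note found = that
  define D where "D = {c * y | c. c \<in> A \<and> norm c \<le> 1}"
  obtain z where z: "z \<in> A" "\<And>c. c \<in> D \<Longrightarrow> Re (g (star z * c)) < Re (g (star z * x))"
  proof (rule separation[of D x d "sn y"])
    show "D \<subseteq> A" using y by (auto simp: D_def mult)
    show "D \<noteq> {}" using zero by (auto simp: D_def intro!: exI[of _ 0])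
    show "d \<le> sn (x - c)" if "c \<in> D" for c
      using none found that by (force simp: D_def not_less intro: leI)
    show "sn c \<le> sn y" if cD: "c \<in> D" for c
    proof -
      obtain a where a: "c = a * y" "a \<in> A" "norm a \<le> 1" using cD by (auto simp: D_def)
      have "norm a * sn y \<le> 1 * sn y" using a sn_nonneg[OF y] by (intro mult_right_mono)
      then show ?thesis using sn_mult_le[OF a(2) y] a(1) by simp
    qed
    show "c + t *\<^sub>R (c' - c) \<in> D" if cD: "c \<in> D" and c'D: "c' \<in> D" and t: "0 \<le> t" "t \<le> 1" for c c' t
    proof -
      obtain a where a: "c = a * y" "a \<in> A" "norm a \<le> 1" using cD by (auto simp: D_def)
      obtain a' where a': "c' = a' * y" "a' \<in> A" "norm a' \<le> 1" using c'D by (auto simp: D_def)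
      have "norm (a + t *\<^sub>R (a' - a)) = norm ((1 - t) *\<^sub>R a + t *\<^sub>R a')" by (simp add: algebra_simps)
      also have "\<dots> \<le> (1 - t) * norm a + t * norm a'"
        using t by (intro order_trans[OF norm_triangle_ineq]) simp
      also have "\<dots> \<le> (1 - t) * 1 + t * 1"
        using a a' t by (intro add_mono mult_left_mono) auto
      finally have "norm (a + t *\<^sub>R (a' - a)) \<le> 1" by simp
      moreover have "c + t *\<^sub>R (c' - c) = (a + t *\<^sub>R (a' - a)) * y"
        by (simp add: a a' algebra_simps)
      moreover have "a + t *\<^sub>R (a' - a) \<in> A" using a a' by (simp add: closure_rules)
      ultimately show ?thesis unfolding D_def by blast
    qed
  qed (use x \<open>0 < d\<close> in auto)
  have xz: "Re (g (star z * x)) \<le> sn x * sn z"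
    using Cauchy_Schwarz[OF x z(1)] by simp
  have unit_bound: "cmod (g (star z * c * y)) \<le> sn x * sn z" if c: "c \<in> A" "norm c \<le> 1" for c
  proof -
    define p where "p = g (star z * c * y)"
    \<comment> \<open>\<open>D\<close> is invariant under phases, so the bound for real parts is one
      for moduli.\<close>
    define u where "u = (if p = 0 then 1 else cnj (sgn p))"
    have u: "cmod u = 1" "u * p = of_real (cmod p)"
      by (simp add: u_def norm_sgn)
        (auto simp: u_def sgn_eq complex_norm_square[symmetric] mult.commute[of "cnj p"] power2_eq_square)
    have "cs u * c * y \<in> D"
      unfolding D_def using c u norm_mult_ineq[of "cs u" c] by (auto intro!: exI[of _ "cs u * c"] simp: cs_mult_closed)
    from z(2)[OF this] have "Re (g (star z * (cs u * c * y))) < Re (g (star z * x))" .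
    moreover have "star z * (cs u * c * y) = cs u * (star z * c * y)"
      by (simp add: mult.assoc cs_left_commute[of "star z"])
    then have "g (star z * (cs u * c * y)) = u * p"
      using c z y by (simp add: g_cs closure_rules p_def)
    ultimately have "cmod p < Re (g (star z * x))"
      using u(2) by (metis Re_complex_of_real)
    then show ?thesis using xz by (simp add: p_def)
  qed
  have "sn y * sn z \<le> 2 * (sn x * sn z)"
  proof (rule off_diagonal_norm[OF y z(1)])
    fix c assume c: "c \<in> A"
    show "cmod (g (star z * c * y)) \<le> sn x * sn z * norm c"
    proof (cases "c = 0")
      case False
      define a where "a = inverse (norm c) *\<^sub>R c"
      have "cmod (g (star z * a * y)) \<le> sn x * sn z"
        by (rule unit_bound) (use c False in \<open>simp_all add: a_def scaleR\<close>)
      moreover have "g (star z * a * y) = inverse (norm c) * g (star z * c * y)"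
        using c y z by (simp add: a_def g_scaleR closure_rules)
      ultimately have "inverse (norm c) * cmod (g (star z * c * y)) \<le> sn x * sn z"
        by (simp add: norm_mult norm_inverse)
      then show ?thesis using False by (simp add: field_simps)
    qed simp
  qed
  moreover have "0 < sn z"
  proof (rule ccontr)
    assume "\<not> 0 < sn z"
    then have "sn z = 0" using sn_nonneg[OF z(1)] by simp
    have "0 * y \<in> D" unfolding D_def using zero by (intro CollectI exI[of _ 0]) auto
    from z(2)[OF this] show False using xz \<open>sn z = 0\<close> by simp
  qed
  ultimately have "sn y \<le> 2 * sn x" by (simp add: mult.assoc[symmetric] mult_le_cancel_right)
  then show False using lt by simp
qed

lemma approximate_transitivity:
  assumes x: "x \<in> A" and y: "y \<in> A" and "0 < sn y" and "0 < d"
  obtains c where "c \<in> A" "norm c \<le> 3 * sn x / sn y" "sn (x - c * y) < d"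
proof (cases "sn x = 0")
  case True
  show ?thesis
    by (rule that[of 0]) (use True zero \<open>0 < d\<close> in auto)
next
  case False
  then have sx: "0 < sn x" using sn_nonneg[OF x] by simp
  \<comment> \<open>The factor 3 leaves the strict inequality 2 sn (r x) < sn y.\<close>
  define r where "r = sn y / (3 * sn x)"
  have r: "0 < r" using sx \<open>0 < sn y\<close> by (simp add: r_def)
  have "2 * sn (r *\<^sub>R x) < sn y"
    using sx \<open>0 < sn y\<close> by (simp add: sn_scaleR[OF x] r_def)
  moreover have "0 < r * d" using r \<open>0 < d\<close> by simp
  ultimately obtain c where c: "c \<in> A" "norm c \<le> 1" "sn (r *\<^sub>R x - c * y) < r * d"
    using approximate_transitivity_unscaled[OF scaleR[OF x] y] by blast
  have eq: "r *\<^sub>R (x - (inverse r *\<^sub>R c) * y) = r *\<^sub>R x - c * y"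
    using r by (simp add: scaleR_diff_right)
  have cA: "inverse r *\<^sub>R c \<in> A" using c(1) by (rule scaleR)
  have "x - (inverse r *\<^sub>R c) * y \<in> A" by (intro diff mult x y cA)
  from sn_scaleR[OF this, of r] have "r * sn (x - (inverse r *\<^sub>R c) * y) < r * d"
    using c(3) r unfolding eq by simp
  then have "sn (x - (inverse r *\<^sub>R c) * y) < d" using r by simp
  moreover have "norm (inverse r *\<^sub>R c) \<le> 3 * sn x / sn y"
  proof -
    have "norm (inverse r *\<^sub>R c) = inverse r * norm c" using r by simp
    also have "\<dots> \<le> inverse r * 1" using c(2) r by (intro mult_left_mono) auto
    finally show ?thesis by (simp add: r_def)
  qed
  ultimately show ?thesis using that cA by blast
qed

text \<open>Each remainder is approximated again, with error at most half as large as the previous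
  bound. The corrections are bounded by (3 / sn y) (1/2)^n, so they converge in \<open>A\<close> and
  their sum has norm at most 6 / sn y.\<close>

theorem transitivity:
  assumes y: "y \<in> A" and "0 < sn y"
  obtains c where "c \<in> A" "norm c \<le> 6 / sn y" "sn (e - c * y) = 0"
proof -
  have "\<exists>c. c \<in> A \<and> norm c \<le> 3 * sn x / sn y \<and> sn (x - c * y) < (1/2) ^ Suc n" if "x \<in> A" for x n
    by (rule approximate_transitivity[OF that y \<open>0 < sn y\<close>, of "(1/2) ^ Suc n"]) auto
  then obtain \<phi> where \<phi>: "\<And>x n. x \<in> A \<Longrightarrow> \<phi> x n \<in> A \<and> norm (\<phi> x n) \<le> 3 * sn x / sn y
      \<and> sn (x - \<phi> x n * y) < (1/2) ^ Suc n"
    by metis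
  define X where "X = rec_nat e (\<lambda>n x. x - \<phi> x n * y)"
  have X0: "X 0 = e" and XS: "X (Suc n) = X n - \<phi> (X n) n * y" for n by (simp_all add: X_def)
  have XA: "X n \<in> A" for n by (induction n) (use y \<phi> in \<open>auto simp: X0 XS unit closure_rules\<close>)
  have Xsn: "sn (X n) \<le> (1/2) ^ n" for n
  proof (cases n)
    case (Suc m)
    then show ?thesis using \<phi>[OF XA[of m], of m] by (simp add: XS)
  qed (simp add: X0 sn_unit)
  define c where "c n = \<phi> (X n) n" for n
  have cA: "c n \<in> A" and cn: "norm (c n) \<le> (3 / sn y) * (1/2) ^ n" for n
  proof -
    show "c n \<in> A" using \<phi>[OF XA] by (simp add: c_def)
    have "norm (c n) \<le> 3 * sn (X n) / sn y" using \<phi>[OF XA] by (simp add: c_def)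
    also have "\<dots> \<le> 3 * (1/2) ^ n / sn y" using Xsn[of n] \<open>0 < sn y\<close> by (intro divide_right_mono) auto
    finally show "norm (c n) \<le> (3 / sn y) * (1/2) ^ n" by simp
  qed
  have geo: "(\<lambda>n. (3 / sn y) * (1/2) ^ n) sums ((3 / sn y) * 2)"
    using sums_mult[OF geometric_sums[of "1/2 :: real"], of "3 / sn y"] by simp
  have summ: "summable (\<lambda>n. norm (c n))"
    using cn by (intro summable_comparison_test'[OF sums_summable[OF geo], of 0]) auto
  define C where "C = (\<Sum>n. c n)"
  have lim: "(\<lambda>n. \<Sum>k<n. c k) \<longlonglongrightarrow> C"
    using summable_norm_cancel[OF summ] by (simp add: C_def summable_LIMSEQ)
  have CA: "C \<in> A" by (rule limit[OF _ lim]) (use cA in \<open>simp add: sum\<close>)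
  have "norm C \<le> (\<Sum>n. norm (c n))" unfolding C_def by (rule summable_norm[OF summ])
  also have "\<dots> \<le> (\<Sum>n. (3 / sn y) * (1/2) ^ n)"
    by (rule suminf_le[OF cn summ sums_summable[OF geo]])
  also have "\<dots> = 6 / sn y" using sums_unique[OF geo] by simp
  finally have norm_C: "norm C \<le> 6 / sn y" .
  have Xn: "X n = e - (\<Sum>k<n. c k) * y" for n
    by (induction n) (simp_all add: X0 XS c_def distrib_right)
  have "sn (e - C * y) \<le> norm (C - (\<Sum>k<n. c k)) * sn y + (1/2) ^ n" for n
  proof -
    define s where "s = (\<Sum>k<n. c k)"
    have s: "s \<in> A" using cA by (simp add: s_def sum)
    have "e - C * y = (s - C) * y + X n" by (simp add: Xn s_def algebra_simps)
    then have "sn (e - C * y) \<le> sn ((s - C) * y) + sn (X n)"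
      using sn_triangle[of "(s - C) * y" "X n"] s CA y XA by (simp add: closure_rules)
    also have "\<dots> \<le> norm (s - C) * sn y + (1/2) ^ n"
      using Xsn sn_mult_le[OF diff[OF s CA] y] by (intro add_mono)
    finally show ?thesis by (simp add: s_def norm_minus_commute)
  qed
  moreover have "(\<lambda>n. norm (C - (\<Sum>k<n. c k)) * sn y + (1/2) ^ n) \<longlonglongrightarrow> norm (C - C) * sn y + 0"
    by (intro tendsto_intros lim LIMSEQ_realpow_zero) auto
  ultimately have "sn (e - C * y) \<le> norm (C - C) * sn y + 0"
    by (meson LIMSEQ_le_const)
  then have "sn (e - C * y) = 0"
    using sn_nonneg[of "e - C * y"] CA y unit by (simp add: closure_rules)
  then show ?thesis using that CA norm_C by blast
qed

end


section \<open>The hereditary kernel\<close>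

context irreducible_state
begin

definition her :: "'a bop set" where
  "her = {a \<in> A. sn a = 0 \<and> sn (star a) = 0}"

lemma g_mult_her:
  assumes "u \<in> her" "x \<in> A" shows "g (x * u) = 0" "g (u * x) = 0"
proof -
  have u: "u \<in> A" "sn u = 0" "sn (star u) = 0" using assms by (auto simp: her_def)
  have "g (star (star x) * u) = 0" "g (star (star u) * x) = 0"
    using g_Cauchy_Schwarz[of u "star x"] g_Cauchy_Schwarz[of x "star u"] u assms by (auto simp: star_closed)
  then show "g (x * u) = 0" "g (u * x) = 0" by simp_all
qed

lemma sn_tendsto_0:
  assumes "X \<longlonglongrightarrow> a" "\<And>n. X n \<in> A" "\<And>n. sn (X n) = 0" shows "sn a = 0"
proof -
  have a: "a \<in> A" using limit assms by blast
  have "sn a \<le> norm (a - X n)" for n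
    using sn_triangle[of "a - X n" "X n"] sn_le_norm[of "a - X n"] a assms(2,3) by (simp add: diff)
  moreover have "(\<lambda>n. norm (a - X n)) \<longlonglongrightarrow> norm (a - a)" by (intro tendsto_intros assms)
  ultimately have "sn a \<le> norm (a - a)" by (meson LIMSEQ_le_const)
  then show ?thesis using sn_nonneg[OF a] by simp
qed

lemma star_subalgebra_her: "star_subalgebra her"
proof
  have sn_0: "sn 0 = 0" by (simp add: sn_def)
  show "closed her"
    unfolding closed_sequential_limits
  proof (intro allI impI, elim conjE)
    fix X a assume X: "\<forall>n. X n \<in> her" "X \<longlonglongrightarrow> a"
    have a: "a \<in> A" using limit X by (auto simp: her_def)
    moreover have "sn a = 0" using X by (intro sn_tendsto_0[OF X(2)]) (auto simp: her_def)
    moreover have "sn (star a) = 0"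
      using X by (intro sn_tendsto_0[OF tendsto_star[OF X(2)]]) (auto simp: her_def star_closed)
    ultimately show "a \<in> her" by (simp add: her_def)
  qed
  show "0 \<in> her" by (simp add: her_def zero sn_0)
next
  fix a b c assume a: "a \<in> her"
  then have aA: "a \<in> A" "star a \<in> A" "sn a = 0" "sn (star a) = 0" by (auto simp: her_def star_closed)
  have "star (cs c * a) = cs (cnj c) * star a" by (simp add: cs_commute)
  then show "cs c * a \<in> her" using aA by (auto simp: her_def cs_mult_closed sn_cs_mult)
  show "star a \<in> her" using aA by (simp add: her_def)
  assume b: "b \<in> her"
  then have bA: "b \<in> A" "star b \<in> A" "sn b = 0" "sn (star b) = 0" by (auto simp: her_def star_closed)
  show "a + b \<in> her"
    using sn_triangle[OF aA(1) bA(1)] sn_triangle[OF aA(2) bA(2)] sn_nonneg[of "a + b"] sn_nonneg[of "star a + star b"] aA bA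
    by (simp add: her_def add)
  show "a * b \<in> her"
    using sn_mult_le[OF aA(1) bA(1)] sn_mult_le[OF bA(2) aA(2)] sn_nonneg[of "a * b"] sn_nonneg[of "star b * star a"] aA bA
    by (simp add: her_def mult)
qed

text \<open>For a self-adjoint root r of d, g d = 0 says sn r = 0, and then sn d = sn (r r) \<le>
  norm r sn r.\<close>

lemma pos_her:
  assumes "d \<in> A" "pos d" "g d = 0" shows "d \<in> her"
proof -
  obtain r where r: "r \<in> A" "star r = r" "r * r = d" using sqrt_exists[OF assms(1,2)] .
  have "sn r = 0" using assms(3) r by (simp add: sn_def)
  then have "sn d = 0" using sn_mult_le[OF r(1) r(1)] r sn_nonneg[OF assms(1)] by simp
  then show ?thesis using assms by (simp add: her_def pos_star)
qed

lemma star_mult_her: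
  assumes "x \<in> A" "sn x = 0" shows "star x * x \<in> her"
proof (rule pos_her)
  show "g (star x * x) = 0"
    using assms g_pos_Re(2)[OF assms(1)] sn_square[OF assms(1)] by (simp add: complex_eq_iff)
qed (use assms in \<open>auto simp: closure_rules pos_star_mult\<close>)

end

text \<open>\<open>B\<close> need not contain 1, but 1 - (1 - h)^k is a polynomial in h without
  constant term.\<close>

lemma (in contraction_powers) one_diff_power_in:
  assumes "star_subalgebra B" "h \<in> B" shows "1 - w ^ n \<in> B"
proof -
  interpret star_subalgebra B by fact
  have "1 - (1 - h) ^ k \<in> B" for k
  proof (induction k)
    case (Suc k)
    have "1 - (1 - h) ^ Suc k = h + (1 - (1 - h) ^ k) - h * (1 - (1 - h) ^ k)"
      by (simp add: algebra_simps)
    also have "\<dots> \<in> B" by (rule diff[OF add[OF assms(2) Suc] mult[OF assms(2) Suc]])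
    finally show ?case .
  qed (simp add: zero)
  from this[of "2 * n"] show ?thesis by (simp add: w_power mult_2 power_add)
qed


section \<open>Operators of a discrete group\<close>

lift_definition ell2_restrict :: "'a set \<Rightarrow> 'a ell2 \<Rightarrow> 'a ell2" is "\<lambda>X f x. if x \<in> X then f x else 0"
proof -
  fix X and f :: "'a \<Rightarrow> complex" assume f: "(\<lambda>x. (cmod (f x))\<^sup>2) summable_on UNIV"
  have "(\<lambda>x. (cmod (f x))\<^sup>2) summable_on X" using f summable_on_subset_banach by blast
  then show "(\<lambda>x. (cmod (if x \<in> X then f x else 0))\<^sup>2) summable_on UNIV"
    by (rule summable_on_cong_neutral[THEN iffD1, rotated -1]) auto
qed

lemma norm_restrict_le: "norm (ell2_restrict X f) \<le> norm f"
proof (rule power2_le_imp_le)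
  show "(norm (ell2_restrict X f))\<^sup>2 \<le> (norm f)\<^sup>2"
    unfolding ell2_norm_square
    by (rule infsum_mono[OF ell2_coeff_summable ell2_coeff_summable]) (simp add: ell2_restrict.rep_eq)
qed simp

lift_definition ind_op :: "'a set \<Rightarrow> 'a op" is ell2_restrict
proof (rule bounded_linear_intro[of _ 1])
  fix X and f g :: "'a ell2" and r :: real
  show "ell2_restrict X (f + g) = ell2_restrict X f + ell2_restrict X g"
    by (rule ell2_eqI) (simp add: ell2_restrict.rep_eq plus_ell2.rep_eq)
  show "ell2_restrict X (r *\<^sub>R f) = r *\<^sub>R ell2_restrict X f"
    by (rule ell2_eqI) (simp add: ell2_restrict.rep_eq scaleR_ell2_def ell2_scaleC.rep_eq)
qed (simp add: norm_restrict_le)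

lift_definition ind :: "'a set \<Rightarrow> 'a bop" is ind_op
proof
  fix X show "adjoint_pair (ind_op X) (ind_op X)"
    unfolding adjoint_pair_def ind_op.rep_eq
    by (auto simp: ell2_cinner.rep_eq ell2_restrict.rep_eq intro!: infsum_cong)
qed

lemma coeff_ind: "ell2_coeff (ind X \<cdot> f) x = (if x \<in> X then ell2_coeff f x else 0)"
  by (simp add: act_def ind.rep_eq ind_op.rep_eq ell2_restrict.rep_eq)

lemma star_ind [simp]: "star (ind X) = ind X"
  by (rule star_eqI) (auto simp: ell2_cinner.rep_eq coeff_ind intro!: infsum_cong)

lemma norm_ind_le: "norm (ind X) \<le> 1"
  by (rule norm_bop_bound) (simp_all add: act_def ind.rep_eq ind_op.rep_eq norm_restrict_le)

lemma cinner_delta: "ell2_cinner (delta x) f = ell2_coeff f x"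
proof -
  have "ell2_cinner (delta x) f = (\<Sum>\<^sub>\<infinity>y\<in>{x}. ell2_coeff f y)"
    unfolding ell2_cinner.rep_eq by (rule infsum_cong_neutral) (auto simp: coeff_delta)
  then show ?thesis by simp
qed

lemma norm_delta [simp]: "norm (delta x) = 1"
  using power2_norm_eq_inner[of "delta x"]
  by (simp add: inner_ell2_def cinner_delta coeff_delta power2_eq_1_iff) (metis norm_ge_zero le_minus_one_simps(3))

lemma coeff_simps:
  "ell2_coeff (f + g) x = ell2_coeff f x + ell2_coeff g x"
  "ell2_coeff (f - g) x = ell2_coeff f x - ell2_coeff g x"
  "ell2_coeff (ell2_scaleC c f) x = c * ell2_coeff f x"
  "ell2_coeff (r *\<^sub>R f) x = of_real r * ell2_coeff f x"
  "ell2_coeff 0 x = 0"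
  by (simp_all add: plus_ell2.rep_eq minus_ell2.rep_eq ell2_scaleC.rep_eq scaleR_ell2_def zero_ell2.rep_eq)

lemma coeff_sum: "ell2_coeff (\<Sum>i\<in>I. f i) x = (\<Sum>i\<in>I. ell2_coeff (f i) x)"
  by (induction I rule: infinite_finite_induct) (simp_all add: coeff_simps)

lemma act_sum: "(\<Sum>i\<in>I. a i) \<cdot> f = (\<Sum>i\<in>I. a i \<cdot> f)" "b \<cdot> (\<Sum>i\<in>I. h i) = (\<Sum>i\<in>I. b \<cdot> h i)"
  by (induction I rule: infinite_finite_induct) (simp_all add: act_simps)

lemma star_sum: "star (\<Sum>i\<in>I. f i) = (\<Sum>i\<in>I. star (f i))"
  by (induction I rule: infinite_finite_induct) simp_all

lemma cinner_sum: "ell2_cinner (\<Sum>i\<in>I. f i) g = (\<Sum>i\<in>I. ell2_cinner (f i) g)"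
  "ell2_cinner h (\<Sum>i\<in>I. f i) = (\<Sum>i\<in>I. ell2_cinner h (f i))"
proof -
  have "ell2_cinner 0 f = 0" "ell2_cinner f 0 = 0" for f :: "'a ell2"
    by (simp_all add: ell2_cinner.rep_eq zero_ell2.rep_eq)
  then show "ell2_cinner (\<Sum>i\<in>I. f i) g = (\<Sum>i\<in>I. ell2_cinner (f i) g)"
    "ell2_cinner h (\<Sum>i\<in>I. f i) = (\<Sum>i\<in>I. ell2_cinner h (f i))"
    by (induction I rule: infinite_finite_induct) (simp_all add: cinner_add_left cinner_add_right)
qed

lemma coeff_tendsto:
  assumes "X \<longlonglongrightarrow> f" shows "(\<lambda>n. ell2_coeff (X n) x) \<longlonglongrightarrow> ell2_coeff f x"
  unfolding cinner_delta[symmetric] by (intro tendsto_cinner tendsto_const assms)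

lemma finite_support_dense:
  assumes "0 < r" obtains Q where "finite Q" "norm (f - ind Q \<cdot> f) < r"
proof -
  let ?h = "\<lambda>x. (cmod (ell2_coeff f x))\<^sup>2"
  have "(norm f)\<^sup>2 - r\<^sup>2 < infsum ?h UNIV" using assms by (simp add: ell2_norm_square)
  also have "infsum ?h UNIV = (SUP Q\<in>{Q. finite Q}. sum ?h Q)"
    using infsum_nonneg_is_SUPREMUM_real[OF ell2_coeff_summable[of f]] by simp
  finally have "(norm f)\<^sup>2 - r\<^sup>2 < (SUP Q\<in>{Q. finite Q}. sum ?h Q)" .
  moreover have "bdd_above (sum ?h ` {Q. finite Q})"
    by (rule bdd_aboveI2[of _ _ "(norm f)\<^sup>2"]) (simp add: sum_coeff_square_le)
  ultimately obtain Q where Q: "finite Q" "(norm f)\<^sup>2 - r\<^sup>2 < sum ?h Q"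
    by (subst (asm) less_cSUP_iff) auto
  define u where "u = ind Q \<cdot> f"
  have "(norm u)\<^sup>2 = sum ?h Q"
    unfolding ell2_norm_square u_def using Q(1)
    by (subst infsum_cong_neutral[where T = Q and g = ?h]) (auto simp: coeff_ind)
  moreover have "inner u f = inner u u"
  proof -
    have "ind Q \<cdot> u = u" by (rule ell2_eqI) (simp add: u_def coeff_ind)
    then show ?thesis using act_star_inner[of "ind Q" u f] by (simp add: u_def)
  qed
  then have "(norm (f - u))\<^sup>2 = (norm f)\<^sup>2 - (norm u)\<^sup>2"
    unfolding power2_norm_eq_inner by (simp add: inner_diff_left inner_diff_right inner_commute)
  ultimately have "(norm (f - u))\<^sup>2 < r\<^sup>2" using Q(2) by simp
  then have "norm (f - u) < r" using assms by (simp add: power_less_imp_less_base)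
  then show ?thesis using that Q(1) by (simp add: u_def)
qed

lemma ind_finite_eq:
  assumes "finite Q" shows "ind Q \<cdot> f = (\<Sum>x\<in>Q. ell2_scaleC (ell2_coeff f x) (delta x))"
  by (rule ell2_eqI) (simp add: coeff_ind coeff_sum coeff_simps coeff_delta assms sum.delta' if_distrib cong: if_cong)

lemma norm_sum_delta:
  assumes "finite I" "inj_on x I"
  shows "(norm (\<Sum>i\<in>I. ell2_scaleC (c i) (delta (x i))))\<^sup>2 = (\<Sum>i\<in>I. (cmod (c i))\<^sup>2)"
proof -
  have "complex_of_real ((norm (\<Sum>i\<in>I. ell2_scaleC (c i) (delta (x i))))\<^sup>2)
      = (\<Sum>i\<in>I. \<Sum>j\<in>I. if i = j then c j * cnj (c i) else 0)"
    unfolding cinner_self[symmetric] cinner_sum cinner_scaleC_left cinner_scaleC_right cinner_delta coeff_delta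
    by (subst sum.swap) (auto simp: sum_distrib_left inj_on_eq_iff[OF assms(2)] intro!: sum.cong)
  also have "\<dots> = of_real (\<Sum>i\<in>I. (cmod (c i))\<^sup>2)"
    using assms(1) by (simp add: of_real_cmod_square)
  finally show ?thesis by (simp only: of_real_eq_iff)
qed

section \<open>Left translations, the algebras they span, and the trace\<close>

context group
begin

definition lam :: "'a \<Rightarrow> 'a bop" where "lam s = Abs_bop (left_regular G s)"

lemma adjoint_pair_left_regular:
  assumes s: "s \<in> carrier G" shows "adjoint_pair (left_regular G (inv s)) (left_regular G s)"
  unfolding adjoint_pair_def
proof (intro allI)
  fix f g :: "'a ell2"
  have bij: "bij_betw (\<lambda>x. s \<otimes> x) (carrier G) (carrier G)"
    by (rule bij_betw_byWitness[of _ "\<lambda>x. inv s \<otimes> x"]) (auto simp: s m_assoc[symmetric])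
  have "ell2_cinner (left_regular G (inv s) f) g = (\<Sum>\<^sub>\<infinity>x\<in>carrier G. cnj (ell2_coeff f (s \<otimes> x)) * ell2_coeff g x)"
    unfolding ell2_cinner.rep_eq
    by (rule infsum_cong_neutral) (auto simp: left_regular_apply[OF is_group inv_closed[OF s]] s)
  also have "\<dots> = (\<Sum>\<^sub>\<infinity>x\<in>carrier G. cnj (ell2_coeff f (s \<otimes> x)) * ell2_coeff g (inv s \<otimes> (s \<otimes> x)))"
    by (rule infsum_cong) (simp add: s m_assoc[symmetric])
  also have "\<dots> = (\<Sum>\<^sub>\<infinity>y\<in>carrier G. cnj (ell2_coeff f y) * ell2_coeff g (inv s \<otimes> y))"
    by (rule infsum_reindex_bij_betw[OF bij])
  also have "\<dots> = ell2_cinner f (left_regular G s g)"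
    unfolding ell2_cinner.rep_eq
    by (rule infsum_cong_neutral) (auto simp: left_regular_apply[OF is_group s])
  finally show "ell2_cinner (left_regular G (inv s) f) g = ell2_cinner f (left_regular G s g)" .
qed

lemma op_of_lam: "s \<in> carrier G \<Longrightarrow> op_of (lam s) = left_regular G s"
  unfolding lam_def using adjoint_pair_left_regular by (intro Abs_bop_inverse) blast

lemma coeff_lam: "s \<in> carrier G \<Longrightarrow>
    ell2_coeff (lam s \<cdot> f) x = (if x \<in> carrier G then ell2_coeff f (inv s \<otimes> x) else 0)"
  by (simp add: act_def op_of_lam left_regular_apply is_group)

lemma lam_mult: "s \<in> carrier G \<Longrightarrow> t \<in> carrier G \<Longrightarrow> lam s * lam t = lam (s \<otimes> t)"
  by (rule bop_eqI, rule ell2_eqI) (simp add: act_simps coeff_lam m_assoc inv_mult_group)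

lemma star_lam: "s \<in> carrier G \<Longrightarrow> star (lam s) = lam (inv s)"
  using adjoint_pair_left_regular[of s] by (intro star_eqI) (simp add: act_def op_of_lam adjoint_pair_def)

lemma lam_one: "lam \<one> = ind (carrier G)"
  by (rule bop_eqI, rule ell2_eqI) (simp add: coeff_lam coeff_ind)

lemma norm_lam_le: assumes "s \<in> carrier G" shows "norm (lam s) \<le> 1"
proof -
  have "(norm (lam s))\<^sup>2 = norm (ind (carrier G))"
    using assms by (simp add: norm_star_mult[symmetric] star_lam lam_mult lam_one)
  then show ?thesis using norm_ind_le[of "carrier G"] by (metis abs_norm_cancel abs_square_le_1)
qed

lemma lam_delta: "s \<in> carrier G \<Longrightarrow> x \<in> carrier G \<Longrightarrow> lam s \<cdot> delta x = delta (s \<otimes> x)"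
  by (rule ell2_eqI) (auto simp: coeff_lam coeff_delta m_assoc[symmetric] inv_solve_left')

definition lin :: "'a set \<Rightarrow> ('a \<Rightarrow> complex) \<Rightarrow> 'a bop" where
  "lin F c = (\<Sum>s\<in>F. cs (c s) * lam s)"

text \<open>For a subgroup this is the group ring. It is also applied to the complement of a
  subgroup, where it is only a linear span.\<close>

definition poly_alg :: "'a set \<Rightarrow> 'a bop set" where
  "poly_alg K = {lin F c | F c. finite F \<and> F \<subseteq> K}"

definition cstar :: "'a set \<Rightarrow> 'a bop set" where "cstar K = closure (poly_alg K)"

lemma lin_extend:
  assumes "finite F'" "F \<subseteq> F'" shows "lin F c = lin F' (\<lambda>s. if s \<in> F then c s else 0)"
  unfolding lin_def by (rule sum.mono_neutral_cong_left) (use assms in \<open>auto simp: cs_0\<close>)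

lemma lin_add: "lin F c + lin F d = lin F (\<lambda>s. c s + d s)"
  by (simp add: lin_def cs_add distrib_right sum.distrib)

lemma cs_lin: "cs r * lin F c = lin F (\<lambda>s. r * c s)"
  by (simp add: lin_def cs_mult sum_distrib_left mult.assoc)

lemma lin_diff: "lin F c - lin F d = lin F (\<lambda>s. c s - d s)"
proof -
  have "- lin F d = cs (-1) * lin F d" by (simp add: cs_of_real[of "-1", simplified])
  then show ?thesis using lin_add[of F c "\<lambda>s. - d s"] cs_lin[of "-1" F d]
    by (simp add: diff_conv_add_uminus del: add_uminus_conv_diff)
qed

lemma poly_alg_add: "a \<in> poly_alg K \<Longrightarrow> b \<in> poly_alg K \<Longrightarrow> a + b \<in> poly_alg K"
proof -
  assume "a \<in> poly_alg K" "b \<in> poly_alg K"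
  then obtain F c F' c' where *: "a = lin F c" "finite F" "F \<subseteq> K" "b = lin F' c'" "finite F'" "F' \<subseteq> K"
    by (auto simp: poly_alg_def)
  have "a + b = lin (F \<union> F') (\<lambda>s. (if s \<in> F then c s else 0) + (if s \<in> F' then c' s else 0))"
    using * lin_extend[of "F \<union> F'" F c] lin_extend[of "F \<union> F'" F' c'] by (simp add: lin_add)
  moreover have "finite (F \<union> F')" "F \<union> F' \<subseteq> K" using * by auto
  ultimately show ?thesis unfolding poly_alg_def by blast
qed

lemma poly_alg_0: "0 \<in> poly_alg K"
  unfolding poly_alg_def by (rule CollectI, rule exI[of _ "{}"]) (simp add: lin_def)

lemma poly_alg_sum: "(\<And>i. i \<in> I \<Longrightarrow> f i \<in> poly_alg K) \<Longrightarrow> sum f I \<in> poly_alg K"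
  by (induction I rule: infinite_finite_induct) (auto simp: poly_alg_0 poly_alg_add)

lemma poly_alg_cs: "a \<in> poly_alg K \<Longrightarrow> cs r * a \<in> poly_alg K"
  unfolding poly_alg_def by (auto simp: cs_lin) blast

lemma poly_alg_lam: "s \<in> K \<Longrightarrow> lam s \<in> poly_alg K"
  unfolding poly_alg_def
  by (rule CollectI, rule exI[of _ "{s}"], rule exI[of _ "\<lambda>_. 1"]) (simp add: lin_def cs_1)

lemma poly_alg_mult:
  assumes K: "subgroup K G" and a: "a \<in> poly_alg K" and b: "b \<in> poly_alg K" shows "a * b \<in> poly_alg K"
proof -
  obtain F c where F: "a = lin F c" "F \<subseteq> K" using a by (auto simp: poly_alg_def)
  obtain F' c' where F': "b = lin F' c'" "F' \<subseteq> K" using b by (auto simp: poly_alg_def)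
  have FK: "\<And>s. s \<in> F \<Longrightarrow> s \<in> carrier G" "\<And>s. s \<in> F' \<Longrightarrow> s \<in> carrier G"
    using F F' subgroup.mem_carrier[OF K] by auto
  have "a * b = (\<Sum>s\<in>F. cs (c s) * (\<Sum>t\<in>F'. cs (c' t) * lam (s \<otimes> t)))"
  proof -
    have "lam s * lin F' c' = (\<Sum>t\<in>F'. cs (c' t) * lam (s \<otimes> t))" if "s \<in> F" for s
      unfolding lin_def sum_distrib_left
      by (rule sum.cong) (use that FK in \<open>auto simp: cs_left_commute[of "lam s"] lam_mult\<close>)
    then show ?thesis
      unfolding F(1) by (simp add: lin_def[of F] sum_distrib_right mult.assoc F'(1))
  qed
  also have "\<dots> \<in> poly_alg K"
    using F F' subgroup.m_closed[OF K] by (intro poly_alg_sum poly_alg_cs poly_alg_lam) auto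
  finally show ?thesis .
qed

lemma poly_alg_star_symmetric:
  assumes K: "K \<subseteq> carrier G" "\<And>s. s \<in> K \<Longrightarrow> inv s \<in> K" and a: "a \<in> poly_alg K" shows "star a \<in> poly_alg K"
proof -
  obtain F c where F: "a = lin F c" "finite F" "F \<subseteq> K" using a by (auto simp: poly_alg_def)
  have "star a = (\<Sum>s\<in>F. cs (cnj (c s)) * lam (inv s))"
    unfolding F(1) lin_def star_sum
    by (rule sum.cong) (use F K in \<open>auto simp: star_lam cs_commute\<close>)
  also have "\<dots> \<in> poly_alg K"
    using F K by (intro poly_alg_sum poly_alg_cs poly_alg_lam) auto
  finally show ?thesis .
qed

lemma poly_alg_star:
  assumes K: "subgroup K G" and a: "a \<in> poly_alg K" shows "star a \<in> poly_alg K"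
  by (rule poly_alg_star_symmetric[OF subgroup.subset[OF K] subgroup.m_inv_closed[OF K] a])

lemma cstar_limit_poly: "a \<in> cstar K \<longleftrightarrow> (\<exists>q. (\<forall>n. q n \<in> poly_alg K) \<and> q \<longlonglongrightarrow> a)"
  by (simp add: cstar_def closure_sequential)

lemma poly_alg_subset: "poly_alg K \<subseteq> cstar K"
  unfolding cstar_def by (rule closure_subset)

lemma lam_in_cstar: "s \<in> K \<Longrightarrow> lam s \<in> cstar K"
  using poly_alg_lam poly_alg_subset by blast

lemma cstar_mono: "K \<subseteq> K' \<Longrightarrow> cstar K \<subseteq> cstar K'"
  unfolding cstar_def by (rule closure_mono) (auto simp: poly_alg_def)

lemma lin_unit:
  assumes "F \<subseteq> carrier G" shows "lam \<one> * lin F c = lin F c" "lin F c * lam \<one> = lin F c"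
  unfolding lin_def sum_distrib_left sum_distrib_right
  by (rule sum.cong; use assms in \<open>auto simp: cs_left_commute[of "lam \<one>"] mult.assoc lam_mult\<close>)+

lemma unital_cstar:
  assumes K: "subgroup K G" shows "unital_star_subalgebra (cstar K) (lam \<one>)"
proof
  show "closed (cstar K)" by (simp add: cstar_def)
  show "0 \<in> cstar K" using poly_alg_0 poly_alg_subset by blast
  show "lam \<one> \<in> cstar K" by (rule lam_in_cstar) (rule subgroup.one_closed[OF K])
  fix a b r assume "a \<in> cstar K"
  then obtain p where p: "\<And>n. p n \<in> poly_alg K" "p \<longlonglongrightarrow> a" by (auto simp: cstar_limit_poly)
  show "cs r * a \<in> cstar K"
    using p poly_alg_cs unfolding cstar_limit_poly
    by (intro exI[of _ "\<lambda>n. cs r * p n"]) (auto intro: tendsto_intros)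
  show "star a \<in> cstar K"
    using p poly_alg_star[OF K] unfolding cstar_limit_poly
    by (intro exI[of _ "\<lambda>n. star (p n)"]) (auto intro: tendsto_star)
  have pu: "lam \<one> * p n = p n" "p n * lam \<one> = p n" for n
    using p(1)[of n] lin_unit subgroup.subset[OF K] by (auto simp: poly_alg_def)
  have "(\<lambda>n. lam \<one> * p n) \<longlonglongrightarrow> lam \<one> * a" "(\<lambda>n. p n * lam \<one>) \<longlonglongrightarrow> a * lam \<one>"
    by (intro tendsto_intros p)+
  then show "lam \<one> * a = a" "a * lam \<one> = a"
    unfolding pu using p(2) LIMSEQ_unique by blast+
  assume "b \<in> cstar K"
  then obtain q where q: "\<And>n. q n \<in> poly_alg K" "q \<longlonglongrightarrow> b" by (auto simp: cstar_limit_poly)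
  show "a + b \<in> cstar K"
    using p q poly_alg_add unfolding cstar_limit_poly
    by (intro exI[of _ "\<lambda>n. p n + q n"]) (auto intro: tendsto_intros)
  show "a * b \<in> cstar K"
    using p q poly_alg_mult[OF K] unfolding cstar_limit_poly
    by (intro exI[of _ "\<lambda>n. p n * q n"]) (auto intro: tendsto_intros)
qed

text \<open>The elements of the group C*-algebra commute with right translations, so their matrices are
  determined by the column of the unit.\<close>

lemma coeff_act_delta:
  assumes "a \<in> cstar (carrier G)" "x \<in> carrier G" "y \<in> carrier G"
  shows "ell2_coeff (a \<cdot> delta y) x = ell2_coeff (a \<cdot> delta \<one>) (x \<otimes> inv y)"
proof -
  obtain p where p: "\<And>n. p n \<in> poly_alg (carrier G)" "p \<longlonglongrightarrow> a" using assms(1) by (auto simp: cstar_limit_poly)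
  have eq: "ell2_coeff (p n \<cdot> delta y) x = ell2_coeff (p n \<cdot> delta \<one>) (x \<otimes> inv y)" for n
  proof -
    obtain F c where F: "p n = lin F c" "F \<subseteq> carrier G" using p(1)[of n] by (auto simp: poly_alg_def)
    have "ell2_coeff (lam s \<cdot> delta y) x = ell2_coeff (lam s \<cdot> delta \<one>) (x \<otimes> inv y)" if "s \<in> carrier G" for s
    proof -
      have "x = s \<otimes> y \<longleftrightarrow> x \<otimes> inv y = s"
        using assms(2,3) that by (metis inv_solve_right' )
      then show ?thesis using assms that by (simp add: lam_delta coeff_delta)
    qed
    then show ?thesis
      using F by (simp add: lin_def act_sum coeff_sum act_simps coeff_simps subsetD)
  qed
  have "(\<lambda>n. ell2_coeff (p n \<cdot> delta y) x) \<longlonglongrightarrow> ell2_coeff (a \<cdot> delta y) x"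
    by (intro coeff_tendsto tendsto_act p tendsto_const)
  moreover have "(\<lambda>n. ell2_coeff (p n \<cdot> delta y) x) \<longlonglongrightarrow> ell2_coeff (a \<cdot> delta \<one>) (x \<otimes> inv y)"
    unfolding eq by (intro coeff_tendsto tendsto_act p tendsto_const)
  ultimately show ?thesis by (rule LIMSEQ_unique)
qed

lemma coeff_act_one_outside:
  assumes "a \<in> cstar K" "K \<subseteq> carrier G" "z \<notin> K" shows "ell2_coeff (a \<cdot> delta \<one>) z = 0"
proof -
  obtain p where p: "\<And>n. p n \<in> poly_alg K" "p \<longlonglongrightarrow> a" using assms(1) by (auto simp: cstar_limit_poly)
  have "ell2_coeff (p n \<cdot> delta \<one>) z = 0" for n
  proof -
    obtain F c where F: "p n = lin F c" "F \<subseteq> K" using p(1)[of n] by (auto simp: poly_alg_def)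
    have "ell2_coeff (lam s \<cdot> delta \<one>) z = 0" if "s \<in> F" for s
      using that F assms by (auto simp: lam_delta coeff_delta subset_iff)
    then show ?thesis using F by (simp add: lin_def act_sum coeff_sum act_simps coeff_simps)
  qed
  moreover have "(\<lambda>n. ell2_coeff (p n \<cdot> delta \<one>) z) \<longlonglongrightarrow> ell2_coeff (a \<cdot> delta \<one>) z"
    by (intro coeff_tendsto tendsto_act p tendsto_const)
  ultimately show ?thesis by (simp add: LIMSEQ_const_iff)
qed

definition trace :: "'a bop \<Rightarrow> complex" where "trace a = ell2_coeff (a \<cdot> delta \<one>) \<one>"

text \<open>A product s t of group elements is the unit exactly if t s is; linearity and continuity
  do the rest.\<close>

lemma trace_commute:
  assumes "a \<in> cstar (carrier G)" "b \<in> cstar (carrier G)" shows "trace (a * b) = trace (b * a)"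
proof -
  have poly: "trace (a * b) = trace (b * a)" if ab: "a \<in> poly_alg (carrier G)" "b \<in> poly_alg (carrier G)" for a b
  proof -
    obtain F c where F: "a = lin F c" "F \<subseteq> carrier G" using ab by (auto simp: poly_alg_def)
    obtain F' d where F': "b = lin F' d" "F' \<subseteq> carrier G" using ab by (auto simp: poly_alg_def)
    have FG: "\<And>s. s \<in> F \<Longrightarrow> s \<in> carrier G" "\<And>s. s \<in> F' \<Longrightarrow> s \<in> carrier G"
      using F F' by auto
    have "a * b = (\<Sum>s\<in>F. \<Sum>t\<in>F'. cs (c s * d t) * lam (s \<otimes> t))"
      unfolding F F' lin_def sum_product
      by (intro sum.cong refl) (simp add: FG cs_mult mult.assoc cs_left_commute[of "lam _"] lam_mult)
    moreover have "b * a = (\<Sum>t\<in>F'. \<Sum>s\<in>F. cs (d t * c s) * lam (t \<otimes> s))"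
      unfolding F F' lin_def sum_product
      by (intro sum.cong refl) (simp add: FG cs_mult mult.assoc cs_left_commute[of "lam _"] lam_mult)
    moreover have "trace (cs (c s * d t) * lam (s \<otimes> t)) = trace (cs (d t * c s) * lam (t \<otimes> s))" if "s \<in> F" "t \<in> F'" for s t
    proof -
      have "s \<in> carrier G" "t \<in> carrier G" using that F F' by auto
      then have "\<one> = s \<otimes> t \<longleftrightarrow> \<one> = t \<otimes> s" by (metis inv_comm)
      then show ?thesis using \<open>s \<in> carrier G\<close> \<open>t \<in> carrier G\<close>
        by (simp add: trace_def act_simps coeff_simps lam_delta coeff_delta)
    qed
    ultimately show ?thesis
      using sum.swap[of "\<lambda>s t. trace (cs (c s * d t) * lam (s \<otimes> t))" F' F]
      by (simp add: trace_def act_sum coeff_sum)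
  qed
  obtain p where p: "\<And>n. p n \<in> poly_alg (carrier G)" "p \<longlonglongrightarrow> a" using assms(1) by (auto simp: cstar_limit_poly)
  obtain q where q: "\<And>n. q n \<in> poly_alg (carrier G)" "q \<longlonglongrightarrow> b" using assms(2) by (auto simp: cstar_limit_poly)
  have "(\<lambda>n. trace (p n * q n)) \<longlonglongrightarrow> trace (a * b)" "(\<lambda>n. trace (q n * p n)) \<longlonglongrightarrow> trace (b * a)"
    unfolding trace_def by (intro coeff_tendsto tendsto_act tendsto_mult p q tendsto_const)+
  then show ?thesis unfolding poly[OF p(1) q(1)] by (rule LIMSEQ_unique)
qed


section \<open>Compressions to transversals\<close>

text \<open>The Gram matrix of the vectors \<open>a \<cdot> delta x\<close> has the coefficients of
  \<open>star a * a\<close> at x inv y as entries, and these vanish off \<open>K\<close>. On a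
  transversal the vectors are therefore orthogonal, all of norm r. As \<open>a\<close> is
  self-adjoint, they produce the coefficients of \<open>a \<cdot> f\<close>, and Bessel's inequality
  bounds an operator norm by a 2-norm.\<close>

lemma norm_ind_mult_le:
  assumes K: "subgroup K G" and a: "a \<in> cstar K" "star a = a" and X: "X \<subseteq> carrier G"
    and transversal: "\<And>x y. x \<in> X \<Longrightarrow> y \<in> X \<Longrightarrow> x \<otimes> inv y \<in> K \<Longrightarrow> x = y"
  shows "norm (ind X * a) \<le> norm (a \<cdot> delta \<one>)"
proof (rule norm_bop_bound)
  interpret K: unital_star_subalgebra "cstar K" "lam \<one>" by (rule unital_cstar[OF K])
  define r where "r = norm (a \<cdot> delta \<one>)"
  have KG: "K \<subseteq> carrier G" by (rule subgroup.subset[OF K])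
  have aa: "star a * a \<in> cstar K" using a by (intro K.closure_rules)
  have gram: "ell2_cinner (a \<cdot> delta x) (a \<cdot> delta y) = (if x = y then of_real (r\<^sup>2) else 0)"
    if "x \<in> X" "y \<in> X" for x y
  proof -
    have xy: "x \<in> carrier G" "y \<in> carrier G" using that X by auto
    have "ell2_cinner (a \<cdot> delta x) (a \<cdot> delta y) = ell2_coeff ((star a * a) \<cdot> delta y) x"
      by (metis act_simps(4) act_star_cinner cinner_delta star_star)
    also have "\<dots> = ell2_coeff ((star a * a) \<cdot> delta \<one>) (x \<otimes> inv y)"
      using aa cstar_mono[OF KG] xy by (intro coeff_act_delta) auto
    finally have eq: "ell2_cinner (a \<cdot> delta x) (a \<cdot> delta y) = ell2_coeff ((star a * a) \<cdot> delta \<one>) (x \<otimes> inv y)" .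
    show ?thesis
    proof (cases "x = y")
      case True
      have "ell2_coeff ((star a * a) \<cdot> delta \<one>) \<one> = ell2_cinner (a \<cdot> delta \<one>) (a \<cdot> delta \<one>)"
        by (metis act_simps(4) act_star_cinner cinner_delta star_star)
      then show ?thesis using eq xy True by (simp add: cinner_self r_def)
    next
      case False
      then have "x \<otimes> inv y \<notin> K" using transversal that by blast
      then show ?thesis using eq False coeff_act_one_outside[OF aa KG] by simp
    qed
  qed
  fix f
  have bessel: "(\<Sum>x\<in>F. (cmod (ell2_coeff (a \<cdot> f) x))\<^sup>2) \<le> (r * norm f)\<^sup>2" if "finite F" "F \<subseteq> X" for F
  proof -
    define c where "c x = ell2_coeff (a \<cdot> f) x" for x
    define Q where "Q = (\<Sum>x\<in>F. (cmod (c x))\<^sup>2)"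
    define u where "u = (\<Sum>x\<in>F. ell2_scaleC (c x) (delta x))"
    have Q0: "0 \<le> Q" by (simp add: Q_def sum_nonneg)
    have au: "a \<cdot> u = (\<Sum>x\<in>F. ell2_scaleC (c x) (a \<cdot> delta x))"
      by (simp add: u_def act_sum act_scaleC)
    have "complex_of_real ((norm (a \<cdot> u))\<^sup>2) = (\<Sum>x\<in>F. \<Sum>y\<in>F. cnj (c x) * (c y * (if x = y then of_real (r\<^sup>2) else 0)))"
      unfolding cinner_self[symmetric] au cinner_sum cinner_scaleC_left cinner_scaleC_right
      by (subst sum.swap)
        (intro sum.cong refl, use gram that(2) in \<open>auto simp: subset_iff sum_distrib_left mult.left_commute\<close>)
    also have "\<dots> = of_real (r\<^sup>2 * Q)"
      using that(1) by (simp add: if_distrib sum.delta Q_def sum_distrib_left mult_ac of_real_cmod_square cong: if_cong)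
    finally have n: "(norm (a \<cdot> u))\<^sup>2 = r\<^sup>2 * Q" by (simp only: of_real_eq_iff)
    have "ell2_cinner (a \<cdot> u) f = ell2_cinner u (a \<cdot> f)" using act_star_cinner[of a u f] a(2) by simp
    also have "\<dots> = (\<Sum>x\<in>F. cnj (c x) * c x)"
      by (simp add: u_def cinner_sum cinner_scaleC_left cinner_delta c_def)
    also have "\<dots> = of_real Q" by (simp add: Q_def mult.commute of_real_cmod_square)
    finally have "Q \<le> norm (a \<cdot> u) * norm f"
      using cinner_Cauchy_Schwarz[of "a \<cdot> u" f] Q0 by simp
    then have "Q\<^sup>2 \<le> (norm (a \<cdot> u) * norm f)\<^sup>2" using Q0 by (intro power_mono)
    also have "\<dots> = Q * (r * norm f)\<^sup>2" by (simp add: power_mult_distrib n mult_ac)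
    finally have "Q * Q \<le> Q * (r * norm f)\<^sup>2" by (simp add: power2_eq_square)
    then have "Q \<le> (r * norm f)\<^sup>2" using Q0 by (cases "Q = 0") (auto simp: mult_le_cancel_left)
    then show ?thesis by (simp add: Q_def c_def)
  qed
  have "(norm ((ind X * a) \<cdot> f))\<^sup>2 \<le> (r * norm f)\<^sup>2"
    unfolding ell2_norm_square
  proof (rule infsum_le_finite_sums[OF ell2_coeff_summable])
    fix F :: "'a set" assume "finite F"
    then have "(\<Sum>x\<in>F. (cmod (ell2_coeff ((ind X * a) \<cdot> f) x))\<^sup>2) = (\<Sum>x\<in>F \<inter> X. (cmod (ell2_coeff (a \<cdot> f) x))\<^sup>2)"
      by (intro sum.mono_neutral_cong_right) (auto simp: act_simps coeff_ind)
    then show "(\<Sum>x\<in>F. (cmod (ell2_coeff ((ind X * a) \<cdot> f) x))\<^sup>2) \<le> (r * norm f)\<^sup>2"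
      using bessel[of "F \<inter> X"] \<open>finite F\<close> by simp
  qed
  then show "norm ((ind X * a) \<cdot> f) \<le> norm (a \<cdot> delta \<one>) * norm f"
    using power2_le_imp_le by (fastforce simp: r_def)
qed simp

text \<open>With \<open>D\<close> the complement of \<open>U\<close> and X = s D, a s a = (a 1_X) (s
  a) + (a s) (1_U a), because s 1_D = 1_X s. Each summand contains a compression of \<open>a\<close>
  to a transversal.\<close>

lemma norm_sandwich_le:
  assumes K: "subgroup K G" and a: "a \<in> cstar K" "star a = a" and s: "s \<in> carrier G"
    and U: "U \<subseteq> carrier G" "\<And>x y. x \<in> U \<Longrightarrow> y \<in> U \<Longrightarrow> x \<otimes> inv y \<in> K \<Longrightarrow> x = y"
    and D: "\<And>x y. x \<in> carrier G - U \<Longrightarrow> y \<in> carrier G - U \<Longrightarrow> (s \<otimes> x) \<otimes> inv (s \<otimes> y) \<in> K \<Longrightarrow> x = y"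
  shows "norm (a * lam s * a) \<le> 2 * norm a * norm (a \<cdot> delta \<one>)"
proof -
  define r where "r = norm (a \<cdot> delta \<one>)"
  define D where "D = carrier G - U"
  define X where "X = (\<lambda>x. s \<otimes> x) ` D"
  have nU: "norm (ind U * a) \<le> r"
    unfolding r_def by (rule norm_ind_mult_le[OF K a]) (use U in auto)
  have "norm (ind X * a) \<le> r"
    unfolding r_def by (rule norm_ind_mult_le[OF K a]) (use s assms(7) in \<open>auto simp: X_def D_def\<close>)
  then have nX: "norm (a * ind X) \<le> r"
    using norm_star[of "ind X * a"] a(2) by simp
  have "lam \<one> * a = a"
    using unital_star_subalgebra.unit_left[OF unital_cstar[OF K] a(1)] .
  moreover have "lam \<one> = ind D + ind U"
    unfolding lam_one by (rule bop_eqI, rule ell2_eqI) (use U(1) in \<open>auto simp: act_simps coeff_simps coeff_ind D_def\<close>)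
  ultimately have a_eq: "a = ind D * a + ind U * a" by (simp add: distrib_right)
  have "lam s * ind D = ind X * lam s"
  proof (rule bop_eqI, rule ell2_eqI)
    fix f x
    have "inv s \<otimes> x \<in> D \<longleftrightarrow> x \<in> X" if "x \<in> carrier G"
    proof
      assume "inv s \<otimes> x \<in> D"
      moreover have "x = s \<otimes> (inv s \<otimes> x)" using that s by (simp add: m_assoc[symmetric])
      ultimately show "x \<in> X" unfolding X_def by blast
    next
      assume "x \<in> X"
      then show "inv s \<otimes> x \<in> D" using s by (auto simp: X_def D_def m_assoc[symmetric])
    qed
    moreover have "x \<in> carrier G" if "x \<in> X" using that s by (auto simp: X_def D_def)
    ultimately show "ell2_coeff ((lam s * ind D) \<cdot> f) x = ell2_coeff ((ind X * lam s) \<cdot> f) x"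
      using s by (auto simp: act_simps coeff_lam coeff_ind)
  qed
  then have eq: "a * lam s * a = (a * ind X) * (lam s * a) + (a * lam s) * (ind U * a)"
    by (subst a_eq) (simp add: distrib_left mult.assoc[symmetric], simp add: mult.assoc)
  have la: "norm (lam s * a) \<le> norm a" "norm (a * lam s) \<le> norm a"
    using norm_mult_ineq[of "lam s" a] norm_mult_ineq[of a "lam s"] norm_lam_le[OF s]
      mult_right_mono[of "norm (lam s)" 1 "norm a"] mult_left_mono[of "norm (lam s)" 1 "norm a"] by auto
  have "norm ((a * ind X) * (lam s * a)) \<le> r * norm a"
    by (rule order_trans[OF norm_mult_ineq]) (use nX la in \<open>auto intro!: mult_mono simp: r_def\<close>)
  moreover have "norm ((a * lam s) * (ind U * a)) \<le> norm a * r"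
    by (rule order_trans[OF norm_mult_ineq]) (use nU la in \<open>auto intro!: mult_mono\<close>)
  ultimately show ?thesis
    unfolding eq r_def[symmetric] using norm_triangle_ineq[of "(a * ind X) * (lam s * a)" "(a * lam s) * (ind U * a)"]
    by (simp add: mult.commute)
qed


section \<open>The conditional expectation onto a subgroup algebra\<close>

lemma coeff_lin_one:
  assumes "finite F" "F \<subseteq> carrier G" shows "ell2_coeff (lin F c \<cdot> delta \<one>) z = (if z \<in> F then c z else 0)"
proof -
  have "ell2_coeff (lin F c \<cdot> delta \<one>) z = (\<Sum>s\<in>F. c s * (if z = s then 1 else 0))"
    unfolding lin_def act_sum coeff_sum
    by (rule sum.cong) (use assms in \<open>auto simp: act_simps coeff_simps lam_delta coeff_delta\<close>)
  then show ?thesis using assms(1) by (simp add: if_distrib cong: if_cong)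
qed

lemma lin_in_cstar: "finite F \<Longrightarrow> F \<subseteq> K \<Longrightarrow> lin F c \<in> cstar K"
  using poly_alg_subset unfolding poly_alg_def by blast

text \<open>In matrix terms, passing to the subgroup \<open>K\<close> deletes the entries outside the diagonal blocks
  indexed by the right cosets of \<open>K\<close>.\<close>

lemma lin_Int_form_le_finite:
  fixes \<phi> :: "'a \<Rightarrow> complex"
  assumes K: "subgroup K G" and F: "finite F" "F \<subseteq> carrier G" and Q: "finite Q" "Q \<subseteq> carrier G"
    and le: "\<And>f. inner f (lin F c \<cdot> f) \<le> t * inner f f"
  defines "v \<equiv> \<lambda>P. \<Sum>x\<in>P. ell2_scaleC (\<phi> x) (delta x)"
  shows "inner (v Q) (lin (F \<inter> K) c \<cdot> v Q) \<le> t * inner (v Q) (v Q)"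
proof -
  define \<kappa> where "\<kappa> x = K #> x" for x
  define P where "P r = {x \<in> Q. \<kappa> x = r}" for r
  have \<kappa>: "\<kappa> x = \<kappa> y \<longleftrightarrow> x \<otimes> inv y \<in> K" if "x \<in> carrier G" "y \<in> carrier G" for x y
  proof
    assume "\<kappa> x = \<kappa> y"
    then have "x \<in> K #> y" using rcos_self[OF that(1) K] by (simp add: \<kappa>_def)
    then obtain k where "k \<in> K" "x = k \<otimes> y" by (auto simp: r_coset_def)
    then show "x \<otimes> inv y \<in> K" using that subgroup.mem_carrier[OF K] by (simp add: m_assoc)
  next
    assume k: "x \<otimes> inv y \<in> K"
    have "x = (x \<otimes> inv y) \<otimes> y" using that by (simp add: m_assoc)
    then have "x \<in> K #> y" using k by (auto simp: r_coset_def)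
    then show "\<kappa> x = \<kappa> y" using repr_independence[OF _ that(2) K] by (simp add: \<kappa>_def)
  qed
  have form: "ell2_cinner (v P) (lin F' c \<cdot> v P)
      = (\<Sum>x\<in>P. \<Sum>y\<in>P. cnj (\<phi> x) * (\<phi> y * (if x \<otimes> inv y \<in> F' then c (x \<otimes> inv y) else 0)))"
    if "P \<subseteq> Q" "F' \<subseteq> F" for P F'
  proof -
    have F': "finite F'" "F' \<subseteq> carrier G" using that F finite_subset by auto
    have "ell2_coeff (lin F' c \<cdot> delta y) x = (if x \<otimes> inv y \<in> F' then c (x \<otimes> inv y) else 0)"
      if "x \<in> P" "y \<in> P" for x y
      using coeff_act_delta[OF lin_in_cstar[OF F'], of x y] that \<open>P \<subseteq> Q\<close> Q(2)
      by (auto simp: coeff_lin_one[OF F'] subset_iff)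
    then show ?thesis
      unfolding v_def act_sum cinner_sum act_scaleC cinner_scaleC_left cinner_scaleC_right cinner_delta
      by (subst sum.swap) (simp add: sum_distrib_left mult.left_commute)
  qed
  have blocks: "(\<Sum>x\<in>Q. \<Sum>y\<in>Q. if \<kappa> x = \<kappa> y then h x y else 0) = (\<Sum>r\<in>\<kappa> ` Q. \<Sum>x\<in>P r. \<Sum>y\<in>P r. h x y)"
    for h :: "'a \<Rightarrow> 'a \<Rightarrow> complex"
  proof -
    have "(\<Sum>x\<in>Q. \<Sum>y\<in>Q. if \<kappa> x = \<kappa> y then h x y else 0)
        = (\<Sum>r\<in>\<kappa> ` Q. \<Sum>x\<in>P r. \<Sum>y\<in>Q. if \<kappa> x = \<kappa> y then h x y else 0)"
      unfolding P_def by (rule sum.image_gen[OF Q(1)])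
    also have "\<dots> = (\<Sum>r\<in>\<kappa> ` Q. \<Sum>x\<in>P r. \<Sum>y\<in>P r. h x y)"
    proof (rule sum.cong[OF refl], rule sum.cong[OF refl])
      fix r x assume x: "x \<in> P r"
      show "(\<Sum>y\<in>Q. if \<kappa> x = \<kappa> y then h x y else 0) = (\<Sum>y\<in>P r. h x y)"
        by (rule sum.mono_neutral_cong_right) (use x Q(1) in \<open>auto simp: P_def\<close>)
    qed
    finally show ?thesis .
  qed
  have "ell2_cinner (v Q) (lin (F \<inter> K) c \<cdot> v Q) = (\<Sum>x\<in>Q. \<Sum>y\<in>Q. if \<kappa> x = \<kappa> y
      then cnj (\<phi> x) * (\<phi> y * (if x \<otimes> inv y \<in> F then c (x \<otimes> inv y) else 0)) else 0)"
    unfolding form[OF order_refl Int_lower1]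
    by (intro sum.cong refl) (use Q(2) in \<open>auto simp: \<kappa> subset_iff\<close>)
  also have "\<dots> = (\<Sum>r\<in>\<kappa> ` Q. ell2_cinner (v (P r)) (lin F c \<cdot> v (P r)))"
    unfolding blocks by (intro sum.cong refl, subst form) (auto simp: P_def)
  finally have "inner (v Q) (lin (F \<inter> K) c \<cdot> v Q) = (\<Sum>r\<in>\<kappa> ` Q. inner (v (P r)) (lin F c \<cdot> v (P r)))"
    by (simp add: inner_ell2_def)
  also have "\<dots> \<le> (\<Sum>r\<in>\<kappa> ` Q. t * inner (v (P r)) (v (P r)))"
    by (intro sum_mono le)
  also have "\<dots> = t * inner (v Q) (v Q)"
  proof -
    have sq: "inner (v P) (v P) = (\<Sum>x\<in>P. (cmod (\<phi> x))\<^sup>2)" if "P \<subseteq> Q" for P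
    proof -
      have "finite P" using that Q(1) finite_subset by blast
      then have "ell2_cinner (v P) (v P) = (\<Sum>x\<in>P. cnj (\<phi> x) * \<phi> x)"
        unfolding v_def cinner_sum cinner_scaleC_left cinner_scaleC_right cinner_delta coeff_delta
        by (simp add: if_distrib sum.delta mult.commute cong: if_cong)
      also have "\<dots> = of_real (\<Sum>x\<in>P. (cmod (\<phi> x))\<^sup>2)"
        by (simp add: of_real_cmod_square mult.commute)
      finally show ?thesis unfolding inner_ell2_def by (simp only: Re_complex_of_real)
    qed
    have "inner (v Q) (v Q) = (\<Sum>r\<in>\<kappa> ` Q. inner (v (P r)) (v (P r)))"
      unfolding sq[OF order_refl] sum.image_gen[OF Q(1), of _ \<kappa>] P_def[symmetric]
      by (intro sum.cong refl, subst sq) (auto simp: P_def)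
    then show ?thesis by (simp add: sum_distrib_left)
  qed
  finally show ?thesis .
qed

text \<open>Finitely supported vectors are dense. Replacing \<open>f\<close> by its projection
  \<open>f'\<close> onto the functions on the carrier preserves the left-hand side and does not
  increase the norm, so the right-hand side can only shrink as t \<ge> 0.\<close>

lemma lin_Int_form_le:
  assumes K: "subgroup K G" and F: "finite F" "F \<subseteq> carrier G" and "0 \<le> t"
    and le: "\<And>f. inner f (lin F c \<cdot> f) \<le> t * inner f f"
  shows "inner f (lin (F \<inter> K) c \<cdot> f) \<le> t * inner f f"
proof -
  define E where "E = lin (F \<inter> K) c"
  define f' where "f' = lam \<one> \<cdot> f"
  have E: "lam \<one> * E = E" "E * lam \<one> = E"
    unfolding E_def by (rule lin_unit; use F in auto)+
  have "\<exists>Q. finite Q \<and> norm (f' - ind Q \<cdot> f') < inverse (real (Suc n))" for n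
    using finite_support_dense[of "inverse (real (Suc n))" f'] by auto
  then obtain Q where Q: "\<And>n. finite (Q n)" "\<And>n. norm (f' - ind (Q n) \<cdot> f') < inverse (real (Suc n))" by metis
  have lim: "(\<lambda>n. ind (Q n) \<cdot> f') \<longlonglongrightarrow> f'"
  proof (rule metric_LIMSEQ_I)
    fix r :: real assume "0 < r"
    then obtain M where M: "inverse (real (Suc M)) < r" using reals_Archimedean by blast
    have "dist (ind (Q n) \<cdot> f') f' < r" if "n \<ge> M" for n
    proof -
      have "inverse (real (Suc n)) \<le> inverse (real (Suc M))" using that by (intro le_imp_inverse_le) auto
      then have "norm (f' - ind (Q n) \<cdot> f') < r" using Q(2)[of n] M by linarith
      then show ?thesis by (simp add: dist_norm norm_minus_commute)
    qed
    then show "\<exists>M. \<forall>n\<ge>M. dist (ind (Q n) \<cdot> f') f' < r" by blast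
  qed
  have "inner (ind (Q n) \<cdot> f') (E \<cdot> ind (Q n) \<cdot> f') \<le> t * inner (ind (Q n) \<cdot> f') (ind (Q n) \<cdot> f')" for n
  proof -
    have "ind (Q n) \<cdot> f' = ind (Q n \<inter> carrier G) \<cdot> f'"
      by (rule ell2_eqI) (auto simp: coeff_ind f'_def lam_one)
    also have "\<dots> = (\<Sum>x\<in>Q n \<inter> carrier G. ell2_scaleC (ell2_coeff f' x) (delta x))"
      using Q(1) by (intro ind_finite_eq) auto
    finally show ?thesis
      unfolding E_def using lin_Int_form_le_finite[OF K F _ _ le, where \<phi> = "ell2_coeff f'" and Q = "Q n \<inter> carrier G"] Q(1) by simp
  qed
  moreover have "(\<lambda>n. inner (ind (Q n) \<cdot> f') (E \<cdot> ind (Q n) \<cdot> f')) \<longlonglongrightarrow> inner f' (E \<cdot> f')"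
    "(\<lambda>n. t * inner (ind (Q n) \<cdot> f') (ind (Q n) \<cdot> f')) \<longlonglongrightarrow> t * inner f' f'"
    by (intro tendsto_intros tendsto_act lim)+
  ultimately have "inner f' (E \<cdot> f') \<le> t * inner f' f'"
    by (intro LIMSEQ_le) auto
  moreover have "inner f' (E \<cdot> f') = inner f (E \<cdot> f)"
  proof -
    have "inner (star (lam \<one>) \<cdot> f) (E \<cdot> f') = inner f ((lam \<one> * E * lam \<one>) \<cdot> f)"
      unfolding act_star_inner by (simp add: act_simps f'_def)
    then show ?thesis by (simp add: E star_lam f'_def)
  qed
  moreover have "t * inner f' f' \<le> t * inner f f"
  proof -
    have "norm f' \<le> norm f"
      using norm_act_le[of "lam \<one>" f] mult_right_mono[OF norm_lam_le[OF one_closed] norm_ge_zero[of f]] by (simp add: f'_def)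
    then have "(norm f')\<^sup>2 \<le> (norm f)\<^sup>2" by (intro power_mono) auto
    then show ?thesis using \<open>0 \<le> t\<close> by (simp add: power2_norm_eq_inner mult_left_mono)
  qed
  ultimately show ?thesis by (simp add: E_def)
qed

lemma lin_split: "finite F \<Longrightarrow> lin F c = lin (F \<inter> K) c + lin (F - K) c"
  unfolding lin_def by (subst sum.union_disjoint[symmetric]) (auto intro!: sum.cong)

text \<open>The expectation is taken only along a given sequence of polynomials, not as a map. The
  form bound for -T n with t = 0 gives positivity. Applied to differences in both orders it gives
  contractivity, hence convergence.\<close>

lemma conditional_expectation:
  assumes K: "subgroup K G" and T: "\<And>n. T n \<in> poly_alg (carrier G)" "\<And>n. pos (T n)" "T \<longlonglongrightarrow> B"
  obtains E d where "\<And>n. E n \<in> cstar K" "pos d" "E \<longlonglongrightarrow> d" "\<And>n. T n - E n \<in> poly_alg (carrier G - K)"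
proof -
  interpret K: unital_star_subalgebra "cstar K" "lam \<one>" by (rule unital_cstar[OF K])
  have "\<exists>F c. finite F \<and> F \<subseteq> carrier G \<and> T n = lin F c" for n
    using T(1)[of n] by (auto simp: poly_alg_def)
  then obtain F c where F: "\<And>n. finite (F n)" "\<And>n. F n \<subseteq> carrier G" and Tn: "\<And>n. T n = lin (F n) (c n)"
    by metis
  define E0 where "E0 n = lin (F n \<inter> K) (c n)" for n
  \<comment> \<open>Averaging with the adjoint makes self-adjointness immediate and leaves the
    quadratic form unchanged.\<close>
  define E where "E n = (1/2) *\<^sub>R (E0 n + star (E0 n))" for n
  have form: "inner f (E n \<cdot> f) = inner f (E0 n \<cdot> f)" for n f
    by (simp add: E_def act_simps inner_add_right inner_act_star)
  have starE: "star (E n) = E n" for n by (simp add: E_def add.commute)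
  have EK: "E n \<in> cstar K" for n
    unfolding E_def E0_def using F by (intro K.closure_rules lin_in_cstar) auto
  have posE: "pos (E n)" for n
    unfolding pos_def
  proof (intro conjI allI starE)
    fix f
    have neg: "lin X (\<lambda>s. - c n s) = - lin X (c n)" for X
      using lin_diff[of X "\<lambda>_. 0" "c n"] by (simp add: lin_def cs_0)
    have "inner f (lin (F n \<inter> K) (\<lambda>s. - c n s) \<cdot> f) \<le> 0 * inner f f"
      by (rule lin_Int_form_le[OF K F]) (use T(2)[of n] in \<open>auto simp: neg Tn pos_def act_simps\<close>)
    then show "0 \<le> inner f (E n \<cdot> f)" by (simp add: neg form E0_def act_simps)
  qed
  have diff: "norm (E m - E n) \<le> norm (T m - T n)" for m n
  proof (rule norm_le_of_form)
    have le: "inner f ((E0 m - E0 n) \<cdot> f) \<le> norm (T m - T n) * inner f f" for m n f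
    proof -
      define F' where "F' = F m \<union> F n"
      define c' where "c' s = (if s \<in> F m then c m s else 0) - (if s \<in> F n then c n s else 0)" for s
      have F': "finite F'" "F' \<subseteq> carrier G" using F by (auto simp: F'_def)
      have Td: "T m - T n = lin F' c'"
        unfolding Tn c'_def lin_diff[symmetric]
        using lin_extend[OF F'(1), of "F m" "c m"] lin_extend[OF F'(1), of "F n" "c n"] by (simp add: F'_def)
      have ext: "lin (F k \<inter> K) (c k) = lin (F' \<inter> K) (\<lambda>s. if s \<in> F k then c k s else 0)" if "F k \<subseteq> F'" for k
        unfolding lin_def by (rule sum.mono_neutral_cong_left) (use that F' in \<open>auto simp: cs_0\<close>)
      have "E0 m - E0 n = lin (F' \<inter> K) c'"
        unfolding E0_def c'_def lin_diff[symmetric] by (simp add: ext F'_def)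
      then show ?thesis
        using lin_Int_form_le[OF K F', of "norm (T m - T n)" c' f] inner_act_le[of _ "T m - T n"]
        by (simp add: Td power2_norm_eq_inner abs_le_iff)
    qed
    fix f
    have eq: "inner f ((E m - E n) \<cdot> f) = inner f ((E0 m - E0 n) \<cdot> f)"
      by (simp add: act_simps inner_diff_right form)
    have "inner f ((E0 n - E0 m) \<cdot> f) = - inner f ((E0 m - E0 n) \<cdot> f)"
      by (simp add: act_simps inner_diff_right)
    then show "\<bar>inner f ((E m - E n) \<cdot> f)\<bar> \<le> norm (T m - T n) * (norm f)\<^sup>2"
      using le[of f m n] le[of f n m] unfolding eq power2_norm_eq_inner
      by (simp add: norm_minus_commute[of "T n"] abs_le_iff)
  qed (simp_all add: starE)
  have "Cauchy E"
  proof (rule metric_CauchyI)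
    fix r :: real assume "0 < r"
    from metric_CauchyD[OF LIMSEQ_imp_Cauchy[OF T(3)] this]
    obtain M where M: "\<forall>m\<ge>M. \<forall>n\<ge>M. dist (T m) (T n) < r" by blast
    have "dist (E m) (E n) < r" if "m \<ge> M" "n \<ge> M" for m n
      using diff[of m n] M[rule_format, OF that] by (simp add: dist_norm)
    then show "\<exists>M. \<forall>m\<ge>M. \<forall>n\<ge>M. dist (E m) (E n) < r" by blast
  qed
  then obtain d where d: "E \<longlonglongrightarrow> d" by (auto simp: Cauchy_convergent_iff convergent_def)
  have "T n - E n \<in> poly_alg (carrier G - K)" for n
  proof -
    define V where "V = lin (F n - K) (c n)"
    have V: "V \<in> poly_alg (carrier G - K)"
      unfolding V_def poly_alg_def using F by blast
    have "star V \<in> poly_alg (carrier G - K)"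
    proof (rule poly_alg_star_symmetric[OF _ _ V])
      fix s assume s: "s \<in> carrier G - K"
      then have "inv s \<notin> K" using subgroup.m_inv_closed[OF K, of "inv s"] by auto
      then show "inv s \<in> carrier G - K" using s by simp
    qed auto
    then have "(1/2) *\<^sub>R (V + star V) \<in> poly_alg (carrier G - K)"
      using V poly_alg_cs[OF poly_alg_add, of V "carrier G - K" "star V" "of_real (1/2)"]
      unfolding cs_of_real by simp
    moreover have "T n - E n = (1/2) *\<^sub>R (V + star V)"
    proof -
      have split: "T n = E0 n + V" unfolding Tn E0_def V_def by (rule lin_split[OF F(1)])
      have "T n = (1/2) *\<^sub>R (T n + star (T n))"
        using pos_star[OF T(2)[of n]] by (simp flip: scaleR_2)
      also have "\<dots> = E n + (1/2) *\<^sub>R (V + star V)"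
        unfolding split E_def by (simp add: algebra_simps)
      finally show ?thesis by simp
    qed
    ultimately show ?thesis by simp
  qed
  then show ?thesis using that EK d pos_limit[OF d posE] by blast
qed

end


section \<open>Free groups\<close>

lemma free_group_mult: "u \<otimes>\<^bsub>free_group R\<^esub> v = foldr letter_mult u v"
  by (simp add: free_group_def)

lemma free_group_carrier: "w \<in> carrier (free_group R) \<longleftrightarrow> set w \<subseteq> R \<times> UNIV \<and> reduced_word w"
  by (simp add: free_group_def)

lemma free_group_one: "\<one>\<^bsub>free_group R\<^esub> = []"
  by (simp add: free_group_def)

lemma free_group_inv: "u \<in> carrier (free_group R) \<Longrightarrow> inv\<^bsub>free_group R\<^esub> u = rev (map inv_letter u)"
  by (rule group.inv_equality[OF group_free_group])
    (auto simp: free_group_mult free_group_one foldr_left_inverse free_group_carrier reduced_inverse inv_letter_def)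

lemma reduced_append:
  "reduced_word (u @ w) \<longleftrightarrow> reduced_word u \<and> reduced_word w \<and> (u = [] \<or> w = [] \<or> hd w \<noteq> inv_letter (last u))"
  by (auto simp: reduced_word_def successively_append_iff)

lemma foldr_letter_mult_reduced: "reduced_word (u @ w) \<Longrightarrow> foldr letter_mult u w = u @ w"
proof (induction u)
  case (Cons x u)
  then have "foldr letter_mult u w = u @ w" "u @ w = [] \<or> hd (u @ w) \<noteq> inv_letter x"
    by (auto simp: reduced_word_Cons)
  then show ?case by (cases "u @ w") auto
qed simp

lemma subgroup_free_group:
  assumes "S \<subseteq> R" shows "subgroup (carrier (free_group S)) (free_group R)"
proof (rule group.subgroupI[OF group_free_group])
  show sub: "carrier (free_group S) \<subseteq> carrier (free_group R)" using assms by (fastforce simp: free_group_carrier)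
  show "carrier (free_group S) \<noteq> {}" by (auto simp: free_group_def intro!: exI[of _ "[]"])
  fix u assume u: "u \<in> carrier (free_group S)"
  then show "inv\<^bsub>free_group R\<^esub> u \<in> carrier (free_group S)"
    using sub by (auto simp: free_group_inv free_group_carrier reduced_inverse inv_letter_def subset_iff)
  fix v assume v: "v \<in> carrier (free_group S)"
  then show "u \<otimes>\<^bsub>free_group R\<^esub> v \<in> carrier (free_group S)"
    using u set_foldr[of u v] by (auto simp: free_group_mult free_group_carrier reduced_foldr)
qed

text \<open>A nonempty h over \<open>S\<close> cannot cancel against w, which starts outside
  \<open>S\<close>. Then h w is reduced and starts inside \<open>S\<close>, contrary to the
  assumption on v.\<close>

lemma same_coset_eq:
  assumes h: "h \<in> carrier (free_group S)" and "reduced_word w" "v = foldr letter_mult h w"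
    and "v \<noteq> []" "w \<noteq> []" "fst (hd v) \<notin> S" "fst (hd w) \<notin> S"
  shows "v = w"
proof (cases "h = []")
  case False
  have hS: "fst x \<in> S" if "x \<in> set h" for x using h that by (auto simp: free_group_carrier)
  have "hd w \<noteq> inv_letter (last h)"
    using hS[of "last h"] False assms by (auto simp: inv_letter_def)
  then have "v = h @ w"
    using assms h by (simp add: foldr_letter_mult_reduced reduced_append free_group_carrier)
  then show ?thesis using hS[of "hd h"] False assms by simp
qed (use assms in simp)

text \<open>Write \<open>s = s' l k\<close> with \<open>l\<close> the last letter outside \<open>S\<close>.  The set \<open>U\<close> consists of the
  group elements \<open>x\<close> for which \<open>l\<close> cancels in \<open>s x\<close>.\<close>

lemma free_group_transversals:
  assumes S: "S \<subseteq> R" and s: "s \<in> carrier (free_group R)" "s \<notin> carrier (free_group S)"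
  defines "G \<equiv> free_group R" and "K \<equiv> carrier (free_group S)"
  obtains U where "U \<subseteq> carrier G"
    "\<And>x y. x \<in> U \<Longrightarrow> y \<in> U \<Longrightarrow> x \<otimes>\<^bsub>G\<^esub> inv\<^bsub>G\<^esub> y \<in> K \<Longrightarrow> x = y"
    "\<And>x y. x \<in> carrier G - U \<Longrightarrow> y \<in> carrier G - U \<Longrightarrow>
      (s \<otimes>\<^bsub>G\<^esub> x) \<otimes>\<^bsub>G\<^esub> inv\<^bsub>G\<^esub> (s \<otimes>\<^bsub>G\<^esub> y) \<in> K \<Longrightarrow> x = y"
proof -
  interpret group G unfolding G_def by (rule group_free_group)
  have K: "subgroup K G" unfolding K_def G_def by (rule subgroup_free_group[OF S])
  note KG = subgroup.mem_carrier[OF K]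
  have sG: "s \<in> carrier G" using s by (simp add: G_def)
  have ex: "\<exists>x\<in>set s. fst x \<notin> S"
    using s by (force simp: free_group_carrier)
  obtain s' l k where s_eq: "s = s' @ l # k" and l: "fst l \<notin> S" and k: "\<forall>x\<in>set k. fst x \<in> S"
    using split_list_last_prop[OF ex] by auto
  \<comment> \<open>Here \<open>l'\<close> is the first letter outside \<open>S\<close>, possibly
    \<open>l\<close> itself. If \<open>l\<close> survives in s x, the reduced word of s x starts
    with p l', and removing \<open>p \<in> K\<close> exposes a letter outside
    \<open>S\<close>.\<close>
  obtain p l' q where sp: "s' @ [l] = p @ l' # q" and l': "fst l' \<notin> S" and p: "\<forall>x\<in>set p. fst x \<in> S"
    using split_list_first_prop[of "s' @ [l]" "\<lambda>x. fst x \<notin> S"] l by auto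
  have sred: "reduced_word ((s' @ [l]) @ k)" "set ((s' @ [l]) @ k) \<subseteq> R \<times> UNIV"
    using s(1) by (simp_all add: s_eq free_group_carrier)
  have "reduced_word k" using sred(1) unfolding reduced_append by blast
  then have kK: "k \<in> K" using sred(2) k by (auto simp: K_def free_group_carrier)
  have "reduced_word p" using sred(1) unfolding sp reduced_append by blast
  then have pK: "p \<in> K" using sred(2) p unfolding sp by (auto simp: K_def free_group_carrier)
  have coset: "v = w" if "v \<in> carrier G" "w \<in> carrier G" "h \<in> K" "v = h \<otimes>\<^bsub>G\<^esub> w"
    "v \<noteq> []" "w \<noteq> []" "fst (hd v) \<notin> S" "fst (hd w) \<notin> S" for h v w
    by (rule same_coset_eq[of h S w v]) (use that in \<open>auto simp: K_def G_def free_group_mult free_group_carrier\<close>)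
  \<comment> \<open>Common core of both claims: once an element of \<open>K\<close> moves
    \<open>x\<close> and \<open>y\<close> to words starting outside \<open>S\<close>, a common coset
    forces equality. It is used with \<open>k\<close> for \<open>U\<close> and with the inverse of
    \<open>p\<close> for the complement.\<close>
  have transversal: "x = y" if x: "x \<in> carrier G" and y: "y \<in> carrier G" and k: "k \<in> K" and xy: "x \<otimes>\<^bsub>G\<^esub> inv\<^bsub>G\<^esub> y \<in> K"
    and hd: "k \<otimes>\<^bsub>G\<^esub> x \<noteq> []" "k \<otimes>\<^bsub>G\<^esub> y \<noteq> []" "fst (hd (k \<otimes>\<^bsub>G\<^esub> x)) \<notin> S" "fst (hd (k \<otimes>\<^bsub>G\<^esub> y)) \<notin> S" for x y k
  proof -
    define h where "h = k \<otimes>\<^bsub>G\<^esub> (x \<otimes>\<^bsub>G\<^esub> inv\<^bsub>G\<^esub> y) \<otimes>\<^bsub>G\<^esub> inv\<^bsub>G\<^esub> k"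
    have hK: "h \<in> K" unfolding h_def
      by (intro subgroup.m_closed[OF K] subgroup.m_inv_closed[OF K] k xy)
    have kx: "k \<otimes>\<^bsub>G\<^esub> x = h \<otimes>\<^bsub>G\<^esub> (k \<otimes>\<^bsub>G\<^esub> y)"
    proof -
      have "inv\<^bsub>G\<^esub> k \<otimes>\<^bsub>G\<^esub> (k \<otimes>\<^bsub>G\<^esub> y) = y" "x \<otimes>\<^bsub>G\<^esub> (inv\<^bsub>G\<^esub> y \<otimes>\<^bsub>G\<^esub> y) = x"
        using KG[OF k] x y by (simp_all add: m_assoc[symmetric])
      then show ?thesis using KG[OF k] x y by (simp add: h_def m_assoc)
    qed
    have "k \<otimes>\<^bsub>G\<^esub> x = k \<otimes>\<^bsub>G\<^esub> y"
      by (rule coset[OF _ _ hK kx hd]) (use KG[OF k] x y in simp_all)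
    then show ?thesis using KG[OF k] x y by simp
  qed
  define U where "U = {x \<in> carrier G. \<exists>v. k \<otimes>\<^bsub>G\<^esub> x = inv_letter l # v}"
  show ?thesis
  proof (rule that[of U])
    show "U \<subseteq> carrier G" by (auto simp: U_def)
    fix x y
    have fl: "fst (inv_letter l) \<notin> S" using l by (simp add: inv_letter_def)
    show "x = y" if "x \<in> U" "y \<in> U" "x \<otimes>\<^bsub>G\<^esub> inv\<^bsub>G\<^esub> y \<in> K"
      using that fl by (intro transversal[OF _ _ kK]) (auto simp: U_def)
    assume x: "x \<in> carrier G - U" and y: "y \<in> carrier G - U"
      and xy: "(s \<otimes>\<^bsub>G\<^esub> x) \<otimes>\<^bsub>G\<^esub> inv\<^bsub>G\<^esub> (s \<otimes>\<^bsub>G\<^esub> y) \<in> K"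
    have norm: "\<exists>v. inv\<^bsub>G\<^esub> p \<otimes>\<^bsub>G\<^esub> (s \<otimes>\<^bsub>G\<^esub> x) = l' # v" if x: "x \<in> carrier G - U" for x
    proof -
      define w where "w = k \<otimes>\<^bsub>G\<^esub> x"
      have wG: "w \<in> carrier G" using x KG[OF kK] by (simp add: w_def)
      have "w = [] \<or> hd w \<noteq> inv_letter l"
        using x by (cases w) (auto simp: U_def w_def)
      then have red: "reduced_word ((s' @ [l]) @ w)"
        using sred(1) wG unfolding reduced_append G_def free_group_carrier by simp
      have "s \<otimes>\<^bsub>G\<^esub> x = foldr letter_mult (s' @ [l]) (foldr letter_mult k x)"
        by (simp add: G_def free_group_mult s_eq)
      also have "foldr letter_mult k x = w" by (simp add: w_def G_def free_group_mult)
      also have "foldr letter_mult (s' @ [l]) w = (p @ l' # q) @ w"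
        using red by (simp only: foldr_letter_mult_reduced sp)
      finally have sx: "s \<otimes>\<^bsub>G\<^esub> x = p @ (l' # q @ w)" by simp
      have red': "reduced_word (p @ (l' # q @ w))" using red unfolding sp by simp
      have "reduced_word (l' # q @ w)" using red' unfolding reduced_append[of p] by blast
      then have tG: "l' # q @ w \<in> carrier G"
        using sred(2) wG unfolding sp by (simp add: G_def free_group_carrier)
      have "p \<otimes>\<^bsub>G\<^esub> (l' # q @ w) = s \<otimes>\<^bsub>G\<^esub> x"
        unfolding sx using red' by (simp add: G_def free_group_mult foldr_letter_mult_reduced)
      then have "inv\<^bsub>G\<^esub> p \<otimes>\<^bsub>G\<^esub> (s \<otimes>\<^bsub>G\<^esub> x) = l' # q @ w"
        using tG KG[OF pK] by (simp add: m_assoc[symmetric] flip: \<open>p \<otimes>\<^bsub>G\<^esub> _ = _\<close>)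
      then show ?thesis by blast
    qed
    have "s \<otimes>\<^bsub>G\<^esub> x = s \<otimes>\<^bsub>G\<^esub> y"
      using norm[OF x] norm[OF y] x y sG l'
      by (intro transversal[OF _ _ subgroup.m_inv_closed[OF K pK] xy]) auto
    then show "x = y" using x y sG by simp
  qed
qed

lemma free_group_generator_pow:
  assumes "r \<in> R"
  shows "[(r, True)] \<in> carrier (free_group R)" "inj (\<lambda>n::nat. [(r, True)] [^]\<^bsub>free_group R\<^esub> n)"
proof -
  show p: "[(r, True)] \<in> carrier (free_group R)"
    using assms by (simp add: free_group_carrier reduced_word_def)
  interpret group "free_group R" by (rule group_free_group)
  have "[(r, True)] [^]\<^bsub>free_group R\<^esub> n = replicate n (r, True)" for n :: nat
  proof (induction n)
    case (Suc n)
    have "[(r, True)] [^]\<^bsub>free_group R\<^esub> Suc n = [(r, True)] \<otimes>\<^bsub>free_group R\<^esub> [(r, True)] [^]\<^bsub>free_group R\<^esub> n"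
      by (rule nat_pow_Suc2[OF p])
    then show ?case using Suc by (cases n) (simp_all add: free_group_mult inv_letter_def)
  qed (simp add: free_group_one)
  then show "inj (\<lambda>n::nat. [(r, True)] [^]\<^bsub>free_group R\<^esub> n)"
    by (auto intro!: injI dest: arg_cong[of _ _ length])
qed


section \<open>Elements of the hereditary kernel of nearly full trace\<close>

lemma sum_roots_of_unity:
  fixes a b M :: nat
  defines "\<omega> \<equiv> cis (2 * pi / real M)"
  assumes "a < M" "b < M"
  shows "(\<Sum>j<M. cnj ((\<omega> ^ j) ^ a) * (\<omega> ^ j) ^ b) = (if a = b then of_nat M else 0)"
proof -
  define x where "x = cnj (\<omega> ^ a) * \<omega> ^ b"
  have \<omega>: "\<omega> ^ k = cis (2 * pi * real k / real M)" for k
    unfolding \<omega>_def Complex.DeMoivre by (simp add: mult_ac)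
  have "cnj ((\<omega> ^ j) ^ a) * (\<omega> ^ j) ^ b = x ^ j" for j
    by (simp add: x_def power_mult_distrib mult.commute flip: power_mult)
  then have sum: "(\<Sum>j<M. cnj ((\<omega> ^ j) ^ a) * (\<omega> ^ j) ^ b) = (\<Sum>j<M. x ^ j)" by simp
  have xa: "\<omega> ^ a * x = \<omega> ^ b"
    by (simp add: x_def \<omega> cis_cnj cis_mult flip: mult.assoc)
  show ?thesis
  proof (cases "a = b")
    case True
    then have "x = 1" using xa by (simp add: \<omega>)
    then show ?thesis using sum True by simp
  next
    case False
    have inj: "inj_on (\<lambda>k. cis (2 * pi * real k / real M)) {..<M}"
      using Complex.bij_betw_roots_unity[of M] assms by (simp add: bij_betw_def)
    have "x \<noteq> 1"
    proof
      assume "x = 1"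
      then have "\<omega> ^ a = \<omega> ^ b" using xa by simp
      then show False using inj_onD[OF inj, of a b] assms(2,3) False by (simp add: \<omega>)
    qed
    moreover have "x ^ M = 1"
    proof -
      have "\<omega> ^ M = 1" using assms(2) by (simp add: \<omega>)
      have "x ^ M = cnj ((\<omega> ^ M) ^ a) * (\<omega> ^ M) ^ b"
        by (simp add: x_def power_mult_distrib mult.commute flip: power_mult)
      then show ?thesis by (simp add: \<open>\<omega> ^ M = 1\<close>)
    qed
    ultimately show ?thesis using sum False by (simp add: geometric_sum)
  qed
qed

text \<open>Let r m be the number of pairs with sum m. These numbers add up to N^2 over the 2 N
  values m < 2 N, and Cauchy-Schwarz gives N^4 \<le> 2 N times the sum of their squares.\<close>

lemma additive_energy_ge:
  fixes N :: nat
  defines "P \<equiv> {..<N} \<times> {..<N}"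
  assumes "0 < N"
  shows "real N ^ 3 \<le> 2 * (\<Sum>i\<in>P. \<Sum>j\<in>P. if fst i + snd i = fst j + snd j then 1 else (0::real))"
proof -
  define z where "z i = fst i + snd i" for i :: "nat \<times> nat"
  define r where "r m = (\<Sum>i\<in>P. if z i = m then 1 else (0::real))" for m
  have finP: "finite P" by (simp add: P_def)
  have zP: "z i \<in> {..<2 * N}" if "i \<in> P" for i using that by (auto simp: P_def z_def)
  have one: "(\<Sum>m<2 * N. if z i = m then f m else 0) = f (z i)" if "i \<in> P" for f :: "nat \<Rightarrow> real" and i
    using zP[OF that] by simp
  have "(\<Sum>m<2 * N. r m) = (\<Sum>i\<in>P. \<Sum>m<2 * N. if z i = m then 1 else 0)"
    unfolding r_def by (rule sum.swap)
  also have "\<dots> = real (N * N)" using one[of _ "\<lambda>_. 1"] by (simp add: P_def)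
  finally have tot: "(\<Sum>m<2 * N. r m) = real (N * N)" .
  have r_sq: "(r m)\<^sup>2 = (\<Sum>i\<in>P. if z i = m then r m else 0)" for m
  proof -
    have "(r m)\<^sup>2 = (\<Sum>i\<in>P. if z i = m then 1 else 0) * r m" by (simp add: power2_eq_square r_def)
    also have "\<dots> = (\<Sum>i\<in>P. if z i = m then r m else 0)"
      unfolding sum_distrib_right by (rule sum.cong) auto
    finally show ?thesis .
  qed
  have "(\<Sum>m<2 * N. (r m)\<^sup>2) = (\<Sum>m<2 * N. \<Sum>i\<in>P. if z i = m then r m else 0)"
    unfolding r_sq ..
  also have "\<dots> = (\<Sum>i\<in>P. \<Sum>m<2 * N. if z i = m then r m else 0)" by (rule sum.swap)
  also have "\<dots> = (\<Sum>i\<in>P. r (z i))" by (intro sum.cong one refl)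
  finally have sq: "(\<Sum>m<2 * N. (r m)\<^sup>2) = (\<Sum>i\<in>P. \<Sum>j\<in>P. if z i = z j then 1 else 0)"
    by (simp add: r_def eq_commute)
  have "(real (N * N))\<^sup>2 \<le> real (2 * N) * (\<Sum>m<2 * N. (r m)\<^sup>2)"
    using sum_squared_le_sum_of_squares[of r "{..<2 * N}"] unfolding tot card_lessThan
    by (simp only: mult.commute)
  then have "real N * real N ^ 3 \<le> real N * (2 * (\<Sum>m<2 * N. (r m)\<^sup>2))"
    by (simp add: power2_eq_square power3_eq_cube mult_ac)
  then have "real N ^ 3 \<le> 2 * (\<Sum>m<2 * N. (r m)\<^sup>2)"
    using assms(2) by (simp only: mult_le_cancel_left)
  then show ?thesis unfolding sq z_def .
qed

context group
begin

text \<open>With \<open>F \<theta> = b \<theta> * b \<theta>\<close>, the average of \<open>star (F \<theta>) * F \<theta>\<close> over the \<open>2 N\<close>-th roots of unity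
  is a scalar, namely the additive energy of an interval.\<close>

lemma exists_large_square:
  assumes st: "irreducible_state (cstar (carrier G)) (lam \<one>) g" and p: "p \<in> carrier G" and "0 < N"
  defines "b \<equiv> \<lambda>\<theta>. \<Sum>k<N. cs (\<theta> ^ k) * lam (p [^] k)"
  obtains \<theta> where "cmod \<theta> = 1" "real N ^ 3 \<le> 2 * Re (g (star (b \<theta> * b \<theta>) * (b \<theta> * b \<theta>)))"
proof -
  interpret I: irreducible_state "cstar (carrier G)" "lam \<one>" g by (rule st)
  define P where "P = {..<N} \<times> {..<N}"
  define z where "z i = fst i + snd i" for i :: "nat \<times> nat"
  define L where "L k = lam (p [^] (k::nat))" for k
  have LA: "L k \<in> cstar (carrier G)" for k unfolding L_def using p by (intro lam_in_cstar) simp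
  have LL: "L k * L l = L (k + l)" for k l
    unfolding L_def using p by (simp add: lam_mult nat_pow_mult)
  have starLL: "star (L k) * L k = lam \<one>" for k
    unfolding L_def using p by (simp add: star_lam lam_mult)
  have bb: "b \<theta> * b \<theta> = (\<Sum>i\<in>P. cs (\<theta> ^ z i) * L (z i))" for \<theta>
  proof -
    have "b \<theta> * b \<theta> = (\<Sum>k<N. \<Sum>l<N. cs (\<theta> ^ (k + l)) * L (k + l))"
      unfolding b_def sum_product
      by (intro sum.cong refl)
        (simp add: power_add cs_mult mult.assoc LL[symmetric] cs_left_commute[of "L _"] flip: L_def)
    then show ?thesis by (simp add: sum.cartesian_product P_def z_def case_prod_unfold)
  qed
  define \<gamma> where "\<gamma> k l = g (star (L k) * L l)" for k l
  have form: "g (star (b \<theta> * b \<theta>) * (b \<theta> * b \<theta>)) = (\<Sum>i\<in>P. \<Sum>j\<in>P. (cnj (\<theta> ^ z i) * \<theta> ^ z j) * \<gamma> (z i) (z j))" for \<theta>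
  proof -
    have summand: "star (cs (\<theta> ^ z i) * L (z i)) * (cs (\<theta> ^ z j) * L (z j))
        = cs (cnj (\<theta> ^ z i) * \<theta> ^ z j) * (star (L (z i)) * L (z j))" for i j
      by (simp add: cs_mult mult.assoc cs_left_commute[of "star (L _)"] cs_commute[of "star (L _)"] del: complex_cnj_power)
    have "g (star (b \<theta> * b \<theta>) * (b \<theta> * b \<theta>)) = (\<Sum>i\<in>P. \<Sum>j\<in>P. g (star (cs (\<theta> ^ z i) * L (z i)) * (cs (\<theta> ^ z j) * L (z j))))"
    proof -
      have mem: "star (cs (\<theta> ^ z i) * L (z i)) * (cs (\<theta> ^ z j) * L (z j)) \<in> cstar (carrier G)" for i j
        by (intro I.mult I.star_closed I.cs_mult_closed LA)
      show ?thesis unfolding bb star_sum sum_product by (simp only: I.g_sum I.sum mem)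
    qed
    then show ?thesis
      unfolding summand using LA by (simp add: I.g_cs I.closure_rules \<gamma>_def del: complex_cnj_power)
  qed
  \<comment> \<open>All exponents \<open>z i\<close> are below 2 N, so the 2 N-th roots of unity
    separate them.\<close>
  define M where "M = 2 * N"
  define \<omega> where "\<omega> = cis (2 * pi / real M)"
  define q where "q = (\<Sum>i\<in>P. \<Sum>j\<in>P. if z i = z j then 1 else (0::real))"
  have q: "real N ^ 3 \<le> 2 * q"
    using additive_energy_ge[OF \<open>0 < N\<close>] by (simp add: q_def P_def z_def)
  have zM: "z i < M" if "i \<in> P" for i using that by (auto simp: P_def z_def M_def)
  have "(\<Sum>t<M. g (star (b (\<omega> ^ t) * b (\<omega> ^ t)) * (b (\<omega> ^ t) * b (\<omega> ^ t))))
      = (\<Sum>i\<in>P. \<Sum>j\<in>P. (\<Sum>t<M. cnj ((\<omega> ^ t) ^ z i) * (\<omega> ^ t) ^ z j) * \<gamma> (z i) (z j))"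
    unfolding form sum_distrib_right by (subst sum.swap) (intro sum.cong refl sum.swap)
  also have "\<dots> = (\<Sum>i\<in>P. \<Sum>j\<in>P. of_real (real M * (if z i = z j then 1 else 0)))"
    by (intro sum.cong refl, unfold \<omega>_def, subst sum_roots_of_unity[OF zM zM])
      (auto simp: \<gamma>_def starLL I.g_unit)
  also have "\<dots> = of_real (real M * q)" by (simp add: q_def sum_distrib_left)
  finally have avg: "(\<Sum>t<M. Re (g (star (b (\<omega> ^ t) * b (\<omega> ^ t)) * (b (\<omega> ^ t) * b (\<omega> ^ t))))) = real M * q"
    by (metis Re_complex_of_real Re_sum)
  \<comment> \<open>Some term is at least the average.\<close>
  have "\<exists>t<M. q \<le> Re (g (star (b (\<omega> ^ t) * b (\<omega> ^ t)) * (b (\<omega> ^ t) * b (\<omega> ^ t))))"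
  proof (rule ccontr)
    assume "\<not> ?thesis"
    moreover have "0 \<in> {..<M}" using \<open>0 < N\<close> by (simp add: M_def)
    then have "{..<M} \<noteq> {}" by blast
    ultimately have "(\<Sum>t<M. Re (g (star (b (\<omega> ^ t) * b (\<omega> ^ t)) * (b (\<omega> ^ t) * b (\<omega> ^ t))))) < (\<Sum>t<M. q)"
      by (intro sum_strict_mono) (auto simp: not_le)
    then show False using avg by simp
  qed
  then obtain t where "q \<le> Re (g (star (b (\<omega> ^ t) * b (\<omega> ^ t)) * (b (\<omega> ^ t) * b (\<omega> ^ t))))" by blast
  then show ?thesis using q by (intro that[of "\<omega> ^ t"]) (auto simp: \<omega>_def norm_power)
qed

lemma trace_le_norm: "cmod (trace a) \<le> norm a"
  using norm_coeff_le[of "a \<cdot> delta \<one>" \<one>] norm_act_le[of a "delta \<one>"] by (simp add: trace_def)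

text \<open>By transitivity the vector of \<open>y = b * b\<close> can be moved to the cyclic vector by an operator \<open>c\<close>
  of norm \<open>O(N powr (-3/2))\<close>, so \<open>l = 1 - c y\<close> lies in the left kernel.  Where \<open>l\<close> vanishes,
  \<open>c y = 1\<close>, and the trace of \<open>c y\<close> is at most \<open>norm c * N\<close>.\<close>

lemma her_nearly_full:
  assumes st: "irreducible_state (cstar (carrier G)) (lam \<one>) g" and p: "p \<in> carrier G" "inj (\<lambda>n::nat. p [^] n)"
    and "0 < \<epsilon>"
  obtains u where "u \<in> irreducible_state.her (cstar (carrier G)) g" "norm ((lam \<one> - u) \<cdot> delta \<one>) < \<epsilon>"
proof -
  interpret I: irreducible_state "cstar (carrier G)" "lam \<one>" g by (rule st)
  let ?A = "cstar (carrier G)" and ?e = "lam \<one>"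
  \<comment> \<open>Chosen so that norm c N \<le> 12 / sqrt N < \<epsilon>^2. Here 12 is the
    constant 6 of \<open>transitivity\<close> times 2, from N^(3/2) \<le> 2 sn (v v).\<close>
  obtain N :: nat where N: "12 / \<epsilon>\<^sup>2 < sqrt (real N)" "0 < N"
  proof -
    obtain n :: nat where n: "(12 / \<epsilon>\<^sup>2)\<^sup>2 < real n" using reals_Archimedean2 by blast
    then have "12 / \<epsilon>\<^sup>2 < sqrt (real n)" by (rule real_less_rsqrt)
    moreover have "0 < n" using n by (metis not_less0 of_nat_0 gr0I power2_less_0)
    ultimately show ?thesis using that by blast
  qed
  define b where "b \<theta> = (\<Sum>k<N. cs (\<theta> ^ k) * lam (p [^] k))" for \<theta>
  obtain \<theta> where \<theta>: "cmod \<theta> = 1" "real N ^ 3 \<le> 2 * Re (g (star (b \<theta> * b \<theta>) * (b \<theta> * b \<theta>)))"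
    using exists_large_square[OF st p(1) N(2)] unfolding b_def by blast
  define v where "v = b \<theta>"
  have pw: "p [^] k \<in> carrier G" for k :: nat using p by simp
  have v: "v \<in> ?A" unfolding v_def b_def
    by (intro I.sum I.cs_mult_closed lam_in_cstar pw)
  have vv: "v * v \<in> ?A" by (rule I.mult[OF v v])
  have norm_v: "norm (v \<cdot> delta \<one>) = sqrt N" "norm (star v \<cdot> delta \<one>) = sqrt N"
  proof -
    have 1: "v \<cdot> delta \<one> = (\<Sum>k<N. ell2_scaleC (\<theta> ^ k) (delta (p [^] k)))"
      by (simp add: v_def b_def act_sum act_simps lam_delta pw)
    have 2: "star v \<cdot> delta \<one> = (\<Sum>k<N. ell2_scaleC (cnj \<theta> ^ k) (delta (inv (p [^] k))))"
      by (simp add: v_def b_def star_sum act_sum act_simps star_lam lam_delta pw act_scaleC)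
    have "inj_on (\<lambda>k. p [^] k) {..<N}" using p(2) by (auto intro: inj_on_subset)
    then have "(norm (v \<cdot> delta \<one>))\<^sup>2 = N"
      unfolding 1 by (subst norm_sum_delta) (simp_all add: norm_power \<theta>)
    then show "norm (v \<cdot> delta \<one>) = sqrt N" by (metis norm_ge_zero real_sqrt_unique)
    have "inj_on (\<lambda>k. inv (p [^] k)) {..<N}"
    proof (rule inj_onI)
      fix k j :: nat assume "inv (p [^] k) = inv (p [^] j)"
      then have "p [^] k = p [^] j" using inv_inv[OF pw] by metis
      then show "k = j" by (rule injD[OF p(2)])
    qed
    then have "(norm (star v \<cdot> delta \<one>))\<^sup>2 = N"
      unfolding 2 by (subst norm_sum_delta) (simp_all add: norm_power \<theta>)
    then show "norm (star v \<cdot> delta \<one>) = sqrt N" by (metis norm_ge_zero real_sqrt_unique)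
  qed
  have sn2: "real N ^ 3 \<le> 2 * (I.sn (v * v))\<^sup>2"
    using \<theta>(2) I.sn_square[OF vv] by (simp add: v_def)
  then have "0 < (I.sn (v * v))\<^sup>2" using N(2) by (smt (verit) of_nat_0_less_iff zero_less_power)
  then have sn0: "0 < I.sn (v * v)" using I.sn_nonneg[OF vv] by (simp add: less_le)
  obtain c where c: "c \<in> ?A" "norm c \<le> 6 / I.sn (v * v)" "I.sn (?e - c * (v * v)) = 0"
    using I.transitivity[OF vv sn0] .
  have cN: "norm c * N \<le> 12 / sqrt N"
  proof -
    have "(sqrt N * N)\<^sup>2 \<le> (2 * I.sn (v * v))\<^sup>2"
    proof -
      have "(sqrt N * N)\<^sup>2 = real N ^ 3"
        unfolding power_mult_distrib real_sqrt_pow2[OF of_nat_0_le_iff] by (simp add: power2_eq_square power3_eq_cube)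
      also have "\<dots> \<le> 4 * (I.sn (v * v))\<^sup>2"
        using sn2 zero_le_power2[of "I.sn (v * v)"] by linarith
      finally show ?thesis by (simp add: power_mult_distrib)
    qed
    then have "sqrt N * N \<le> 2 * I.sn (v * v)"
      using sn0 by (intro power2_le_imp_le[of "sqrt N * N"]) auto
    then have "6 / I.sn (v * v) * N \<le> 12 / sqrt N"
      using sn0 N(2) by (simp add: field_simps)
    moreover have "norm c * N \<le> 6 / I.sn (v * v) * N" using c(2) by (intro mult_right_mono) auto
    ultimately show ?thesis by linarith
  qed
  define l where "l = ?e - c * (v * v)"
  have l: "l \<in> ?A" unfolding l_def by (rule I.diff[OF I.unit I.mult[OF c(1) vv]])
  define H where "H = star l * l"
  \<comment> \<open>Scales \<open>H\<close> to a contraction; the added 1 keeps the denominator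
    positive.\<close>
  define r where "r = 1 / (1 + norm H)"
  have r: "0 < r" by (simp add: r_def add_pos_nonneg)
  have H: "H \<in> I.her" "pos H"
    unfolding H_def by (rule I.star_mult_her[OF l c(3)[folded l_def]], rule pos_star_mult)
  interpret her: star_subalgebra I.her by (rule I.star_subalgebra_her)
  define h where "h = r *\<^sub>R H"
  define w where "w = (1 - h) * (1 - h)"
  have h: "h \<in> I.her" unfolding h_def by (rule her.scaleR[OF H(1)])
  interpret cp: contraction_powers h w
  proof
    show "pos h" unfolding h_def using H(2) r by (simp add: pos_scaleR)
    show "norm h \<le> 1" by (simp add: h_def r_def divide_le_eq_1 add_pos_nonneg)
  qed (rule w_def)
  have "(\<lambda>n. l * w ^ n) \<longlonglongrightarrow> 0"
  proof (rule cp.mult_w_power_tendsto_0)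
    show "pos ((1 / r) *\<^sub>R h - star l * l)" using r by (simp add: h_def flip: H_def)
  qed (use r in simp)
  then have "(\<lambda>n. norm (l * w ^ n)) \<longlonglongrightarrow> 0" by (rule tendsto_norm_zero)
  then have "\<forall>\<^sub>F n in sequentially. norm (l * w ^ n) < \<epsilon>\<^sup>2 - 12 / sqrt N"
  proof (rule order_tendstoD(2))
    have "12 < sqrt N * \<epsilon>\<^sup>2" using N(1) \<open>0 < \<epsilon>\<close> by (simp add: field_simps)
    then show "0 < \<epsilon>\<^sup>2 - 12 / sqrt N" using N(2) by (simp add: field_simps)
  qed
  then obtain n where n: "norm (l * w ^ n) < \<epsilon>\<^sup>2 - 12 / sqrt N" by (auto simp: eventually_sequentially)
  define u where "u = 1 - w ^ n"
  have u: "u \<in> I.her" unfolding u_def by (rule cp.one_diff_power_in[OF I.star_subalgebra_her h])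
  then have uA: "u \<in> ?A" by (simp add: I.her_def)
  define a where "a = ?e - u"
  have aA: "a \<in> ?A" unfolding a_def by (rule I.diff[OF I.unit uA])
  have a_eq: "?e * w ^ n = a" "w ^ n * ?e = a"
    using I.unit_left[OF uA] I.unit_right[OF uA] by (simp_all add: a_def u_def algebra_simps)
  have a_conj: "a = star ?e * w ^ n * ?e"
    using I.unit_right[OF aA] by (simp add: I.star_unit a_eq)
  have pos_a: "pos a" unfolding a_conj by (intro pos_conj cp.pos_w_power)
  have norm_a: "norm a \<le> 1"
  proof -
    have "norm a \<le> norm ?e * norm (w ^ n)" unfolding a_eq(1)[symmetric] by (rule norm_mult_ineq)
    also have "\<dots> \<le> 1" using I.norm_unit cp.norm_w_power by (intro mult_le_one) auto
    finally show ?thesis .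
  qed
  have la: "l * w ^ n = l * a" using I.unit_right[OF l] by (metis a_eq(1) mult.assoc)
  have split: "a = c * v * (v * a) + l * a"
    using I.unit_left[OF aA] by (simp add: l_def left_diff_distrib mult.assoc)
  have "trace a = trace (c * v * (v * a)) + trace (l * a)"
    by (subst split) (simp add: trace_def act_simps coeff_simps)
  \<comment> \<open>The trace property places one factor \<open>v\<close> on each side. What remains
    is an inner product of vectors controlled by the two 2-norms of \<open>v\<close> and by norm a
    norm c.\<close>
  also have "trace (c * v * (v * a)) = trace (v * a * (c * v))"
    by (rule trace_commute) (use c v aA in \<open>auto intro: I.mult\<close>)
  finally have "cmod (trace a) \<le> cmod (trace (v * a * (c * v))) + cmod (trace (l * a))"
    by (simp add: norm_triangle_ineq)
  also have "cmod (trace (v * a * (c * v))) \<le> norm c * N"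
  proof -
    have "trace (v * a * (c * v)) = ell2_cinner (star v \<cdot> delta \<one>) (a \<cdot> c \<cdot> v \<cdot> delta \<one>)"
      by (simp add: trace_def act_simps act_star_cinner cinner_delta)
    also have "cmod \<dots> \<le> sqrt N * norm (a \<cdot> c \<cdot> v \<cdot> delta \<one>)"
      using cinner_Cauchy_Schwarz[of "star v \<cdot> delta \<one>"] by (simp add: norm_v)
    also have "norm (a \<cdot> c \<cdot> v \<cdot> delta \<one>) \<le> 1 * (norm c * sqrt N)"
    proof -
      have "norm (a \<cdot> c \<cdot> v \<cdot> delta \<one>) \<le> norm a * norm (c \<cdot> v \<cdot> delta \<one>)" by (rule norm_act_le)
      also have "\<dots> \<le> 1 * (norm c * norm (v \<cdot> delta \<one>))"
        by (intro mult_mono norm_a norm_act_le) auto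
      finally show ?thesis by (simp only: norm_v)
    qed
    finally show ?thesis by (simp add: mult.left_commute mult_left_mono)
  qed
  also have "cmod (trace (l * a)) \<le> norm (l * w ^ n)" unfolding la by (rule trace_le_norm)
  finally have tr: "cmod (trace a) < \<epsilon>\<^sup>2" using cN n by linarith
  \<comment> \<open>As a a \<le> a, a small trace of \<open>a\<close> gives a small 2-norm.\<close>
  have "pos (a - a * a)" by (rule pos_diff_square[OF pos_a norm_a])
  then have "inner (delta \<one>) ((a * a) \<cdot> delta \<one>) \<le> inner (delta \<one>) (a \<cdot> delta \<one>)"
    by (simp add: pos_def act_simps inner_diff_right)
  also have "\<dots> \<le> cmod (trace a)"
    by (simp add: inner_ell2_def cinner_delta trace_def complex_Re_le_cmod)
  also have "inner (delta \<one>) ((a * a) \<cdot> delta \<one>) = (norm (a \<cdot> delta \<one>))\<^sup>2"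
    using act_star_inner[of a "delta \<one>" "a \<cdot> delta \<one>"] pos_star[OF pos_a]
    by (simp add: act_simps power2_norm_eq_inner)
  finally have "(norm (a \<cdot> delta \<one>))\<^sup>2 < \<epsilon>\<^sup>2" using tr by linarith
  then have "norm (a \<cdot> delta \<one>) < \<epsilon>" using \<open>0 < \<epsilon>\<close> by (simp add: power_less_imp_less_base)
  then show ?thesis using that u by (simp add: a_def)
qed

end


section \<open>Separable subalgebras\<close>

text \<open>A sum of the \<open>star (x k) * x k\<close> with positive weights that make it converge
  with norm at most 1. Omitting the other, positive terms shows that it dominates a multiple of
  each.\<close>

lemma dominating_element:
  assumes B: "star_subalgebra B" and x: "\<And>k. x k \<in> B"
  obtains h where "h \<in> B" "pos h" "norm h \<le> 1" "\<And>k::nat. \<exists>C\<ge>0. pos (C *\<^sub>R h - star (x k) * x k)"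
proof -
  interpret B: star_subalgebra B by (rule B)
  define t where "t k = (1/2) ^ Suc k / (1 + (norm (x k))\<^sup>2)" for k
  define y where "y k = t k *\<^sub>R (star (x k) * x k)" for k
  have t: "0 < t k" for k by (simp add: t_def add_pos_nonneg)
  have pos_y: "pos (y k)" for k unfolding y_def using t[of k] by (intro pos_scaleR pos_star_mult) simp
  have yB: "y k \<in> B" for k unfolding y_def by (intro B.closure_rules x)
  have norm_y: "norm (y k) \<le> (1/2) ^ Suc k" for k
  proof -
    have "norm (y k) = (1/2) ^ Suc k * ((norm (x k))\<^sup>2 / (1 + (norm (x k))\<^sup>2))"
      using t[of k] by (simp add: y_def norm_star_mult t_def)
    also have "\<dots> \<le> (1/2) ^ Suc k * 1"
      by (intro mult_left_mono) (simp_all add: divide_le_eq_1 add_pos_nonneg)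
    finally show ?thesis by simp
  qed
  have geo: "(\<lambda>k. (1/2::real) ^ Suc k) sums 1" using power_half_series .
  have summ: "summable (\<lambda>k. norm (y k))"
    using norm_y by (intro summable_comparison_test'[OF sums_summable[OF geo], of 0]) auto
  define h where "h = (\<Sum>k. y k)"
  have lim: "(\<lambda>n. \<Sum>k<n. y k) \<longlonglongrightarrow> h"
    using summable_norm_cancel[OF summ] by (simp add: h_def summable_LIMSEQ)
  have pos_sum: "pos (\<Sum>k\<in>I. y k)" for I
    by (induction I rule: infinite_finite_induct) (auto intro: pos_add pos_y)
  show ?thesis
  proof (rule that[of h])
    show "h \<in> B" by (rule B.limit[OF _ lim]) (intro B.sum yB)
    show "pos h" by (rule pos_limit[OF lim pos_sum])
    have "norm h \<le> (\<Sum>k. norm (y k))" unfolding h_def by (rule summable_norm[OF summ])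
    also have "\<dots> \<le> (\<Sum>k. (1/2) ^ Suc k)" by (rule suminf_le[OF norm_y summ sums_summable[OF geo]])
    finally show "norm h \<le> 1" using sums_unique[OF geo] by simp
    fix k
    have "pos (h - y k)"
    proof (rule pos_limit)
      show "(\<lambda>n. (\<Sum>j<n + Suc k. y j) - y k) \<longlonglongrightarrow> h - y k"
        by (intro tendsto_intros LIMSEQ_ignore_initial_segment lim)
      have "(\<Sum>j<n + Suc k. y j) - y k = (\<Sum>j\<in>{..<n + Suc k} - {k}. y j)" for n
        by (simp add: sum_diff1)
      then show "pos ((\<Sum>j<n + Suc k. y j) - y k)" for n using pos_sum by simp
    qed
    then have "pos ((1 / t k) *\<^sub>R (h - y k))" using t[of k] by (intro pos_scaleR) auto
    then have "pos ((1 / t k) *\<^sub>R h - star (x k) * x k)"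
      using t[of k] by (simp add: scaleR_diff_right y_def)
    then show "\<exists>C\<ge>0. pos (C *\<^sub>R h - star (x k) * x k)"
      using t[of k] by (intro exI[of _ "1 / t k"]) (simp add: less_imp_le)
  qed
qed

text \<open>Points of \<open>D\<close> need not lie in \<open>X\<close>, so for each point d and
  each precision m a nearby point of \<open>X\<close> is chosen when there is one.\<close>

lemma countable_dense_subset:
  fixes D :: "'b::metric_space set"
  assumes "countable D" "X \<subseteq> closure D" "X \<noteq> {}"
  obtains x :: "nat \<Rightarrow> 'b" where "\<And>k. x k \<in> X" "\<And>y r. y \<in> X \<Longrightarrow> 0 < r \<Longrightarrow> \<exists>k. dist y (x k) < r"
proof -
  define Y where "Y = {(d, m::nat). d \<in> D \<and> (\<exists>y\<in>X. dist y d < inverse (real (Suc m)))}"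
  have "\<forall>i\<in>Y. \<exists>y\<in>X. dist y (fst i) < inverse (real (Suc (snd i)))" by (auto simp: Y_def)
  then obtain \<phi> where \<phi>: "\<And>i. i \<in> Y \<Longrightarrow> \<phi> i \<in> X \<and> dist (\<phi> i) (fst i) < inverse (real (Suc (snd i)))"
    by metis
  have "Y \<subseteq> D \<times> UNIV" by (auto simp: Y_def)
  then have "countable Y" using assms(1) by (meson countable_SIGMA countable_subset countableI_type)
  have dense: "\<exists>i\<in>Y. dist y (\<phi> i) < r" if y: "y \<in> X" and r: "0 < r" for y r
  proof -
    obtain m where m: "inverse (real (Suc m)) < r / 2" using reals_Archimedean[OF half_gt_zero[OF r]] by blast
    have "y \<in> closure D" "0 < inverse (real (Suc m))" using assms(2) y by auto
    then obtain d where d: "d \<in> D" "dist d y < inverse (real (Suc m))"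
      unfolding closure_approachable by blast
    then have i: "(d, m) \<in> Y" using y by (auto simp: Y_def dist_commute)
    have "dist y (\<phi> (d, m)) \<le> dist d y + dist (\<phi> (d, m)) d"
      by (metis dist_commute dist_triangle2 add.commute)
    also have "\<dots> < r" using \<phi>[OF i] d(2) m by simp
    finally show ?thesis using i by blast
  qed
  have "Y \<noteq> {}" using dense[of _ 1] assms(3) by fastforce
  show ?thesis
  proof (rule that[of "\<lambda>k. \<phi> (from_nat_into Y k)"])
    show "\<phi> (from_nat_into Y k) \<in> X" for k
      using \<phi>[OF from_nat_into[OF \<open>Y \<noteq> {}\<close>]] by blast
    show "\<exists>k. dist y (\<phi> (from_nat_into Y k)) < r" if yr: "y \<in> X" "0 < r" for y r
      using dense[OF yr] from_nat_into_surj[OF \<open>countable Y\<close>] by metis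
  qed
qed

lemma (in group) cstar_countable_dense:
  assumes "countable K" "K \<subseteq> carrier G"
  obtains D where "countable D" "cstar K \<subseteq> closure D"
proof -
  obtain Q :: "complex set" where Q: "countable Q" "\<And>X. open X \<Longrightarrow> X \<noteq> {} \<Longrightarrow> \<exists>d\<in>Q. d \<in> X"
    using countable_dense_setE by blast
  \<comment> \<open>Polynomials are coded by lists of pairs, which makes their countability that of
    \<open>lists\<close>.\<close>
  define D where "D = (\<lambda>xs. \<Sum>(s, c)\<leftarrow>xs. cs c * lam s) ` lists (K \<times> Q)"
  have "countable D" unfolding D_def using assms(1) Q(1) by (intro countable_image countable_lists) auto
  have "poly_alg K \<subseteq> closure D"
  proof
    fix a assume "a \<in> poly_alg K"
    then obtain F c where F: "a = lin F c" "finite F" "F \<subseteq> K" by (auto simp: poly_alg_def)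
    show "a \<in> closure D"
      unfolding closure_approachable
    proof (intro allI impI)
      fix r :: real assume "0 < r"
      define \<delta> where "\<delta> = r / (1 + real (card F))"
      have \<delta>: "0 < \<delta>" using \<open>0 < r\<close> by (simp add: \<delta>_def)
      have "\<exists>d\<in>Q. dist (c s) d < \<delta>" for s
        using Q(2)[of "ball (c s) \<delta>"] \<delta> by auto
      then obtain d where d: "\<And>s. d s \<in> Q" "\<And>s. dist (c s) (d s) < \<delta>" by metis
      obtain ys where ys: "set ys = F" "distinct ys" using finite_distinct_list[OF F(2)] by blast
      have "lin F d = (\<Sum>(s, c)\<leftarrow>map (\<lambda>s. (s, d s)) ys. cs c * lam s)"
        unfolding lin_def using sum.distinct_set_conv_list[OF ys(2)] ys(1) by (simp add: o_def)
      then have "lin F d \<in> D" unfolding D_def using ys(1) F(3) d(1)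
        by (intro image_eqI[of _ _ "map (\<lambda>s. (s, d s)) ys"]) auto
      moreover have "dist (lin F d) a < r"
      proof -
        have "dist (lin F d) a = norm (lin F (\<lambda>s. d s - c s))" by (simp add: dist_norm F(1) lin_diff)
        also have "\<dots> \<le> (\<Sum>s\<in>F. \<delta>)"
          unfolding lin_def
        proof (rule order_trans[OF norm_sum sum_mono])
          fix s assume "s \<in> F"
          then have "norm (lam s) \<le> 1" using F(3) assms(2) by (intro norm_lam_le) auto
          then have "norm (cs (d s - c s) * lam s) \<le> cmod (d s - c s) * 1"
            by (intro order_trans[OF norm_mult_ineq] mult_mono) auto
          then show "norm (cs (d s - c s) * lam s) \<le> \<delta>"
            using d(2)[of s] by (simp add: dist_norm norm_minus_commute)
        qed
        also have "\<dots> = real (card F) * \<delta>" by simp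
        also have "\<dots> < (1 + real (card F)) * \<delta>" using \<delta> by (simp add: distrib_right)
        also have "\<dots> = r" by (simp add: \<delta>_def)
        finally show ?thesis .
      qed
      ultimately show "\<exists>y\<in>D. dist y a < r" by blast
    qed
  qed
  then have "cstar K \<subseteq> closure D" unfolding cstar_def by (simp add: closure_minimal)
  then show ?thesis using that \<open>countable D\<close> by blast
qed

text \<open>Each of countably many approximating polynomials involves finitely many words, hence
  finitely many letters.\<close>

lemma free_group_countable_support:
  assumes "a \<in> group.cstar (free_group R) (carrier (free_group R))"
  obtains S where "countable S" "S \<subseteq> R" "a \<in> group.cstar (free_group R) (carrier (free_group S))"
proof -
  interpret group "free_group R" by (rule group_free_group)
  obtain q where q: "\<And>n. q n \<in> poly_alg (carrier (free_group R))" "q \<longlonglongrightarrow> a"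
    using assms by (auto simp: cstar_limit_poly)
  have "\<exists>F c. finite F \<and> F \<subseteq> carrier (free_group R) \<and> q n = lin F c" for n
    using q(1)[of n] by (auto simp: poly_alg_def)
  then obtain F c where F: "\<And>n. finite (F n)" "\<And>n. F n \<subseteq> carrier (free_group R)" "\<And>n. q n = lin (F n) (c n)"
    by metis
  define S where "S = (\<Union>n. \<Union>w\<in>F n. fst ` set w)"
  have "countable (\<Union>w\<in>F n. fst ` set w)" for n
    by (rule countable_finite) (use F(1) in auto)
  then have "countable S" unfolding S_def by (intro countable_UN[OF countableI_type])
  moreover have "S \<subseteq> R" unfolding S_def using F(2) by (fastforce simp: free_group_carrier)
  moreover have "F n \<subseteq> carrier (free_group S)" for n
    using F(2)[of n] by (force simp: free_group_carrier S_def)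
  then have "a \<in> cstar (carrier (free_group S))"
    unfolding cstar_limit_poly using F q by (intro exI[of _ q]) (auto simp: poly_alg_def)
  ultimately show ?thesis using that by blast
qed


section \<open>The approximate unit\<close>

text \<open>The conclusion is about one element \<open>h\<close> and powers of (1 - h) (1 - h), so
  that both the approximate unit and the strictly positive element can be read off from it.\<close>

lemma free_group_approximate_unit:
  fixes R :: "'r set"
  assumes st: "irreducible_state (group.cstar (free_group R) (carrier (free_group R))) (group.lam (free_group R) []) g"
    and "R \<noteq> {}"
  obtains h where "h \<in> irreducible_state.her (group.cstar (free_group R) (carrier (free_group R))) g"
    "pos h" "norm h \<le> 1"
    "\<And>b. b \<in> irreducible_state.her (group.cstar (free_group R) (carrier (free_group R))) g \<Longrightarrow>
      (\<lambda>n. b * ((1 - h) * (1 - h)) ^ n) \<longlonglongrightarrow> 0"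
proof -
  define G where "G = free_group R"
  interpret group G unfolding G_def by (rule group_free_group)
  have one: "\<one>\<^bsub>G\<^esub> = []" by (simp add: G_def free_group_one)
  define A where "A = cstar (carrier G)"
  define e where "e = lam \<one>\<^bsub>G\<^esub>"
  have stA: "irreducible_state (cstar (carrier G)) (lam \<one>\<^bsub>G\<^esub>) g" using st by (simp add: G_def one[unfolded G_def])
  interpret I: irreducible_state A e g using stA by (simp add: A_def e_def)
  interpret her: star_subalgebra I.her by (rule I.star_subalgebra_her)
  obtain r where r: "r \<in> R" using \<open>R \<noteq> {}\<close> by blast
  have "\<exists>u\<in>I.her. norm ((e - u) \<cdot> delta \<one>\<^bsub>G\<^esub>) < inverse (real (Suc k))" for k
    using her_nearly_full[OF stA free_group_generator_pow[OF r, folded G_def], of "inverse (real (Suc k))"]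
    by (auto simp: A_def e_def)
  then obtain u where u: "\<And>k. u k \<in> I.her" "\<And>k. norm ((e - u k) \<cdot> delta \<one>\<^bsub>G\<^esub>) < inverse (real (Suc k))" by metis
  have "\<exists>S. countable S \<and> S \<subseteq> R \<and> u k \<in> cstar (carrier (free_group S))" for k
  proof -
    have "u k \<in> A" using u(1)[of k] by (simp add: I.her_def)
    then obtain S where "countable S" "S \<subseteq> R" "u k \<in> cstar (carrier (free_group S))"
      using free_group_countable_support[of "u k" R] unfolding A_def G_def by blast
    then show ?thesis by blast
  qed
  then obtain Sk where Sk: "\<And>k. countable (Sk k)" "\<And>k. Sk k \<subseteq> R" "\<And>k. u k \<in> cstar (carrier (free_group (Sk k)))"
    by metis
  define S where "S = (\<Union>k. Sk k)"
  define K where "K = carrier (free_group S)"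
  have S: "countable S" "S \<subseteq> R" using Sk by (auto simp: S_def)
  have K: "subgroup K G" unfolding K_def G_def by (rule subgroup_free_group[OF S(2)])
  note KG = subgroup.subset[OF K]
  have "K \<subseteq> lists (S \<times> UNIV)" by (auto simp: K_def free_group_carrier)
  then have cK: "countable K"
    by (rule countable_subset) (intro countable_lists countable_SIGMA S(1) countableI_type)
  interpret K: unital_star_subalgebra "cstar K" e unfolding e_def by (rule unital_cstar[OF K])
  have KA: "cstar K \<subseteq> A" unfolding A_def by (rule cstar_mono[OF KG])
  have uK: "u k \<in> cstar K" for k
  proof -
    have "carrier (free_group (Sk k)) \<subseteq> K" by (fastforce simp: K_def free_group_carrier S_def)
    then show ?thesis using Sk(3) cstar_mono by blast
  qed
  define B where "B = I.her \<inter> cstar K"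
  have B: "star_subalgebra B"
    unfolding B_def
    by unfold_locales (auto simp: K.closure_rules her.closure_rules intro: K.closed her.closed)
  interpret B: star_subalgebra B by (rule B)
  obtain D where D: "countable D" "cstar K \<subseteq> closure D"
    using cstar_countable_dense[OF cK KG] .
  have "B \<subseteq> closure D" "B \<noteq> {}" using D(2) B.zero by (auto simp: B_def)
  then obtain x :: "nat \<Rightarrow> 'r letter list bop" where x: "\<And>k. x k \<in> B" "\<And>y r. y \<in> B \<Longrightarrow> 0 < r \<Longrightarrow> \<exists>k. dist y (x k) < r"
    by (rule countable_dense_subset[OF D(1)]) (rule that)
  obtain h where h: "h \<in> B" "pos h" "norm h \<le> 1" "\<And>k. \<exists>C\<ge>0. pos (C *\<^sub>R h - star (x k) * x k)"
    by (rule dominating_element[of B x, OF B x(1)]) (rule that)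
  define w where "w = (1 - h) * (1 - h)"
  interpret cp: contraction_powers h w by unfold_locales (use h in \<open>auto simp: w_def\<close>)
  have Bw: "(\<lambda>n. d * w ^ n) \<longlonglongrightarrow> 0" if d: "d \<in> B" for d
  proof (rule metric_LIMSEQ_I)
    fix r :: real assume "0 < r"
    obtain k where k: "dist d (x k) < r / 2" using x(2)[OF d, of "r / 2"] \<open>0 < r\<close> by auto
    obtain C where "0 \<le> C" "pos (C *\<^sub>R h - star (x k) * x k)" using h(4) by blast
    then have "(\<lambda>n. x k * w ^ n) \<longlonglongrightarrow> 0" by (intro cp.mult_w_power_tendsto_0)
    from metric_LIMSEQ_D[OF this, of "r / 2"] \<open>0 < r\<close>
    obtain M where M: "\<And>n. n \<ge> M \<Longrightarrow> norm (x k * w ^ n) < r / 2" by (auto simp: dist_norm)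
    have "dist (d * w ^ n) 0 < r" if "n \<ge> M" for n
    proof -
      have "d * w ^ n = (d - x k) * w ^ n + x k * w ^ n" by (simp add: algebra_simps)
      then have "norm (d * w ^ n) \<le> norm ((d - x k) * w ^ n) + norm (x k * w ^ n)"
        by (simp add: norm_triangle_ineq)
      also have "norm ((d - x k) * w ^ n) \<le> norm (d - x k) * 1"
        using cp.norm_w_power[of n] by (intro order_trans[OF norm_mult_ineq] mult_left_mono) auto
      finally show ?thesis using M[OF that] k by (simp add: dist_norm)
    qed
    then show "\<exists>M. \<forall>n\<ge>M. dist (d * w ^ n) 0 < r" by blast
  qed
  define v where "v n = 1 - w ^ n" for n
  have vB: "v n \<in> B" for n unfolding v_def by (rule cp.one_diff_power_in[OF B h(1)])
  \<comment> \<open>The element \<open>w ^ n\<close> equals (1 - e) + a n. Only the second summand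
    lies in the algebra, and both act alike next to elements of the algebra.\<close>
  define a where "a n = e - v n" for n
  have aK: "a n \<in> cstar K" for n unfolding a_def using vB by (intro K.diff K.unit) (auto simp: B_def)
  have aA: "a n \<in> A" for n using aK KA by blast
  have ew: "e * w ^ n = a n" "w ^ n * e = a n" for n
    using vB[of n] K.unit_left[of "v n"] K.unit_right[of "v n"] by (auto simp: B_def a_def v_def algebra_simps)
  have star_a: "star (a n) = a n" for n
    unfolding a_def v_def by (simp add: K.star_unit del: star_power)
  have norm_a: "norm (a n) \<le> 1" for n
    unfolding ew(1)[symmetric] using K.norm_unit cp.norm_w_power[of n]
    by (intro order_trans[OF norm_mult_ineq] mult_le_one) auto
  have bw: "b * w ^ n = b * a n" if "b \<in> A" for b n
    using I.unit_right[OF that] ew(1) by (metis mult.assoc)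
  have delta: "e \<cdot> delta \<one>\<^bsub>G\<^esub> = delta \<one>\<^bsub>G\<^esub>" by (simp add: e_def lam_delta)
  \<comment> \<open>The vector is split by e = u k + (e - u k). The second part is small by the
    choice of \<open>u k\<close>, uniformly in n; the first is small for large n because
    \<open>u k\<close> lies in \<open>B\<close>. The adjoint of \<open>u k\<close> enters because
    \<open>Bw\<close> multiplies from the right.\<close>
  have a_delta: "(\<lambda>n. norm (a n \<cdot> delta \<one>\<^bsub>G\<^esub>)) \<longlonglongrightarrow> 0"
  proof (rule metric_LIMSEQ_I)
    fix r :: real assume "0 < r"
    obtain k where k: "inverse (real (Suc k)) < r / 2" using reals_Archimedean[of "r / 2"] \<open>0 < r\<close> by auto
    have sB: "star (u k) \<in> B" using u(1) uK by (simp add: B_def her.star_closed K.star_closed)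
    from metric_LIMSEQ_D[OF Bw[OF sB], of "r / 2"] \<open>0 < r\<close>
    obtain M where M: "\<And>n. n \<ge> M \<Longrightarrow> norm (star (u k) * w ^ n) < r / 2" by (auto simp: dist_norm)
    have "norm (a n \<cdot> delta \<one>\<^bsub>G\<^esub>) < r" if "n \<ge> M" for n
    proof -
      have "a n \<cdot> delta \<one>\<^bsub>G\<^esub> = (a n * u k) \<cdot> delta \<one>\<^bsub>G\<^esub> + a n \<cdot> ((e - u k) \<cdot> delta \<one>\<^bsub>G\<^esub>)"
        by (simp add: act_simps delta)
      then have "norm (a n \<cdot> delta \<one>\<^bsub>G\<^esub>) \<le> norm ((a n * u k) \<cdot> delta \<one>\<^bsub>G\<^esub>) + norm (a n \<cdot> ((e - u k) \<cdot> delta \<one>\<^bsub>G\<^esub>))"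
        by (metis norm_triangle_ineq)
      also have "norm ((a n * u k) \<cdot> delta \<one>\<^bsub>G\<^esub>) \<le> norm (a n * u k)"
        using norm_act_le[of "a n * u k" "delta \<one>\<^bsub>G\<^esub>"] by simp
      also have "norm (a n * u k) = norm (star (u k) * w ^ n)"
        using norm_star[of "a n * u k"] bw[of "star (u k)" n] sB KA by (auto simp: star_a B_def)
      also have "norm (a n \<cdot> ((e - u k) \<cdot> delta \<one>\<^bsub>G\<^esub>)) \<le> 1 * norm ((e - u k) \<cdot> delta \<one>\<^bsub>G\<^esub>)"
        using norm_a[of n] by (intro order_trans[OF norm_act_le] mult_right_mono) auto
      finally show ?thesis using M[OF that] u(2)[of k] k by linarith
    qed
    then show "\<exists>M. \<forall>n\<ge>M. dist (norm (a n \<cdot> delta \<one>\<^bsub>G\<^esub>)) 0 < r" by auto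
  qed
  have sandwich: "(\<lambda>n. a n * lam s * a n) \<longlonglongrightarrow> 0" if s: "s \<in> carrier G - K" for s
  proof -
    obtain U where U: "U \<subseteq> carrier G"
      "\<And>x y. x \<in> U \<Longrightarrow> y \<in> U \<Longrightarrow> x \<otimes>\<^bsub>G\<^esub> inv\<^bsub>G\<^esub> y \<in> K \<Longrightarrow> x = y"
      "\<And>x y. x \<in> carrier G - U \<Longrightarrow> y \<in> carrier G - U \<Longrightarrow>
        (s \<otimes>\<^bsub>G\<^esub> x) \<otimes>\<^bsub>G\<^esub> inv\<^bsub>G\<^esub> (s \<otimes>\<^bsub>G\<^esub> y) \<in> K \<Longrightarrow> x = y"
      using free_group_transversals[OF S(2), of s] s unfolding G_def K_def by blast
    have "norm (a n * lam s * a n) \<le> 2 * norm (a n \<cdot> delta \<one>\<^bsub>G\<^esub>)" for n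
    proof -
      have "norm (a n * lam s * a n) \<le> 2 * norm (a n) * norm (a n \<cdot> delta \<one>\<^bsub>G\<^esub>)"
        by (rule norm_sandwich_le[OF K aK star_a _ U]) (use s in auto)
      also have "\<dots> \<le> 2 * 1 * norm (a n \<cdot> delta \<one>\<^bsub>G\<^esub>)"
        using norm_a[of n] by (intro mult_right_mono) auto
      finally show ?thesis by simp
    qed
    moreover have "(\<lambda>n. 2 * norm (a n \<cdot> delta \<one>\<^bsub>G\<^esub>)) \<longlonglongrightarrow> 0"
      using tendsto_mult[OF tendsto_const a_delta, of 2] by simp
    ultimately show ?thesis
      by (rule Lim_null_comparison[OF always_eventually[OF allI]])
  qed
  have g_lam: "g (lam s) = 0" if s: "s \<in> carrier G - K" for s
  proof -
    have lA: "lam s \<in> A" using s unfolding A_def by (intro lam_in_cstar) auto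
    \<comment> \<open>Expanding a n = e - v n, every term but \<open>lam s\<close> has a factor
      \<open>v n\<close> in the hereditary kernel at one end, and \<open>g\<close> vanishes on
      it.\<close>
    have "g (a n * lam s * a n) = g (lam s)" for n
    proof -
      have vA: "v n \<in> A" "v n \<in> I.her" using vB[of n] by (auto simp: B_def I.her_def)
      have "a n * lam s * a n = lam s - lam s * v n - v n * (lam s - lam s * v n)"
        unfolding a_def using lA vA by (simp add: algebra_simps I.unit_left I.unit_right I.mult)
      then show ?thesis
        using lA vA by (simp add: I.g_diff I.g_mult_her I.closure_rules)
    qed
    moreover have "(\<lambda>n. g (a n * lam s * a n)) \<longlonglongrightarrow> g 0"
      using sandwich[OF s] lA aA by (intro I.g_tendsto I.mult)
    ultimately show ?thesis by (simp add: LIMSEQ_const_iff)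
  qed
  have "(\<lambda>n. b * w ^ n) \<longlonglongrightarrow> 0" if b: "b \<in> I.her" for b
  proof -
    have bA: "b \<in> A" "I.sn b = 0" using b by (auto simp: I.her_def)
    obtain q where q: "\<And>n. q n \<in> poly_alg (carrier G)" "q \<longlonglongrightarrow> b" using bA(1) unfolding A_def cstar_limit_poly by blast
    define T where "T n = star (q n) * q n" for n
    have T: "\<And>n. T n \<in> poly_alg (carrier G)" "\<And>n. pos (T n)" "T \<longlonglongrightarrow> star b * b"
      unfolding T_def using q subgroup_self
      by (auto intro!: poly_alg_mult poly_alg_star pos_star_mult tendsto_intros tendsto_star)
    obtain E d where E: "\<And>n. E n \<in> cstar K" "pos d" "E \<longlonglongrightarrow> d" "\<And>n. T n - E n \<in> poly_alg (carrier G - K)"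
      using conditional_expectation[OF K T] by blast
    have TA: "T n \<in> A" for n using T(1) poly_alg_subset unfolding A_def by blast
    have EA: "E n \<in> A" for n using E(1) KA by blast
    have "g (E n) = g (T n)" for n
    proof -
      obtain F c where F: "T n - E n = lin F c" "F \<subseteq> carrier G - K" using E(4)[of n] by (auto simp: poly_alg_def)
      have "lam s \<in> A" if "s \<in> F" for s using that F(2) unfolding A_def by (intro lam_in_cstar) auto
      then have "g (lin F c) = (\<Sum>s\<in>F. c s * g (lam s))"
        unfolding lin_def by (simp add: I.g_sum I.g_cs I.cs_mult_closed)
      also have "\<dots> = 0" using F(2) g_lam by (intro sum.neutral) auto
      finally show ?thesis using I.g_diff[OF TA EA, of n n] by (simp add: F(1))
    qed
    \<comment> \<open>\<open>g\<close> vanishes on the group elements outside \<open>K\<close>, so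
      it does not distinguish \<open>T n\<close> from \<open>E n\<close>.\<close>
    then have "(\<lambda>n. g (T n)) \<longlonglongrightarrow> g d" using I.g_tendsto[OF E(3) EA] by simp
    moreover have "(\<lambda>n. g (T n)) \<longlonglongrightarrow> g (star b * b)" by (rule I.g_tendsto[OF T(3) TA])
    ultimately have "g d = g (star b * b)" by (rule LIMSEQ_unique)
    also have "\<dots> = 0"
      using bA I.g_pos_Re(2)[OF bA(1)] I.sn_square[OF bA(1)] by (simp add: complex_eq_iff)
    finally have gd: "g d = 0" .
    have dK: "d \<in> cstar K" by (rule K.limit[OF E(1) E(3)])
    then have dB: "d \<in> B" unfolding B_def using I.pos_her[of d] gd E(2) KA by auto
    have ada: "(\<lambda>n. norm (a n * d * a n)) \<longlonglongrightarrow> 0"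
    proof (rule Lim_null_comparison[where g = "\<lambda>n. norm (d * w ^ n)"])
      show "\<forall>\<^sub>F n in sequentially. norm (norm (a n * d * a n)) \<le> norm (d * w ^ n)"
      proof (intro always_eventually allI)
        fix n
        have "norm (a n * (d * a n)) \<le> 1 * norm (d * a n)"
          using norm_a[of n] by (intro order_trans[OF norm_mult_ineq] mult_right_mono) auto
        then show "norm (norm (a n * d * a n)) \<le> norm (d * w ^ n)"
          using bw[of d n] dK KA by (auto simp: mult.assoc)
      qed
    qed (rule tendsto_norm_zero[OF Bw[OF dB]])
    have aTEa: "(\<lambda>n. norm (a n * (T k - E k) * a n)) \<longlonglongrightarrow> 0" for k
    proof -
      obtain F c where F: "T k - E k = lin F c" "F \<subseteq> carrier G - K" using E(4)[of k] by (auto simp: poly_alg_def)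
      have eq: "a n * (T k - E k) * a n = (\<Sum>s\<in>F. cs (c s) * (a n * lam s * a n))" for n
        by (simp add: F(1) lin_def sum_distrib_left sum_distrib_right mult.assoc cs_left_commute[of "a n"])
      have "(\<lambda>n. \<Sum>s\<in>F. cs (c s) * (a n * lam s * a n)) \<longlonglongrightarrow> (\<Sum>s\<in>F. cs (c s) * 0)"
        using F(2) by (intro tendsto_sum tendsto_mult tendsto_const sandwich) auto
      then show ?thesis unfolding eq by (simp add: tendsto_norm_zero)
    qed
    have small: "norm (a n * y * a n) \<le> norm y" for n y
    proof -
      have "norm (a n * y * a n) \<le> norm (a n) * norm y * norm (a n)"
        by (intro order_trans[OF norm_mult_ineq] mult_right_mono norm_mult_ineq) simp
      also have "\<dots> \<le> 1 * norm y * 1" using norm_a[of n] by (intro mult_mono) auto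
      finally show ?thesis by simp
    qed
    have "(\<lambda>n. norm (a n * (star b * b) * a n)) \<longlonglongrightarrow> 0"
    proof (rule metric_LIMSEQ_I)
      fix r :: real assume "0 < r"
      \<comment> \<open>The index \<open>k\<close> is fixed before n grows: two of the four pieces
        are small uniformly in n, and the other two tend to 0 for this k.\<close>
      have "\<forall>\<^sub>F k in sequentially. dist (T k) (star b * b) < r / 4" "\<forall>\<^sub>F k in sequentially. dist (E k) d < r / 4"
        using tendstoD[OF T(3), of "r / 4"] tendstoD[OF E(3), of "r / 4"] \<open>0 < r\<close> by simp_all
      then have "\<forall>\<^sub>F k in sequentially. dist (T k) (star b * b) < r / 4 \<and> dist (E k) d < r / 4"
        by (rule eventually_conj)
      then obtain k where k: "norm (star b * b - T k) < r / 4" "norm (E k - d) < r / 4"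
        by (auto simp: eventually_sequentially dist_norm norm_minus_commute)
      have "\<forall>\<^sub>F n in sequentially. norm (a n * (T k - E k) * a n) < r / 4"
        "\<forall>\<^sub>F n in sequentially. norm (a n * d * a n) < r / 4"
        using order_tendstoD(2)[OF aTEa[of k], of "r / 4"] order_tendstoD(2)[OF ada, of "r / 4"] \<open>0 < r\<close>
        by simp_all
      then have "\<forall>\<^sub>F n in sequentially. dist (norm (a n * (star b * b) * a n)) 0 < r"
      proof eventually_elim
        case (elim n)
        have "a n * (star b * b) * a n = a n * (star b * b - T k) * a n + a n * (T k - E k) * a n
            + a n * (E k - d) * a n + a n * d * a n"
          by (simp add: algebra_simps)
        then have "norm (a n * (star b * b) * a n) \<le> norm (a n * (star b * b - T k) * a n) + norm (a n * (T k - E k) * a n)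
            + norm (a n * (E k - d) * a n) + norm (a n * d * a n)"
          by (metis (no_types, lifting) norm_triangle_le add_mono order_refl)
        then show ?case using elim k small[of n "star b * b - T k"] small[of n "E k - d"] by simp
      qed
      then show "\<exists>M. \<forall>n\<ge>M. dist (norm (a n * (star b * b) * a n)) 0 < r"
        by (simp add: eventually_sequentially)
    qed
    moreover have "norm (a n * (star b * b) * a n) = (norm (b * w ^ n))\<^sup>2" for n
      unfolding bw[OF bA(1)] norm_star_mult[symmetric] by (simp add: star_a mult.assoc)
    ultimately have "(\<lambda>n. (norm (b * w ^ n))\<^sup>2) \<longlonglongrightarrow> 0" by simp
    from tendsto_real_sqrt[OF this] show ?thesis by (simp add: tendsto_norm_zero_iff)
  qed
  moreover have "h \<in> I.her" using h(1) by (simp add: B_def)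
  ultimately show ?thesis
    using that[of h] h(2,3) unfolding w_def A_def G_def by blast
qed


section \<open>Pure states and strictly positive elements\<close>

lemma op_of_star_mult: "op_of (star b * a) = op_adj (op_of b) o\<^sub>L op_of a"
  by (simp add: times_bop.rep_eq star.rep_eq)

lemma op_of_sum: "op_of (\<Sum>i\<in>I. f i) = (\<Sum>i\<in>I. op_of (f i))"
  by (induction I rule: infinite_finite_induct) (simp_all add: zero_bop.rep_eq plus_bop.rep_eq)

text \<open>\<open>op_of\<close> is isometric and its range is norm closed.\<close>

lemma closure_op_of: "closure (op_of ` X) = op_of ` closure X"
proof
  show "closure (op_of ` X) \<subseteq> op_of ` closure X"
  proof
    fix T assume "T \<in> closure (op_of ` X)"
    then obtain Y where Y: "\<And>n. Y n \<in> op_of ` X" "Y \<longlonglongrightarrow> T" by (auto simp: closure_sequential)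
    then have "\<forall>n. \<exists>a\<in>X. Y n = op_of a" by blast
    then obtain a where a: "\<And>n. a n \<in> X" "\<And>n. Y n = op_of (a n)" by metis
    have "(\<lambda>n. op_of (a n)) \<longlonglongrightarrow> T" using Y(2) by (simp flip: a(2))
    moreover from this have "op_of (Abs_bop T) = T"
      using adjoint_pair_limit[OF op_of_adjoint] by (intro Abs_bop_inverse) blast
    ultimately have "a \<longlonglongrightarrow> Abs_bop T" by (metis tendsto_op_of_iff)
    then have "Abs_bop T \<in> closure X" using a(1) by (auto simp: closure_sequential)
    then show "T \<in> op_of ` closure X" using \<open>op_of (Abs_bop T) = T\<close> by (metis image_eqI)
  qed
  show "op_of ` closure X \<subseteq> closure (op_of ` X)"
    by (force simp: closure_sequential tendsto_op_of_iff)
qed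

lemma (in group) reduced_group_cstar_eq: "reduced_group_cstar G = op_of ` cstar (carrier G)"
proof -
  have lin: "op_of (lin F c) = (\<Sum>s\<in>F. op_scaleC (c s) (left_regular G s))" if "F \<subseteq> carrier G" for F c
    unfolding lin_def op_of_sum by (rule sum.cong) (use that in \<open>auto simp: op_of_cs_mult op_of_lam\<close>)
  have "{\<Sum>s\<in>F. op_scaleC (c s) (left_regular G s) | F c. finite F \<and> F \<subseteq> carrier G} = op_of ` poly_alg (carrier G)"
  proof (rule Set.set_eqI, rule iffI)
    fix T assume "T \<in> {\<Sum>s\<in>F. op_scaleC (c s) (left_regular G s) | F c. finite F \<and> F \<subseteq> carrier G}"
    then obtain F c where "T = op_of (lin F c)" "finite F" "F \<subseteq> carrier G" using lin by auto
    then show "T \<in> op_of ` poly_alg (carrier G)" by (auto simp: poly_alg_def)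
  next
    fix T assume "T \<in> op_of ` poly_alg (carrier G)"
    then obtain F c where "T = op_of (lin F c)" "finite F" "F \<subseteq> carrier G" by (auto simp: poly_alg_def)
    then show "T \<in> {\<Sum>s\<in>F. op_scaleC (c s) (left_regular G s) | F c. finite F \<and> F \<subseteq> carrier G}"
      using lin by auto
  qed
  then show ?thesis by (simp add: reduced_group_cstar_def cstar_def closure_op_of)
qed

lemma op_positive_star_mult: "b \<in> B \<Longrightarrow> op_positive (op_of ` B) (op_of (star b * b))"
  unfolding op_positive_def op_of_star_mult by blast

text \<open>\<open>op_positive\<close> demands a factorisation inside the algebra; square roots stay
  in it even if it has no unit.\<close>

lemma (in star_subalgebra) op_positive_pos:
  assumes "a \<in> A" "pos a" shows "op_positive (op_of ` A) (op_of a)"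
proof -
  obtain r where "r \<in> A" "star r = r" "r * r = a" using sqrt_exists[OF assms] .
  then show ?thesis using op_positive_star_mult[of r A] by simp
qed

lemma cstar_state_simps:
  assumes "cstar_state (op_of ` B) \<phi>"
  shows "a \<in> B \<Longrightarrow> b \<in> B \<Longrightarrow> \<phi> (op_of (a + b)) = \<phi> (op_of a) + \<phi> (op_of b)"
    and "a \<in> B \<Longrightarrow> \<phi> (op_of (cs c * a)) = c * \<phi> (op_of a)"
    and "a \<in> B \<Longrightarrow> \<phi> (op_of (star a * a)) \<in> \<real>\<^sub>\<ge>\<^sub>0"
  using assms op_positive_star_mult[of a B]
  by (auto simp: cstar_state_def linear_functional_def plus_bop.rep_eq op_of_cs_mult)

lemma (in star_subalgebra) cstar_state_bound:
  assumes \<phi>: "cstar_state (op_of ` A) \<phi>" and a: "a \<in> A" shows "cmod (\<phi> (op_of a)) \<le> norm a"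
proof (cases "a = 0")
  case True
  have "\<phi> (op_of (cs 0 * a)) = 0 * \<phi> (op_of a)" by (rule cstar_state_simps(2)[OF \<phi> a])
  then show ?thesis using True by simp
next
  case False
  define b where "b = cs (of_real (1 / norm a)) * a"
  have "b \<in> A" unfolding b_def using a by (rule cs_mult_closed)
  moreover have "norm b \<le> 1" using False unfolding b_def cs_of_real by simp
  ultimately have mem: "cmod (\<phi> (op_of b)) \<in> {cmod (\<phi> a) | a. a \<in> op_of ` A \<and> norm a \<le> 1}" (is "_ \<in> ?V")
    by (auto simp: norm_bop.rep_eq)
  have "bdd_above ?V" "Sup ?V = 1" using \<phi> by (auto simp: cstar_state_def)
  then have "cmod (\<phi> (op_of b)) \<le> 1"
    using cSup_upper[OF mem] by simp
  have "\<phi> (op_of b) = of_real (1 / norm a) * \<phi> (op_of a)"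
    unfolding b_def by (rule cstar_state_simps(2)[OF \<phi> a])
  then show ?thesis
    using \<open>cmod (\<phi> (op_of b)) \<le> 1\<close> False by (simp add: norm_mult norm_divide divide_le_eq)
qed

lemma (in positive_functional) cstar_stateI:
  assumes "g e = 1" shows "cstar_state (op_of ` A) (\<lambda>T. g (Abs_bop T))"
  unfolding cstar_state_def linear_functional_def
proof (intro conjI allI ballI impI)
  fix S T assume "S \<in> op_of ` A"
  then obtain a where a: "S = op_of a" "a \<in> A" by blast
  show "g (Abs_bop (op_scaleC c S)) = c * g (Abs_bop S)" for c
    unfolding a(1) op_of_cs_mult[symmetric] op_of_inverse using a(2) by (rule g_cs)
  assume "T \<in> op_of ` A"
  then obtain b where b: "T = op_of b" "b \<in> A" by blast
  show "g (Abs_bop (S + T)) = g (Abs_bop S) + g (Abs_bop T)"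
    unfolding a(1) b(1) plus_bop.rep_eq[symmetric] op_of_inverse using a(2) b(2) by (rule g_add)
next
  fix T assume "op_positive (op_of ` A) T"
  then obtain b where b: "b \<in> A" "T = op_of (star b * b)" unfolding op_positive_def op_of_star_mult by blast
  show "g (Abs_bop T) \<in> \<real>\<^sub>\<ge>\<^sub>0" unfolding b(2) op_of_inverse using b(1) by (rule g_pos)
next
  let ?V = "{cmod (g (Abs_bop T)) | T. T \<in> op_of ` A \<and> norm T \<le> 1}"
  have le: "x \<le> 1" if xV: "x \<in> ?V" for x
  proof -
    obtain a where "x = cmod (g (Abs_bop (op_of a)))" "a \<in> A" "norm (op_of a) \<le> 1"
      using xV by blast
    then have a: "x = cmod (g a)" "a \<in> A" "norm a \<le> 1"
      by (simp_all add: op_of_inverse norm_bop.rep_eq)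
    then show ?thesis using g_bound[OF a(2)] assms by simp
  qed
  have "1 \<in> ?V"
    using unit norm_unit assms
    by (auto intro!: exI[of _ "op_of e"] simp: op_of_inverse simp flip: norm_bop.rep_eq)
  then show "Sup ?V = 1" using le by (intro cSup_eq_maximum)
  show "bdd_above ?V" using le by (rule bdd_aboveI)
qed

text \<open>The norm of a positive functional is its value at the unit, so norm 1 becomes \<phi> e =
  1. Convex decompositions of the functional then correspond to decompositions of \<phi> into
  states.\<close>

lemma (in unital_star_subalgebra) irreducible_state_of_pure_state:
  assumes "pure_state (op_of ` A) \<phi>" shows "irreducible_state A e (\<lambda>a. \<phi> (op_of a))"
proof -
  have \<phi>: "cstar_state (op_of ` A) \<phi>" using assms by (simp add: pure_state_def)
  interpret pf: positive_functional A e "\<lambda>a. \<phi> (op_of a)"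
    by unfold_locales (rule cstar_state_simps[OF \<phi>]; assumption)+
  have "\<phi> (op_of e) = 1"
  proof (rule complex_eqI)
    let ?V = "{cmod (\<phi> T) | T. T \<in> op_of ` A \<and> norm T \<le> 1}"
    have pos: "0 \<le> Re (\<phi> (op_of e))"
      using pf.g_pos_Re(1)[OF unit] by (simp add: star_unit unit_left unit)
    have "?V \<noteq> {}" using zero by (auto intro!: bexI[of _ 0] simp: zero_bop.rep_eq)
    moreover have "x \<le> Re (\<phi> (op_of e))" if xV: "x \<in> ?V" for x
    proof -
      obtain a where a: "x = cmod (\<phi> (op_of a))" "a \<in> A" "norm a \<le> 1"
        using xV by (auto simp flip: norm_bop.rep_eq)
      then show ?thesis using pf.g_bound[OF a(2)] mult_left_mono[OF a(3) pos] by simp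
    qed
    ultimately have "Sup ?V \<le> Re (\<phi> (op_of e))" by (rule cSup_least)
    moreover have "Re (\<phi> (op_of e)) \<le> 1"
      using cstar_state_bound[OF \<phi> unit] norm_unit complex_Re_le_cmod[of "\<phi> (op_of e)"] by linarith
    ultimately show "Re (\<phi> (op_of e)) = Re 1" using \<phi> by (simp add: cstar_state_def)
    show "Im (\<phi> (op_of e)) = Im 1"
      using pf.g_pos_Re(2)[OF unit] by (simp add: star_unit unit_left unit)
  qed
  then show ?thesis
  proof (rule pf.irreducible_stateI)
    fix \<psi> \<rho> t a
    assume \<psi>: "positive_functional A e \<psi>" "\<psi> e = 1" and \<rho>: "positive_functional A e \<rho>" "\<rho> e = 1"
      and t: "0 < t" "t < (1::real)" and eq: "\<And>a. a \<in> A \<Longrightarrow> \<phi> (op_of a) = t * \<psi> a + (1 - t) * \<rho> a"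
      and a: "a \<in> A"
    note pure = assms[unfolded pure_state_def, THEN conjunct2, rule_format]
    have "cstar_state (op_of ` A) (\<lambda>T. \<psi> (Abs_bop T))" "cstar_state (op_of ` A) (\<lambda>T. \<rho> (Abs_bop T))"
      by (rule positive_functional.cstar_stateI; fact)+
    moreover have "\<phi> T = complex_of_real t * \<psi> (Abs_bop T) + complex_of_real (1 - t) * \<rho> (Abs_bop T)"
      if "T \<in> op_of ` A" for T
      using that eq by (auto simp: op_of_inverse)
    ultimately have "\<psi> (Abs_bop (op_of a)) = \<phi> (op_of a)"
      using pure[OF _ _ t, of "\<lambda>T. \<psi> (Abs_bop T)" "\<lambda>T. \<rho> (Abs_bop T)" "op_of a"] a by blast
    then show "\<psi> a = \<phi> (op_of a)" by (simp add: op_of_inverse)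
  qed
qed

text \<open>The value to be compared with 0 is the sum of the squares of \<open>sn a\<close> and
  \<open>sn (star a)\<close>.\<close>

lemma (in irreducible_state) hereditary_kernel_eq:
  assumes g: "g = (\<lambda>a. \<phi> (op_of a))" shows "hereditary_kernel (op_of ` A) \<phi> = op_of ` her"
proof -
  have "\<phi> ((op_adj (op_of a) o\<^sub>L op_of a) + (op_of a o\<^sub>L op_adj (op_of a))) = 0 \<longleftrightarrow> sn a = 0 \<and> sn (star a) = 0"
    if a: "a \<in> A" for a
  proof -
    have sa: "star a \<in> A" using a by (rule star_closed)
    have sq: "g (star b * b) = of_real ((sn b)\<^sup>2)" if "b \<in> A" for b
      using g_pos_Re(2)[OF that] sn_square[OF that] by (simp add: complex_eq_iff)
    have "\<phi> ((op_adj (op_of a) o\<^sub>L op_of a) + (op_of a o\<^sub>L op_adj (op_of a))) = g (star a * a + star (star a) * star a)"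
      unfolding g by (simp add: plus_bop.rep_eq times_bop.rep_eq star.rep_eq[symmetric])
    also have "\<dots> = of_real ((sn a)\<^sup>2 + (sn (star a))\<^sup>2)"
      using a sa by (subst g_add) (auto simp only: mult star_closed sq of_real_add)
    finally show ?thesis by (simp only: of_real_eq_0_iff sum_power2_eq_zero_iff)
  qed
  then show ?thesis by (auto simp: hereditary_kernel_def her_def)
qed

section \<open>From the powers of a contraction to the two conclusions\<close>

context contraction_powers
begin

text \<open>All terms are polynomials in \<open>h\<close>, hence commute. The sequence increases
  because the powers of \<open>w\<close> decrease, and convergence on the left is the adjoint of
  convergence on the right.\<close>

lemma sequential_abelian_approximate_unitI:
  assumes B: "star_subalgebra B" "h \<in> B" and lim: "\<And>b. b \<in> B \<Longrightarrow> (\<lambda>n. b * w ^ n) \<longlonglongrightarrow> 0"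
  shows "sequential_abelian_approximate_unit (op_of ` B) (\<lambda>n. op_of (1 - w ^ n))"
  unfolding sequential_abelian_approximate_unit_def
proof (intro conjI allI impI ballI)
  interpret B: star_subalgebra B by (rule B(1))
  have uB: "1 - w ^ n \<in> B" for n by (rule one_diff_power_in[OF B])
  show "op_of (1 - w ^ n) \<in> op_of ` B" for n using uB by blast
  show "op_positive (op_of ` B) (op_of (1 - w ^ n))" for n
    by (rule B.op_positive_pos[OF uB pos_1_diff_w_power])
  show "norm (op_of (1 - w ^ n)) \<le> 1" for n
    using norm_le_1_of_pos[OF pos_1_diff_w_power, of n] pos_w_power[of n] by (simp flip: norm_bop.rep_eq)
  show "op_positive (op_of ` B) (op_of (1 - w ^ n) - op_of (1 - w ^ m))" if "m \<le> n" for m n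
  proof -
    have "(1 - w ^ n) - (1 - w ^ m) = w ^ m - w ^ n" by simp
    then show ?thesis
      using B.op_positive_pos[OF B.diff[OF uB[of n] uB[of m]]] pos_w_power_diff[OF that]
      by (simp flip: minus_bop.rep_eq)
  qed
  show "op_of (1 - w ^ m) o\<^sub>L op_of (1 - w ^ n) = op_of (1 - w ^ n) o\<^sub>L op_of (1 - w ^ m)" for m n
  proof -
    have "w ^ m * w ^ n = w ^ n * w ^ m" by (simp add: add.commute flip: power_add)
    then have "(1 - w ^ m) * (1 - w ^ n) = (1 - w ^ n) * (1 - w ^ m)" by (simp add: algebra_simps)
    then show ?thesis by (simp flip: times_bop.rep_eq)
  qed
  fix T assume "T \<in> op_of ` B"
  then obtain b where b: "T = op_of b" "b \<in> B" by blast
  have "(\<lambda>n. b - b * w ^ n) \<longlonglongrightarrow> b - 0" by (intro tendsto_intros lim b)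
  then have "(\<lambda>n. b * (1 - w ^ n)) \<longlonglongrightarrow> b" by (simp add: right_diff_distrib)
  then show "(\<lambda>n. T o\<^sub>L op_of (1 - w ^ n)) \<longlonglongrightarrow> T"
    unfolding b(1) times_bop.rep_eq[symmetric] tendsto_op_of_iff .
  have "(\<lambda>n. star (star b * w ^ n)) \<longlonglongrightarrow> star 0"
    by (intro tendsto_star lim B.star_closed b)
  then have "(\<lambda>n. w ^ n * b) \<longlonglongrightarrow> 0" by (simp del: star_power)
  then have "(\<lambda>n. b - w ^ n * b) \<longlonglongrightarrow> b - 0" by (intro tendsto_intros)
  then have "(\<lambda>n. (1 - w ^ n) * b) \<longlonglongrightarrow> b" by (simp add: left_diff_distrib)
  then show "(\<lambda>n. op_of (1 - w ^ n) o\<^sub>L T) \<longlonglongrightarrow> T"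
    unfolding b(1) times_bop.rep_eq[symmetric] tendsto_op_of_iff .
qed

text \<open>A state vanishing at \<open>h\<close> vanishes on h x for all x in \<open>B\<close>,
  hence on (1 - w^n) b, which is a combination of such products. These elements tend to b, so the
  state would be 0.\<close>

lemma strictly_positiveI:
  assumes B: "star_subalgebra B" "h \<in> B" and lim: "\<And>b. b \<in> B \<Longrightarrow> (\<lambda>n. b * w ^ n) \<longlonglongrightarrow> 0"
  shows "strictly_positive (op_of ` B) (op_of h)"
  unfolding strictly_positive_def
proof (intro conjI allI impI)
  interpret B: star_subalgebra B by (rule B(1))
  show "op_of h \<in> op_of ` B" using B(2) by blast
  show op: "op_positive (op_of ` B) (op_of h)" by (rule B.op_positive_pos[OF B(2) pos_h])
  fix \<psi> assume \<psi>: "cstar_state (op_of ` B) \<psi>"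
  define \<phi> where "\<phi> a = \<psi> (op_of a)" for a
  note \<phi>_simps = cstar_state_simps[OF \<psi>, folded \<phi>_def]
  have \<phi>_pos: "0 \<le> Re (\<phi> (star a * a))" "Im (\<phi> (star a * a)) = 0" if "a \<in> B" for a
    using \<phi>_simps(3)[OF that] by (auto simp: complex_nonneg_Reals_iff)
  have \<phi>_diff: "\<phi> (a - b) = \<phi> a - \<phi> b" if "a \<in> B" "b \<in> B" for a b
    using \<phi>_simps(1)[OF B.diff[OF that] that(2)] by simp
  obtain r where r: "r \<in> B" "star r = r" "r * r = h" using B.sqrt_exists[OF B(2) pos_h] .
  show "0 < Re (\<psi> (op_of h))"
  proof (rule ccontr)
    assume "\<not> 0 < Re (\<psi> (op_of h))"
    then have \<phi>h: "\<phi> (star r * r) = 0"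
      using \<phi>_pos[OF r(1)] by (simp add: r complex_eq_iff \<phi>_def)
    have \<phi>r: "\<phi> (r * x) = 0" if x: "x \<in> B" for x
    proof -
      define p q where "p = \<phi> (star x * r)" and "q = \<phi> (star r * x)"
      \<comment> \<open>\<open>B\<close> may have no unit, so Cauchy-Schwarz is replaced by a
        perturbation argument. As \<phi> (star r r) = 0, positivity at x + c r leaves only a term
        linear in c, which must vanish for all complex c.\<close>
      have form: "\<phi> (star (x + cs c * r) * (x + cs c * r)) = \<phi> (star x * x) + (c * p + cnj c * q)" for c
      proof -
        have "star (x + cs c * r) * (x + cs c * r)
            = star x * x + (cs c * (star x * r) + (cs (cnj c) * (star r * x) + cs (cnj c * c) * (star r * r)))"
          by (simp add: distrib_left distrib_right cs_mult mult.assoc cs_left_commute[of "star _"] cs_commute[of "star _"] r(2)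
              cs_left_commute[of r] cs_commute[of r])
        moreover have "star x * x \<in> B" "star x * r \<in> B" "star r * x \<in> B" "star r * r \<in> B"
          using x r(1) by (simp_all add: B.mult B.star_closed)
        ultimately show ?thesis
          by (simp only: \<phi>_simps(1,2) B.add B.cs_mult_closed \<phi>h p_def q_def mult_zero_right add_0_right)
      qed
      have Im0: "Im (c * p + cnj c * q) = 0" for c
      proof -
        have "x + cs c * r \<in> B" using x r(1) by (intro B.add B.cs_mult_closed)
        from \<phi>_pos(2)[OF this] \<phi>_pos(2)[OF x] show ?thesis unfolding form by simp
      qed
      have Re0: "Re (c * p + cnj c * q) = 0" for c
      proof (rule ccontr)
        define s where "s = Re (c * p + cnj c * q)"
        define X where "X = Re (\<phi> (star x * x))"
        assume "Re (c * p + cnj c * q) \<noteq> 0"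
        then have s: "s \<noteq> 0" by (simp add: s_def)
        \<comment> \<open>This makes X + t s equal to -1.\<close>
        define t where "t = - (X + 1) / s"
        have "0 \<le> Re (\<phi> (star (x + cs (of_real t * c) * r) * (x + cs (of_real t * c) * r)))"
          using x r(1) by (intro \<phi>_pos B.closure_rules)
        also have "\<dots> = X + t * s" unfolding form by (simp add: X_def s_def algebra_simps)
        finally show False using s by (simp add: t_def)
      qed
      have "q = 0"
        using Im0[of 1] Im0[of \<i>] Re0[of 1] Re0[of \<i>] by (simp add: complex_eq_iff)
      then show ?thesis by (simp add: q_def r)
    qed
    have \<phi>h0: "\<phi> (h * x) = 0" if "x \<in> B" for x
      using \<phi>r[of "r * x"] that r by (simp add: B.mult mult.assoc flip: r(3))
    have \<phi>0: "\<phi> b = 0" if b: "b \<in> B" for b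
    proof -
      have step: "(1 - (1 - h) ^ k) * b \<in> B \<and> \<phi> ((1 - (1 - h) ^ k) * b) = 0" for k
      proof (induction k)
        case 0
        have "\<phi> (cs 0 * b) = 0" using \<phi>_simps(2)[OF b, of 0] by simp
        then show ?case by (simp add: cs_0 B.zero)
      next
        case (Suc k)
        define y where "y = (1 - (1 - h) ^ k) * b"
        have y: "y \<in> B" "\<phi> y = 0" using Suc by (simp_all add: y_def)
        have eq: "(1 - (1 - h) ^ Suc k) * b = h * b + (y - h * y)"
          by (simp add: y_def algebra_simps)
        have hb: "h * b \<in> B" "h * y \<in> B" using B(2) b y by (auto intro: B.mult)
        show ?case
          unfolding eq using hb y b by (simp add: B.add B.diff \<phi>_simps(1) \<phi>_diff \<phi>h0)
      qed
      have u: "(1 - w ^ n) * b \<in> B" "\<phi> ((1 - w ^ n) * b) = 0" for n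
        using step[of "n + n"] by (simp_all add: w_power power_add)
      have le: "cmod (\<phi> b) \<le> norm (star b * w ^ n)" for n
      proof -
        have "\<phi> b = \<phi> (b - (1 - w ^ n) * b)" using \<phi>_diff[OF b u(1)] u(2) by simp
        also have "cmod \<dots> \<le> norm (b - (1 - w ^ n) * b)"
          using B.cstar_state_bound[OF \<psi> B.diff[OF b u(1)]] by (simp add: \<phi>_def)
        also have "b - (1 - w ^ n) * b = star (star b * w ^ n)" by (simp add: left_diff_distrib del: star_power)
        finally show ?thesis by (simp only: norm_star)
      qed
      have "(\<lambda>n. norm (star b * w ^ n)) \<longlonglongrightarrow> 0"
        by (intro tendsto_norm_zero lim B.star_closed b)
      then have "cmod (\<phi> b) \<le> 0" using le by (intro LIMSEQ_le_const) auto
      then show ?thesis by simp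
    qed
    have "{cmod (\<psi> T) | T. T \<in> op_of ` B \<and> norm T \<le> 1} = {0}"
      using \<phi>0 B.zero by (force simp: \<phi>_def zero_bop.rep_eq intro!: exI[of _ "op_of 0"])
    then show False using \<psi> by (simp add: cstar_state_def)
  qed
qed

end

theorem theorem0p5:
  fixes R :: "'r set" and g :: "'r letter list op \<Rightarrow> complex"
  assumes "\<exists>a\<in>R. \<exists>b\<in>R. a \<noteq> b"
    and "pure_state (reduced_group_cstar (free_group R)) g"
  shows "(\<exists>u. sequential_abelian_approximate_unit
              (hereditary_kernel (reduced_group_cstar (free_group R)) g) u) \<and>
         (\<exists>h. strictly_positive (hereditary_kernel (reduced_group_cstar (free_group R)) g) h)"
proof -
  interpret group "free_group R" by (rule group_free_group)
  let ?A = "cstar (carrier (free_group R))"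
  interpret unital_star_subalgebra ?A "lam []"
    using unital_cstar[OF subgroup_self] by (simp add: free_group_one)
  have st: "irreducible_state ?A (lam []) (\<lambda>a. g (op_of a))"
    using assms(2) by (intro irreducible_state_of_pure_state) (simp add: reduced_group_cstar_eq)
  interpret I: irreducible_state ?A "lam []" "\<lambda>a. g (op_of a)" by (rule st)
  have "R \<noteq> {}" using assms(1) by blast
  then obtain h where h: "h \<in> I.her" "pos h" "norm h \<le> 1"
    "\<And>b. b \<in> I.her \<Longrightarrow> (\<lambda>n. b * ((1 - h) * (1 - h)) ^ n) \<longlonglongrightarrow> 0"
    using free_group_approximate_unit[OF st] by blast
  interpret contraction_powers h "(1 - h) * (1 - h)"
    by unfold_locales (use h in auto)
  have eq: "hereditary_kernel (reduced_group_cstar (free_group R)) g = op_of ` I.her"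
    unfolding reduced_group_cstar_eq by (rule I.hereditary_kernel_eq) simp
  show ?thesis
    unfolding eq
    using sequential_abelian_approximate_unitI[OF I.star_subalgebra_her h(1,4)]
      strictly_positiveI[OF I.star_subalgebra_her h(1,4)] by blast
qed

end
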